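(* For every superpartition $\Lambda$ of bidegree $(n,m)$, we have $$S_\Lambda=\sum_{\Omega}K_{\Lambda,\Omega}\,\Omega!\sum_{I:\,\Lambda(I)=\Omega}(-1)^{\varepsilon(I)}m_I,$$ where $\Omega$ runs over the superpartitions of bidegree $(n,m)$ and $I$ over the set superpartitions of type $\Omega$.
   Context: Functions. Everything lives in the $\mathbb Q$-algebra of formal power series of bounded degree in $x_1,x_2,\dots$ and $\theta_1,\theta_2,\dots$ subject only to $x_i\theta_j=\theta_jx_i$ and $\theta_i\theta_j=-\theta_j\theta_i$ for all $i,j$ (so $\theta_i^2=0$; the $x_i$ do not commute with each other). Set superpartitions. $[n]=\{1,\dots,n\}$, $[n]_0=[n]\cup\{0\}$, $A^+=A\setminus\{0\}$. For $0\le m\le n+1$, a set superpartition of bidegree $(n,m)$ is a tuple $I=(I_1,\dots,I_k)$ of pairwise distinct nonempty subsets of $[n]_0$ (blocks) with $\bigcup I_i^+=[n]$, $I_i\cap I_j\subseteq\{0\}$ for $i\neq j$, $0\in I_i$ exactly for $i\le m$ (fermionic blocks), and $\min(I_i\setminus I_j)<\min(I_j\setminus I_i)$ for $i<j$, where $\min(\emptyset):=0$. $m_I$ is the sum of all words $\theta_{a_1}\cdots\theta_{a_m}x_{b_1}\cdots x_{b_n}$ with positive integer indices such that, for $i\in[m]$, $a_i=b_j$ iff $j\in I_i^+$, and, for $i,j\in[n]$, $b_i=b_j$ iff $i,j$ lie in the same block of $I$. Superpartitions. A superpartition of bidegree $(n,m)$ is $\Lambda=(\Lambda_1,\dots,\Lambda_m;\Lambda_{m+1},\dots,\Lambda_k)$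 of nonnegative integers with sum $n$, with $\Lambda_1>\dots>\Lambda_m\ge0$ and $\Lambda_{m+1}\ge\dots\ge\Lambda_k\ge1$; $\Lambda!=\Lambda_1!\cdots\Lambda_k!$. If the fermionic blocks of $I$ have pairwise different sizes, $\Lambda(I)$ (the type of $I$) is the superpartition with fermionic part the decreasing rearrangement of $(|I_1|-1,\dots,|I_m|-1)$ and other part the decreasing rearrangement of $(|I_{m+1}|,\dots,|I_k|)$; $\varepsilon(I)$ is the minimal number of transpositions needed to sort $(|I_1|-1,\dots,|I_m|-1)$ decreasingly. (The type is undefined otherwise.) Let $\Lambda^+$ be the decreasing rearrangement of $(\Lambda_1,\dots,\Lambda_k)$ and $\Lambda^\oplus$ that of $(\Lambda_1+1,\dots,\Lambda_m+1,\Lambda_{m+1},\dots,\Lambda_k)$. $\Lambda$ is identified with $(\Lambda^\oplus,\Lambda^+)$ and drawn as the Young diagram of $\Lambda^\oplus$ in which the cells of $\Lambda^\oplus/\Lambda^+$ are circles and the cells of $\Lambda^+$ are boxes. Circles are numbered from top to bottom; $\mathrm{df}(\Lambda)=m$ is their number. A skew diagram is a horizontal $r$-strip if it has $r$ cells, at most one in each column. Tableaux. Let $\bar{\mathbb N}_0=\{\bar0,\bar1,\bar2,\dots\}$ and $|a|=|\bar a|=a$. A super semistandard Young tableau of shape $\Lambda$ and weight $(\alpha_1,\dots,\alpha_r)$, $\alpha_i\in\mathbb N_0\cup\bar{\mathbb N}_0$, is a sequence of superpartitions $(\Lambda_{(0)},\dots,\Lambda_{(r)})$ with $\Lambda_{(0)}=\emptyset$,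 $\Lambda_{(r)}=\Lambda$ such that for each $i\in\{1,\dots,r\}$: (1) $\Lambda_{(i)}^+/\Lambda_{(i-1)}^+$ is a horizontal $|\alpha_i|$-strip. (2) If $\alpha_i\in\mathbb N_0$: $\mathrm{df}(\Lambda_{(i)})=\mathrm{df}(\Lambda_{(i-1)})$, and whenever the $j$th circle of $\Lambda_{(i-1)}$ is in row $t$, the $j$th circle of $\Lambda_{(i)}$ is in row $t$ if row $t$ of $\Lambda_{(i)}^+/\Lambda_{(i-1)}^+$ is empty, and in row $t+1$ if that row is nonempty. (3) If $\alpha_i\in\bar{\mathbb N}_0$: $\mathrm{df}(\Lambda_{(i)})=\mathrm{df}(\Lambda_{(i-1)})+1$; $\Lambda_{(i)}$ contains a unique circle (the new circle), say in column $c$, such that column $c$ of $\Lambda_{(i)}^+/\Lambda_{(i-1)}^+$ is empty and every column to the left of $c$ is nonempty in $\Lambda_{(i)}^+/\Lambda_{(i-1)}^+$; and the diagram obtained from $\Lambda_{(i)}$ by removing the new circle satisfies the conditions in (2) relative to $\Lambda_{(i-1)}$. Such a tableau $T$ is represented by filling the diagram of $\Lambda$: the boxes of $\Lambda^+_{(i)}/\Lambda^+_{(i-1)}$ get label $i$, and if $\alpha_i\in\bar{\mathbb N}_0$ the circle created at step $i$ (followed to its final position) gets label $i$. Tableaux giving the same filling (differing only by trailing weights $0$) are identified; $sSSYT(\Lambda)$ is the set of all fillings of shape $\Lambda$, of all weights (steps with $\alpha_i=0$ are allowed). $T^s_1,\dots,T^s_n$ are the boxes of $T$ in a fixed reading order,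 $T^a_1,\dots,T^a_m$ its circles from top to bottom, and $c(t)$ is the label of $t$. The Schur function is $$S_\Lambda=\sum_{T\in sSSYT(\Lambda)}\theta_{c(T^a_1)}\cdots\theta_{c(T^a_m)}\sum_{\sigma\in\mathfrak S_n}x_{c(T^s_{\sigma(1)})}\cdots x_{c(T^s_{\sigma(n)})}.$$ For $\Omega=(\Omega_1,\dots,\Omega_m;\Omega_{m+1},\dots,\Omega_k)$, $K_{\Lambda,\Omega}=\sum_T(-1)^{\mathrm{inv}(T)}$ over super semistandard Young tableaux $T$ of shape $\Lambda$ and weight $(\bar\Omega_1,\dots,\bar\Omega_m,\Omega_{m+1},\dots,\Omega_k)$, where $\mathrm{inv}(T)$ is the number of inversions of the word $c(T^a_1)\cdots c(T^a_m)$. *)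

theory Defs
  imports Complex_Main "HOL-Combinatorics.Permutations"
begin

section \<open>The algebra of power series in noncommuting and anticommuting variables\<close>

text \<open>
  Modulo the relations, every monomial is, up to sign, either zero or of the form
  \<open>\<theta>\<^sub>A w\<close>, where \<open>\<theta>\<^sub>A\<close> is the product of the \<open>\<theta>\<^sub>a\<close>, \<open>a \<in> A\<close>, in increasing order of the indices
  for a finite set \<open>A\<close> of positive integers, and \<open>w\<close> is a word in the \<open>x\<^sub>b\<close>, encoded as the list of
  its indices. A series is given by its coefficients with respect to these monomials.
\<close>

typedef superseries =
  "{f :: nat set \<Rightarrow> nat list \<Rightarrow> rat.
      \<exists>d. \<forall>A w. f A w \<noteq> 0 \<longrightarrow> finite A \<and> 0 \<notin> A \<and> 0 \<notin> set w \<and> card A + length w \<le> d}"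
  morphisms scoeff Abs_superseries
  by (rule exI[of _ "\<lambda>_ _. 0"]) simp

setup_lifting type_definition_superseries

lemma superseries_eqI: "(\<And>A w. scoeff f A w = scoeff g A w) \<Longrightarrow> f = g"
  by (metis ext scoeff_inject)

text \<open>\<open>\<theta>\<^sub>B \<theta>\<^sub>C = tsign B C \<theta>\<^sub>B\<^sub>\<union>\<^sub>C\<close> for disjoint \<open>B\<close>, \<open>C\<close>.\<close>

definition tsign :: "nat set \<Rightarrow> nat set \<Rightarrow> rat" where
  "tsign B C = (-1) ^ card {(b, c). b \<in> B \<and> c \<in> C \<and> c < b}"

definition splits :: "nat set \<Rightarrow> nat list \<Rightarrow> (nat set \<times> nat set \<times> nat list \<times> nat list) set" where
  "splits A w = {(B, C, u, v). B \<union> C = A \<and> B \<inter> C = {} \<and> u @ v = w}"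

lemma finite_splits: "finite A \<Longrightarrow> finite (splits A w)"
proof -
  assume A: "finite A"
  have "splits A w \<subseteq> Pow A \<times> Pow A \<times> (\<lambda>i. take i w) ` {..length w} \<times> (\<lambda>i. drop i w) ` {..length w}"
  proof
    fix p assume p: "p \<in> splits A w"
    obtain B C u v where pe: "p = (B, C, u, v)"
      by (metis prod_cases4)
    have "B \<subseteq> A" "C \<subseteq> A" "u = take (length u) w" "v = drop (length u) w" "length u \<le> length w"
      using p pe by (auto simp: splits_def)
    then show "p \<in> Pow A \<times> Pow A \<times> (\<lambda>i. take i w) ` {..length w} \<times> (\<lambda>i. drop i w) ` {..length w}"
      unfolding pe by blast
  qed
  then show ?thesis
    by (rule finite_subset) (use A in auto)
qed

lemma tsign_empty [simp]: "tsign {} C = 1" "tsign B {} = 1"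
  by (simp_all add: tsign_def)

lemma tsign_Un1:
  assumes "finite B" "finite C" "finite D" "B \<inter> C = {}"
  shows "tsign (B \<union> C) D = tsign B D * tsign C D"
proof -
  have "{(b, d). b \<in> B \<union> C \<and> d \<in> D \<and> d < b} =
      {(b, d). b \<in> B \<and> d \<in> D \<and> d < b} \<union> {(b, d). b \<in> C \<and> d \<in> D \<and> d < b}"
    by auto
  moreover have "finite {(b, d). b \<in> B \<and> d \<in> D \<and> d < b}" "finite {(b, d). b \<in> C \<and> d \<in> D \<and> d < b}"
    by (rule finite_subset[of _ "(B \<union> C) \<times> D"]; use assms in auto)+
  moreover have "{(b, d). b \<in> B \<and> d \<in> D \<and> d < b} \<inter> {(b, d). b \<in> C \<and> d \<in> D \<and> d < b} = {}"
    using assms by auto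
  ultimately show ?thesis
    by (simp add: tsign_def card_Un_disjoint power_add)
qed

lemma tsign_Un2:
  assumes "finite B" "finite C" "finite D" "C \<inter> D = {}"
  shows "tsign B (C \<union> D) = tsign B C * tsign B D"
proof -
  have "{(b, c). b \<in> B \<and> c \<in> C \<union> D \<and> c < b} =
      {(b, c). b \<in> B \<and> c \<in> C \<and> c < b} \<union> {(b, c). b \<in> B \<and> c \<in> D \<and> c < b}"
    by auto
  moreover have "finite {(b, c). b \<in> B \<and> c \<in> C \<and> c < b}" "finite {(b, c). b \<in> B \<and> c \<in> D \<and> c < b}"
    by (rule finite_subset[of _ "B \<times> (C \<union> D)"]; use assms in auto)+
  moreover have "{(b, c). b \<in> B \<and> c \<in> C \<and> c < b} \<inter> {(b, c). b \<in> B \<and> c \<in> D \<and> c < b} = {}"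
    using assms by auto
  ultimately show ?thesis
    by (simp add: tsign_def card_Un_disjoint power_add)
qed

definition conv :: "(nat set \<Rightarrow> nat list \<Rightarrow> rat) \<Rightarrow> (nat set \<Rightarrow> nat list \<Rightarrow> rat) \<Rightarrow>
    nat set \<Rightarrow> nat list \<Rightarrow> rat" where
  "conv f g A w = (\<Sum>(B, C, u, v) \<in> splits A w. tsign B C * f B u * g C v)"

lemma conv_infinite:
  assumes "infinite A" "\<And>A w. f A w \<noteq> 0 \<Longrightarrow> finite A" "\<And>A w. g A w \<noteq> 0 \<Longrightarrow> finite A"
  shows "conv f g A w = 0"
proof -
  have "tsign B C * f B u * g C v = 0" if "(B, C, u, v) \<in> splits A w" for B C u v
  proof -
    have "infinite B \<or> infinite C" using that assms(1) by (auto simp: splits_def)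
    then show ?thesis using assms(2)[of B u] assms(3)[of C v] by auto
  qed
  then show ?thesis unfolding conv_def by (intro sum.neutral) auto
qed

lemma conv_assoc:
  assumes A: "finite A"
  shows "conv (conv f g) h A w = conv f (conv g h) A w"
proof -
  have fin: "finite B" "finite C" if "(B, C, u, v) \<in> splits A w" for B C u v
    using that A by (auto simp: splits_def)
  let ?L = "\<lambda>((B, C, u, v), (B1, B2, u1, u2)).
      tsign B C * (tsign B1 B2 * f B1 u1 * g B2 u2) * h C v"
  let ?R = "\<lambda>((B, C, u, v), (C1, C2, v1, v2)).
      tsign B C * f B u * (tsign C1 C2 * g C1 v1 * h C2 v2)"
  let ?SL = "SIGMA p : splits A w. case p of (B, C, u, v) \<Rightarrow> splits B u"
  let ?SR = "SIGMA p : splits A w. case p of (B, C, u, v) \<Rightarrow> splits C v"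
  have "conv (conv f g) h A w =
      (\<Sum>p \<in> splits A w. \<Sum>q \<in> (case p of (B, C, u, v) \<Rightarrow> splits B u). ?L (p, q))"
    unfolding conv_def
    by (intro sum.cong refl) (auto simp: sum_distrib_left sum_distrib_right split_beta)
  also have "\<dots> = sum ?L ?SL"
    by (subst sum.Sigma) (auto simp: finite_splits A fin split: prod.splits)
  also have "\<dots> = sum ?R ?SR"
    by (rule sum.reindex_bij_witness[where
          i = "\<lambda>((B, C, u, v), (C1, C2, v1, v2)). ((B \<union> C1, C2, u @ v1, v2), (B, C1, u, v1))" and
          j = "\<lambda>((B, C, u, v), (B1, B2, u1, u2)). ((B1, B2 \<union> C, u1, u2 @ v), (B2, C, u2, v))"])
      (use A in \<open>auto simp: splits_def tsign_Un1 tsign_Un2 Int_Un_distrib Int_Un_distrib2\<close>)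
  also have "\<dots> = (\<Sum>p \<in> splits A w. \<Sum>q \<in> (case p of (B, C, u, v) \<Rightarrow> splits C v). ?R (p, q))"
    by (subst sum.Sigma) (auto simp: finite_splits A fin split: prod.splits)
  also have "\<dots> = conv f (conv g h) A w"
    unfolding conv_def
    by (intro sum.cong refl) (auto simp: sum_distrib_left split_beta)
  finally show ?thesis .
qed

lemma scoeff_finite: "scoeff f A w \<noteq> 0 \<Longrightarrow> finite A"
  using scoeff[of f] by auto

instantiation superseries :: ring_1
begin

lift_definition zero_superseries :: superseries is "\<lambda>_ _. 0"
  by simp

lift_definition one_superseries :: superseries is "\<lambda>A w. of_bool (A = {} \<and> w = [])"
  by (rule exI[of _ 0]) auto

lift_definition plus_superseries :: "superseries \<Rightarrow> superseries \<Rightarrow> superseries"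
  is "\<lambda>f g A w. f A w + g A w"
proof -
  fix f g :: "nat set \<Rightarrow> nat list \<Rightarrow> rat"
  assume "\<exists>d. \<forall>A w. f A w \<noteq> 0 \<longrightarrow> finite A \<and> 0 \<notin> A \<and> 0 \<notin> set w \<and> card A + length w \<le> d"
    "\<exists>d. \<forall>A w. g A w \<noteq> 0 \<longrightarrow> finite A \<and> 0 \<notin> A \<and> 0 \<notin> set w \<and> card A + length w \<le> d"
  then obtain d e where
    d: "\<And>A w. f A w \<noteq> 0 \<Longrightarrow> finite A \<and> 0 \<notin> A \<and> 0 \<notin> set w \<and> card A + length w \<le> d" and
    e: "\<And>A w. g A w \<noteq> 0 \<Longrightarrow> finite A \<and> 0 \<notin> A \<and> 0 \<notin> set w \<and> card A + length w \<le> e"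
    by blast
  have "finite A \<and> 0 \<notin> A \<and> 0 \<notin> set w \<and> card A + length w \<le> d + e" if "f A w + g A w \<noteq> 0" for A w
  proof (cases "f A w = 0")
    case True
    then show ?thesis using that e[of A w] by auto
  next
    case False
    then show ?thesis using d[of A w] by auto
  qed
  then show "\<exists>d. \<forall>A w. f A w + g A w \<noteq> 0 \<longrightarrow>
      finite A \<and> 0 \<notin> A \<and> 0 \<notin> set w \<and> card A + length w \<le> d"
    by blast
qed

lift_definition uminus_superseries :: "superseries \<Rightarrow> superseries" is "\<lambda>f A w. - f A w"
  by simp

definition minus_superseries :: "superseries \<Rightarrow> superseries \<Rightarrow> superseries" where
  "minus_superseries f g = f + (- g)"

lift_definition times_superseries :: "superseries \<Rightarrow> superseries \<Rightarrow> superseries" is conv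
proof -
  fix f g :: "nat set \<Rightarrow> nat list \<Rightarrow> rat"
  assume "\<exists>d. \<forall>A w. f A w \<noteq> 0 \<longrightarrow> finite A \<and> 0 \<notin> A \<and> 0 \<notin> set w \<and> card A + length w \<le> d"
    "\<exists>d. \<forall>A w. g A w \<noteq> 0 \<longrightarrow> finite A \<and> 0 \<notin> A \<and> 0 \<notin> set w \<and> card A + length w \<le> d"
  then obtain d e where
    d: "\<And>A w. f A w \<noteq> 0 \<Longrightarrow> finite A \<and> 0 \<notin> A \<and> 0 \<notin> set w \<and> card A + length w \<le> d" and
    e: "\<And>A w. g A w \<noteq> 0 \<Longrightarrow> finite A \<and> 0 \<notin> A \<and> 0 \<notin> set w \<and> card A + length w \<le> e"
    by blast
  have "finite A \<and> 0 \<notin> A \<and> 0 \<notin> set w \<and> card A + length w \<le> d + e" if nz: "conv f g A w \<noteq> 0" for A w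
  proof -
    from nz obtain p where p: "p \<in> splits A w"
      and pnz: "(case p of (B, C, u, v) \<Rightarrow> tsign B C * f B u * g C v) \<noteq> 0"
      unfolding conv_def by (meson sum.not_neutral_contains_not_neutral)
    obtain B C u v where pe: "p = (B, C, u, v)"
      by (metis prod_cases4)
    have "f B u \<noteq> 0" "g C v \<noteq> 0"
      using pnz pe by auto
    note de = d[OF this(1)] e[OF this(2)]
    have "A = B \<union> C" "B \<inter> C = {}" "w = u @ v"
      using p pe by (auto simp: splits_def)
    then show ?thesis
      using de by (auto simp: card_Un_disjoint)
  qed
  then show "\<exists>d. \<forall>A w. conv f g A w \<noteq> 0 \<longrightarrow>
      finite A \<and> 0 \<notin> A \<and> 0 \<notin> set w \<and> card A + length w \<le> d"
    by blast
qed

instance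
proof
  fix a b c :: superseries
  show "a * b * c = a * (b * c)"
  proof (rule superseries_eqI)
    fix A w
    show "scoeff (a * b * c) A w = scoeff (a * (b * c)) A w"
    proof (cases "finite A")
      case True
      then show ?thesis by (simp add: times_superseries.rep_eq conv_assoc)
    next
      case False
      then show ?thesis using scoeff_finite by metis
    qed
  qed
  show "1 * a = a"
  proof (rule superseries_eqI)
    fix A w
    show "scoeff (1 * a) A w = scoeff a A w"
    proof (cases "finite A")
      case True
      have "conv (scoeff 1) (scoeff a) A w = (\<Sum>p \<in> {({} :: nat set, A, [] :: nat list, w)}. scoeff a A w)"
        unfolding conv_def one_superseries.rep_eq
        by (rule sum.mono_neutral_cong_right) (use True finite_splits in \<open>auto simp: splits_def\<close>)
      then show ?thesis by (simp add: times_superseries.rep_eq)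
    next
      case False
      then show ?thesis using scoeff_finite by metis
    qed
  qed
  show "a * 1 = a"
  proof (rule superseries_eqI)
    fix A w
    show "scoeff (a * 1) A w = scoeff a A w"
    proof (cases "finite A")
      case True
      have "conv (scoeff a) (scoeff 1) A w = (\<Sum>p \<in> {(A, {} :: nat set, w, [] :: nat list)}. scoeff a A w)"
        unfolding conv_def one_superseries.rep_eq
        by (rule sum.mono_neutral_cong_right) (use True finite_splits in \<open>auto simp: splits_def\<close>)
      then show ?thesis by (simp add: times_superseries.rep_eq)
    next
      case False
      then show ?thesis using scoeff_finite by metis
    qed
  qed
  show "(a + b) * c = a * c + b * c" "a * (b + c) = a * b + a * c"
    by (rule superseries_eqI,
        simp add: times_superseries.rep_eq plus_superseries.rep_eq conv_def split_beta
          algebra_simps sum.distrib)+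
  show "a + b + c = a + (b + c)" "a + b = b + a" "0 + a = a" "- a + a = 0" "a - b = a + - b"
    by (rule superseries_eqI, simp add: minus_superseries_def plus_superseries.rep_eq
        zero_superseries.rep_eq uminus_superseries.rep_eq)+
  show "(0::superseries) \<noteq> 1"
  proof
    assume "(0::superseries) = 1"
    then have "scoeff 0 {} [] = scoeff 1 {} []" by simp
    then show False by (simp add: zero_superseries.rep_eq one_superseries.rep_eq)
  qed
qed

end

text \<open>The variables are \<open>x\<^sub>1, x\<^sub>2, \<dots>\<close> and \<open>\<theta>\<^sub>1, \<theta>\<^sub>2, \<dots>\<close>; for the index 0 both functions return 0.\<close>

lift_definition xvar :: "nat \<Rightarrow> superseries" is "\<lambda>i A w. of_bool (0 < i \<and> A = {} \<and> w = [i])"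
  by (rule exI[of _ 1]) auto

lift_definition theta :: "nat \<Rightarrow> superseries" is "\<lambda>i A w. of_bool (0 < i \<and> A = {i} \<and> w = [])"
  by (rule exI[of _ 1]) auto

lemma xvar_theta_commute: "xvar i * theta j = theta j * xvar i"
proof (rule superseries_eqI)
  fix A w
  show "scoeff (xvar i * theta j) A w = scoeff (theta j * xvar i) A w"
  proof (cases "finite A")
    case True
    let ?c = "of_bool (0 < i \<and> 0 < j \<and> A = {j} \<and> w = [i]) :: rat"
    have "conv (scoeff (xvar i)) (scoeff (theta j)) A w = (\<Sum>p \<in> {({} :: nat set, A, w, [] :: nat list)}. ?c)"
      unfolding conv_def xvar.rep_eq theta.rep_eq
      by (rule sum.mono_neutral_cong_right) (use True finite_splits in \<open>auto simp: splits_def\<close>)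
    moreover have "conv (scoeff (theta j)) (scoeff (xvar i)) A w = (\<Sum>p \<in> {(A, {} :: nat set, [] :: nat list, w)}. ?c)"
      unfolding conv_def xvar.rep_eq theta.rep_eq
      by (rule sum.mono_neutral_cong_right) (use True finite_splits in \<open>auto simp: splits_def\<close>)
    ultimately show ?thesis by (simp add: times_superseries.rep_eq)
  next
    case False
    then show ?thesis using scoeff_finite by metis
  qed
qed

lemma theta_anticommute: "theta i * theta j = - (theta j * theta i)"
proof (rule superseries_eqI)
  fix A w
  have main: "conv (scoeff (theta i)) (scoeff (theta j)) A w =
      of_bool (0 < i \<and> 0 < j \<and> i \<noteq> j \<and> A = {i, j} \<and> w = []) * (if j < i then -1 else 1)"
    if "finite A" for i j
  proof -
    have ts: "tsign {i} {j} = (if j < i then -1 else 1)"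
    proof -
      have "{(b, c). b \<in> {i} \<and> c \<in> {j} \<and> c < b} = (if j < i then {(i, j)} else {})"
        by auto
      then show ?thesis by (simp add: tsign_def)
    qed
    let ?P = "0 < i \<and> 0 < j \<and> i \<noteq> j \<and> A = {i, j} \<and> w = []"
    let ?s = "if j < i then -1 else 1 :: rat"
    have "conv (scoeff (theta i)) (scoeff (theta j)) A w =
        (\<Sum>p \<in> splits A w. if p = ({i}, {j}, [], []) then of_bool ?P * ?s else 0)"
      unfolding conv_def theta.rep_eq
    proof (rule sum.cong[OF refl])
      fix p assume p: "p \<in> splits A w"
      obtain B C u v where pe: "p = (B, C, u, v)"
        by (metis prod_cases4)
      show "(case p of (B, C, u, v) \<Rightarrow> tsign B C * of_bool (0 < i \<and> B = {i} \<and> u = []) *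
            of_bool (0 < j \<and> C = {j} \<and> v = [])) =
          (if p = ({i}, {j}, [], []) then of_bool ?P * ?s else 0)"
      proof (cases "p = ({i}, {j}, [], [])")
        case True
        then have "A = {i, j}" "i \<noteq> j" "w = []"
          using p by (auto simp: splits_def)
        then show ?thesis using True by (simp add: ts)
      next
        case False
        then have "\<not> (B = {i} \<and> u = []) \<or> \<not> (C = {j} \<and> v = [])"
          using pe by blast
        then show ?thesis unfolding if_not_P[OF False] unfolding pe prod.case by auto
      qed
    qed
    also have "\<dots> = (if ({i}, {j}, [], []) \<in> splits A w then of_bool ?P * ?s else 0)"
      by (rule sum.delta) (use that finite_splits in blast)
    also have "\<dots> = of_bool ?P * ?s"
    proof (cases ?P)
      case True
      then have "({i}, {j}, [], []) \<in> splits A w"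
        unfolding splits_def by blast
      then show ?thesis by simp
    next
      case False
      then show ?thesis by simp
    qed
    finally show ?thesis .
  qed
  show "scoeff (theta i * theta j) A w = scoeff (- (theta j * theta i)) A w"
  proof (cases "finite A")
    case True
    define Q where "Q i j \<longleftrightarrow> 0 < i \<and> 0 < j \<and> i \<noteq> j \<and> A = {i, j} \<and> w = []" for i j
    have "Q j i = Q i j" unfolding Q_def by (metis insert_commute)
    moreover have "i \<noteq> j" if "Q i j" using that by (simp add: Q_def)
    ultimately show ?thesis
      unfolding times_superseries.rep_eq uminus_superseries.rep_eq main[OF True] Q_def[symmetric]
      by (cases i j rule: linorder_cases) auto
  next
    case False
    then show ?thesis using scoeff_finite by metis
  qed
qed

lemma theta_square: "theta i * theta i = 0"
proof (rule superseries_eqI)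
  fix A w
  have "scoeff (theta i * theta i) A w = - scoeff (theta i * theta i) A w"
    by (metis theta_anticommute uminus_superseries.rep_eq)
  then show "scoeff (theta i * theta i) A w = scoeff 0 A w"
    unfolding zero_superseries.rep_eq by linarith
qed

definition super_word :: "nat list \<Rightarrow> nat list \<Rightarrow> superseries" where
  "super_word as bs = prod_list (map theta as) * prod_list (map xvar bs)"

text \<open>
  Formal sum of a possibly infinite family, computed coefficientwise. It is meant for families of
  uniformly bounded degree in which every monomial occurs in only finitely many members.
\<close>

definition formal_sum :: "('a \<Rightarrow> superseries) \<Rightarrow> 'a set \<Rightarrow> superseries" where
  "formal_sum f S = Abs_superseries (\<lambda>A w. \<Sum>s \<in> {s \<in> S. scoeff (f s) A w \<noteq> 0}. scoeff (f s) A w)"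

lemma scoeff_formal_sum:
  assumes "\<And>s A w. s \<in> S \<Longrightarrow> scoeff (f s) A w \<noteq> 0 \<Longrightarrow> card A + length w \<le> d"
  shows "scoeff (formal_sum f S) A w = (\<Sum>s \<in> {s \<in> S. scoeff (f s) A w \<noteq> 0}. scoeff (f s) A w)"
proof -
  let ?g = "\<lambda>A w. \<Sum>s \<in> {s \<in> S. scoeff (f s) A w \<noteq> 0}. scoeff (f s) A w"
  have "finite A \<and> 0 \<notin> A \<and> 0 \<notin> set w \<and> card A + length w \<le> d" if nz: "?g A w \<noteq> 0" for A w
  proof -
    from nz obtain s where "s \<in> S" "scoeff (f s) A w \<noteq> 0"
      using sum.not_neutral_contains_not_neutral by blast
    then show ?thesis using assms[of s A w] scoeff[of "f s"] by auto
  qed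
  then have "scoeff (Abs_superseries ?g) = ?g"
    by (intro Abs_superseries_inverse) blast
  then show ?thesis by (simp add: formal_sum_def)
qed


section \<open>Superpartitions\<close>

text \<open>The pair \<open>(fs, bs)\<close> stands for \<open>(\<Lambda>\<^sub>1, \<dots>, \<Lambda>\<^sub>m; \<Lambda>\<^sub>m\<^sub>+\<^sub>1, \<dots>, \<Lambda>\<^sub>k)\<close>.\<close>

type_synonym spart = "nat list \<times> nat list"

definition superpartition :: "nat \<Rightarrow> nat \<Rightarrow> spart \<Rightarrow> bool" where
  "superpartition n m \<Lambda> \<longleftrightarrow> (case \<Lambda> of (fs, bs) \<Rightarrow>
     length fs = m \<and> sorted_wrt (>) fs \<and> sorted_wrt (\<ge>) bs \<and> (\<forall>b \<in> set bs. 1 \<le> b) \<and>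
     sum_list fs + sum_list bs = n)"

definition sp_fact :: "spart \<Rightarrow> nat" where
  "sp_fact \<Lambda> = prod_list (map fact (fst \<Lambda> @ snd \<Lambda>))"

definition df :: "spart \<Rightarrow> nat" where
  "df \<Lambda> = length (fst \<Lambda>)"

definition decreasing :: "nat list \<Rightarrow> nat list" where
  "decreasing xs = rev (sort xs)"

definition sp_plus :: "spart \<Rightarrow> nat list" where
  "sp_plus \<Lambda> = decreasing (fst \<Lambda> @ snd \<Lambda>)"

definition sp_oplus :: "spart \<Rightarrow> nat list" where
  "sp_oplus \<Lambda> = decreasing (map Suc (fst \<Lambda>) @ snd \<Lambda>)"

text \<open>
  The cells (row, column) of the Young diagram of a partition, rows and columns being numbered
  from 1, listed row by row from top to bottom and from left to right in each row.
\<close>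

definition young :: "nat list \<Rightarrow> (nat \<times> nat) list" where
  "young ps = [(t, c). t \<leftarrow> [1..<length ps + 1], c \<leftarrow> [1..<ps ! (t - 1) + 1]]"

definition boxes :: "spart \<Rightarrow> (nat \<times> nat) list" where
  "boxes \<Lambda> = young (sp_plus \<Lambda>)"

definition circles :: "spart \<Rightarrow> (nat \<times> nat) list" where
  "circles \<Lambda> = filter (\<lambda>z. z \<notin> set (boxes \<Lambda>)) (young (sp_oplus \<Lambda>))"


section \<open>Super semistandard Young tableaux\<close>

text \<open>\<open>Plain a\<close> and \<open>Barred a\<close> are the elements \<open>a\<close> and \<open>\<bar>a\<close> of the two copies of the naturals.\<close>

datatype weight_entry = Plain nat | Barred nat

fun wsize :: "weight_entry \<Rightarrow> nat" where
  "wsize (Plain a) = a"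
| "wsize (Barred a) = a"

definition new_boxes :: "spart \<Rightarrow> spart \<Rightarrow> (nat \<times> nat) set" where
  "new_boxes \<Lambda> \<Lambda>' = set (boxes \<Lambda>') - set (boxes \<Lambda>)"

definition horizontal_strip :: "nat \<Rightarrow> spart \<Rightarrow> spart \<Rightarrow> bool" where
  "horizontal_strip r \<Lambda> \<Lambda>' \<longleftrightarrow> set (boxes \<Lambda>) \<subseteq> set (boxes \<Lambda>') \<and>
     card (new_boxes \<Lambda> \<Lambda>') = r \<and> inj_on snd (new_boxes \<Lambda> \<Lambda>')"

text \<open>
  Condition (2) for lists \<open>cs\<close>, \<open>cs'\<close> of old and new circles from top to bottom, \<open>D\<close> being the set
  of added boxes.
\<close>

definition circles_follow :: "(nat \<times> nat) set \<Rightarrow> (nat \<times> nat) list \<Rightarrow> (nat \<times> nat) list \<Rightarrow> bool" where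
  "circles_follow D cs cs' \<longleftrightarrow> length cs' = length cs \<and>
     (\<forall>j < length cs. let t = fst (cs ! j) in
        fst (cs' ! j) = (if \<exists>z \<in> D. fst z = t then t + 1 else t))"

definition is_new_circle :: "spart \<Rightarrow> spart \<Rightarrow> nat \<times> nat \<Rightarrow> bool" where
  "is_new_circle \<Lambda> \<Lambda>' z \<longleftrightarrow> z \<in> set (circles \<Lambda>') \<and>
     (\<forall>y \<in> new_boxes \<Lambda> \<Lambda>'. snd y \<noteq> snd z) \<and>
     (\<forall>c. 1 \<le> c \<and> c < snd z \<longrightarrow> (\<exists>y \<in> new_boxes \<Lambda> \<Lambda>'. snd y = c))"

fun tableau_step :: "weight_entry \<Rightarrow> spart \<Rightarrow> spart \<Rightarrow> bool" where
  "tableau_step (Plain a) \<Lambda> \<Lambda>' \<longleftrightarrow>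
     horizontal_strip a \<Lambda> \<Lambda>' \<and> df \<Lambda>' = df \<Lambda> \<and>
     circles_follow (new_boxes \<Lambda> \<Lambda>') (circles \<Lambda>) (circles \<Lambda>')"
| "tableau_step (Barred a) \<Lambda> \<Lambda>' \<longleftrightarrow>
     horizontal_strip a \<Lambda> \<Lambda>' \<and> df \<Lambda>' = df \<Lambda> + 1 \<and>
     (\<exists>!z. is_new_circle \<Lambda> \<Lambda>' z) \<and>
     circles_follow (new_boxes \<Lambda> \<Lambda>') (circles \<Lambda>)
       (filter (\<lambda>z. \<not> is_new_circle \<Lambda> \<Lambda>' z) (circles \<Lambda>'))"

definition tableau :: "spart \<Rightarrow> weight_entry list \<Rightarrow> spart list \<Rightarrow> bool" where
  "tableau \<Lambda> \<alpha> T \<longleftrightarrow> length T = length \<alpha> + 1 \<and> (\<forall>\<Gamma> \<in> set T. \<exists>n m. superpartition n m \<Gamma>) \<and>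
     T ! 0 = ([], []) \<and> T ! length \<alpha> = \<Lambda> \<and>
     (\<forall>i < length \<alpha>. tableau_step (\<alpha> ! i) (T ! i) (T ! (i + 1)))"

text \<open>
  The labels, from top to bottom, of the circles of the \<open>i\<close>-th superpartition of a tableau. By (2)
  the older circles keep their relative order; the label \<open>i\<close> of a circle created in step \<open>i\<close>
  is inserted after the labels of the circles above it.
\<close>

fun circle_labels :: "weight_entry list \<Rightarrow> spart list \<Rightarrow> nat \<Rightarrow> nat list" where
  "circle_labels \<alpha> T 0 = []"
| "circle_labels \<alpha> T (Suc i) =
     (let ls = circle_labels \<alpha> T i;
          p = length (takeWhile (\<lambda>z. \<not> is_new_circle (T ! i) (T ! Suc i) z) (circles (T ! Suc i)))
      in case \<alpha> ! i of Plain a \<Rightarrow> ls | Barred a \<Rightarrow> take p ls @ [Suc i] @ drop p ls)"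

text \<open>The filling of the diagram of \<open>\<Lambda>\<close> representing a tableau; cells outside are mapped to 0.\<close>

definition filling :: "spart \<Rightarrow> weight_entry list \<Rightarrow> spart list \<Rightarrow> nat \<times> nat \<Rightarrow> nat" where
  "filling \<Lambda> \<alpha> T z =
     (if z \<in> set (boxes \<Lambda>) then THE i. 1 \<le> i \<and> i \<le> length \<alpha> \<and> z \<in> new_boxes (T ! (i - 1)) (T ! i)
      else if z \<in> set (circles \<Lambda>) then
        circle_labels \<alpha> T (length \<alpha>) ! (THE j. j < length (circles \<Lambda>) \<and> circles \<Lambda> ! j = z)
      else 0)"

definition sSSYT :: "spart \<Rightarrow> (nat \<times> nat \<Rightarrow> nat) set" where
  "sSSYT \<Lambda> = {filling \<Lambda> \<alpha> T | \<alpha> T. tableau \<Lambda> \<alpha> T}"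

definition super_schur :: "spart \<Rightarrow> superseries" where
  "super_schur \<Lambda> = formal_sum (\<lambda>F. \<Sum>\<sigma> | \<sigma> permutes {..<length (boxes \<Lambda>)}.
     super_word (map F (circles \<Lambda>)) (map (\<lambda>i. F (boxes \<Lambda> ! \<sigma> i)) [0..<length (boxes \<Lambda>)])) (sSSYT \<Lambda>)"

definition inversions :: "nat list \<Rightarrow> nat" where
  "inversions w = card {(i, j). i < j \<and> j < length w \<and> w ! i > w ! j}"

definition weight_of :: "spart \<Rightarrow> weight_entry list" where
  "weight_of \<Omega> = map Barred (fst \<Omega>) @ map Plain (snd \<Omega>)"

definition super_kostka :: "spart \<Rightarrow> spart \<Rightarrow> int" where
  "super_kostka \<Lambda> \<Omega> = (\<Sum>T | tableau \<Lambda> (weight_of \<Omega>) T.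
     (-1) ^ inversions (map (filling \<Lambda> (weight_of \<Omega>) T) (circles \<Lambda>)))"


section \<open>Set superpartitions\<close>

definition min0 :: "nat set \<Rightarrow> nat" where
  "min0 A = (if A = {} then 0 else Min A)"

definition set_superpartition :: "nat \<Rightarrow> nat \<Rightarrow> nat set list \<Rightarrow> bool" where
  "set_superpartition n m I \<longleftrightarrow> m \<le> n + 1 \<and> m \<le> length I \<and> distinct I \<and>
     (\<forall>B \<in> set I. B \<noteq> {} \<and> B \<subseteq> {0..n}) \<and> (\<Union>B \<in> set I. B - {0}) = {1..n} \<and>
     (\<forall>i < length I. \<forall>j < length I. i \<noteq> j \<longrightarrow> I ! i \<inter> I ! j \<subseteq> {0}) \<and>
     (\<forall>i < length I. 0 \<in> I ! i \<longleftrightarrow> i < m) \<and>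
     (\<forall>i < length I. \<forall>j < length I. i < j \<longrightarrow> min0 (I ! i - I ! j) < min0 (I ! j - I ! i))"

definition super_monomial :: "nat \<Rightarrow> nat \<Rightarrow> nat set list \<Rightarrow> superseries" where
  "super_monomial n m I = formal_sum (\<lambda>(a, b). super_word a b)
     {(a, b). length a = m \<and> length b = n \<and> (\<forall>i \<in> set a \<union> set b. 1 \<le> i) \<and>
        (\<forall>i < m. \<forall>j \<in> {1..n}. a ! i = b ! (j - 1) \<longleftrightarrow> j \<in> I ! i - {0}) \<and>
        (\<forall>i \<in> {1..n}. \<forall>j \<in> {1..n}. b ! (i - 1) = b ! (j - 1) \<longleftrightarrow> (\<exists>B \<in> set I. i \<in> B \<and> j \<in> B))}"

definition fermionic_sizes :: "nat set list \<Rightarrow> nat list" where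
  "fermionic_sizes I = map (\<lambda>B. card B - 1) (filter (\<lambda>B. 0 \<in> B) I)"

definition ssp_type :: "nat set list \<Rightarrow> spart option" where
  "ssp_type I = (if distinct (fermionic_sizes I)
     then Some (decreasing (fermionic_sizes I), decreasing (map card (filter (\<lambda>B. 0 \<notin> B) I)))
     else None)"

text \<open>\<open>swapidseq r p\<close> says that \<open>p\<close> is a product of \<open>r\<close> transpositions.\<close>

definition sort_length :: "nat list \<Rightarrow> nat" where
  "sort_length xs = (LEAST r. \<exists>p. p permutes {..<length xs} \<and> swapidseq r p \<and>
     sorted_wrt (\<ge>) (permute_list p xs))"

definition ssp_eps :: "nat set list \<Rightarrow> nat" where
  "ssp_eps I = sort_length (fermionic_sizes I)"

end

theory Submission
  imports Defs "HOL-Combinatorics.Multiset_Permutations"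
begin

text \<open>
  The coefficients at each monomial \<open>\<theta>\<^sub>A w\<close> are compared. On the left, every filling whose circles
  carry the labels \<open>A\<close> and whose boxes have the content of \<open>w\<close> contributes its sign times the order of
  the stabilizer of \<open>w\<close>. On the right, at most one set superpartition contributes, namely the
  one given by the equality pattern of \<open>w\<close>. Everything therefore reduces to the fact that the signed
  number of tableaux of a given shape is invariant under the exchange of two adjacent weights, up to the
  factor \<open>-1\<close> if both are barred.

  To prove this, encode the circles of a superpartition by the product of anticommuting variables
  indexed by their rows. A step moves every circle by itself, and since \<open>\<theta>\<^sub>i\<theta>\<^sub>i = 0\<close>, forbidden
  collisions vanish; a new circle is multiplied on the right, which produces its sign. For fixed first and
  last shapes, the rows of the intermediate shape vary independently between bounds
  \<open>p\<close> and \<open>q\<close>, and \<open>\<mu> \<mapsto> p + q - \<mu>\<close> exchanges the sizes of the two steps. The two generating functions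
  are equal although this reflection does not preserve the final positions of the circles: summing over one
  row at a time from the bottom to the top, one finds an invariant that is stable under the reflection.
\<close>

section \<open>Coefficients of superseries\<close>

text \<open>Prescribing the sizes of the two steps would couple the rows of the intermediate shape.
  Both sizes are therefore left free and marked by a power of \<open>zvar\<close>; this is x_1, but
  only its commuting with every theta matters, and reading off a coefficient restores the sizes
  afterwards. The obstacle is that the final row of an old circle can depend on two adjacent rows of
  the intermediate shape: on whether its own row exceeds the minimum and whether the next row stays
  below the maximum. A recursion over the rows must hence carry the full sum over the later rows
  together with the part of it in which the first of these rows is not maximal. This second part
  enters only multiplied by a difference of two neighbouring thetas. Since \<open>(theta i - theta
  j) * theta i = (theta i - theta j) * theta j\<close>, that difference cannot tell apart the
  provisional rows of the new circles. What is left in each row is the identity z + z(z + ... +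
  z^(d-1)) = (z + ... + z^(d-1)) + z^d, where d is the difference of the two bounds of the
  row.\<close>

lemma scoeff_zero [simp]: "scoeff 0 A w = 0"
  by (simp add: zero_superseries.rep_eq)

lemma scoeff_add [simp]: "scoeff (f + g) A w = scoeff f A w + scoeff g A w"
  by (simp add: plus_superseries.rep_eq)

lemma scoeff_uminus [simp]: "scoeff (- f) A w = - scoeff f A w"
  by (simp add: uminus_superseries.rep_eq)

lemma scoeff_sum: "scoeff (sum f S) A w = (\<Sum>s\<in>S. scoeff (f s) A w)"
  by (induction S rule: infinite_finite_induct) auto

lemma scoeff_of_nat_mult: "scoeff (of_nat k * f) A w = of_nat k * scoeff f A w"
  by (induction k) (auto simp: algebra_simps)

lemma scoeff_of_int_mult: "scoeff (of_int k * f) A w = of_int k * scoeff f A w"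
  by (cases k rule: int_cases2) (simp_all add: scoeff_of_nat_mult)

lemma scoeff_minus_one_power_mult: "scoeff ((-1) ^ k * f) A w = (-1) ^ k * scoeff f A w"
  by (induction k) auto

text \<open>Of all splittings of \<open>A\<close> only the one into \<open>{i}\<close> and
  \<open>A - {i}\<close> survives, and to reach its place in the increasing order
  \<open>theta i\<close> passes every theta of smaller index.\<close>

lemma scoeff_theta_mult:
  "scoeff (theta i * f) A w =
     (if 0 < i \<and> i \<in> A then (-1) ^ card {c \<in> A. c < i} * scoeff f (A - {i}) w else 0)"
proof (cases "finite A")
  case True
  let ?t = "tsign {i} (A - {i}) * scoeff f (A - {i}) w"
  have "{(b, c). b \<in> {i} \<and> c \<in> A - {i} \<and> c < b} = Pair i ` {c \<in> A. c < i}"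
    by auto
  then have ts: "tsign {i} (A - {i}) = (-1) ^ card {c \<in> A. c < i}"
    unfolding tsign_def by (simp add: card_image inj_on_def)
  show ?thesis
  proof (cases "0 < i \<and> i \<in> A")
    case cond: True
    have "scoeff (theta i * f) A w = (\<Sum>P \<in> {({i}, A - {i}, [] :: nat list, w)}. ?t)"
      unfolding times_superseries.rep_eq conv_def theta.rep_eq
      by (rule sum.mono_neutral_cong_right[OF finite_splits[OF True]])
        (use cond in \<open>auto simp: splits_def split: if_splits\<close>)
    then show ?thesis using cond by (simp add: ts)
  next
    case False
    then have "scoeff (theta i * f) A w = 0"
      unfolding times_superseries.rep_eq conv_def theta.rep_eq
      by (intro sum.neutral) (auto simp: splits_def)
    then show ?thesis using False by auto
  qed
next
  case False
  then have "scoeff (theta i * f) A w = 0" "scoeff f (A - {i}) w = 0"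
    using scoeff_finite[of "theta i * f" A w] scoeff_finite[of f "A - {i}" w] by auto
  then show ?thesis by simp
qed

lemma scoeff_xvar_mult:
  "scoeff (xvar i * f) A w = (if 0 < i \<and> w \<noteq> [] \<and> hd w = i then scoeff f A (tl w) else 0)"
proof (cases "finite A")
  case True
  show ?thesis
  proof (cases "0 < i \<and> w \<noteq> [] \<and> hd w = i")
    case cond: True
    then obtain v where w: "w = i # v" by (cases w) auto
    have "scoeff (xvar i * f) A w = (\<Sum>P \<in> {({} :: nat set, A, [i], v)}. scoeff f A v)"
      unfolding times_superseries.rep_eq conv_def xvar.rep_eq
      by (rule sum.mono_neutral_cong_right[OF finite_splits[OF True]])
        (use cond w in \<open>auto simp: splits_def split: if_splits\<close>)
    then show ?thesis using cond w by simp
  next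
    case False
    then have "scoeff (xvar i * f) A w = 0"
      unfolding times_superseries.rep_eq conv_def xvar.rep_eq
      by (intro sum.neutral) (auto simp: splits_def)
    then show ?thesis using False by auto
  qed
next
  case False
  then have "scoeff g A v = 0" for g v
    using scoeff_finite by blast
  then show ?thesis by simp
qed

lemma scoeff_prod_list_xvar:
  "scoeff (prod_list (map xvar bs)) A w = of_bool (A = {} \<and> w = bs \<and> 0 \<notin> set bs)"
proof (induction bs arbitrary: w)
  case Nil
  then show ?case by (simp add: one_superseries.rep_eq)
next
  case (Cons b bs)
  then show ?case by (cases w) (auto simp: scoeff_xvar_mult)
qed

text \<open>Distinctness turns the positions of entries below the head into a set of values, the
  form in which \<open>scoeff_theta_mult\<close> delivers its exponent.\<close>

lemma inversions_Cons:
  assumes "distinct (a # as)"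
  shows "inversions (a # as) = card {c \<in> set as. c < a} + inversions as"
proof -
  let ?P = "\<lambda>w. {(i, j). i < j \<and> j < length w \<and> w ! i > w ! j}"
  have fin: "finite (?P w)" for w :: "nat list"
    by (rule finite_subset[of _ "{..<length w} \<times> {..<length w}"]) auto
  have eq: "?P (a # as) = (\<lambda>j. (0, Suc j)) ` {j. j < length as \<and> as ! j < a} \<union>
      (\<lambda>(i, j). (Suc i, Suc j)) ` ?P as" (is "_ = ?A \<union> ?B")
  proof (intro equalityI subsetI)
    fix x assume "x \<in> ?P (a # as)"
    then obtain i j where x: "x = (i, j)" "i < j" "j < Suc (length as)" "(a # as) ! i > (a # as) ! j"
      by auto
    then obtain j' where j': "j = Suc j'" by (cases j) auto
    show "x \<in> ?A \<union> ?B"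
    proof (cases i)
      case 0
      then show ?thesis using x j' by auto
    next
      case (Suc i')
      then have "x = (\<lambda>(i, j). (Suc i, Suc j)) (i', j')" "(i', j') \<in> ?P as" using x j' by auto
      then show ?thesis by blast
    qed
  qed auto
  have "card {j. j < length as \<and> as ! j < a} = card {c \<in> set as. c < a}"
  proof (rule bij_betw_same_card[of "(!) as"])
    show "bij_betw ((!) as) {j. j < length as \<and> as ! j < a} {c \<in> set as. c < a}"
      using assms by (auto simp: bij_betw_def inj_on_def in_set_conv_nth nth_eq_iff_index_eq)
  qed
  then have A: "card ?A = card {c \<in> set as. c < a}"
    by (simp add: card_image inj_on_def)
  have B: "card ?B = inversions as"
    unfolding inversions_def by (rule card_image) (auto simp: inj_on_def)
  have "?A \<inter> ?B = {}" by auto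
  then have "card (?A \<union> ?B) = card ?A + card ?B"
    using fin[of as] by (intro card_Un_disjoint) auto
  then show ?thesis unfolding inversions_def[of "a # as"] using eq A B by simp
qed

lemma inversions_Nil [simp]: "inversions [] = 0"
  by (simp add: inversions_def)

lemma super_word_Cons: "super_word (a # as) bs = theta a * super_word as bs"
  by (simp add: super_word_def mult.assoc)

text \<open>Each theta passes the smaller ones that follow it, so sorting the word costs one sign
  per inversion; a repeated theta or an index 0 makes the word vanish.\<close>

lemma scoeff_super_word:
  "scoeff (super_word as bs) A w =
     (if distinct as \<and> set as = A \<and> 0 \<notin> A \<and> bs = w \<and> 0 \<notin> set w then (-1) ^ inversions as else 0)"
proof (induction as arbitrary: A)
  case Nil
  then show ?case by (auto simp: super_word_def scoeff_prod_list_xvar)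
next
  case (Cons a as)
  show ?case
  proof (cases "distinct (a # as) \<and> set (a # as) = A \<and> 0 \<notin> A \<and> bs = w \<and> 0 \<notin> set w")
    case True
    have "{c \<in> A. c < a} = {c \<in> set as. c < a}" "A - {a} = set as" "a \<in> A" "0 < a"
      using True by (auto intro: Suc_leI)
    moreover have "scoeff (super_word as bs) (set as) w = (-1) ^ inversions as"
      using True by (subst Cons.IH) auto
    ultimately show ?thesis
      using True by (simp add: super_word_Cons scoeff_theta_mult inversions_Cons power_add)
  next
    case False
    then have "\<not> (0 < a \<and> a \<in> A \<and> distinct as \<and> set as = A - {a} \<and> 0 \<notin> A - {a} \<and> bs = w \<and> 0 \<notin> set w)"
      by auto
    then show ?thesis
      unfolding super_word_Cons scoeff_theta_mult Cons.IH if_not_P[OF False] by auto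
  qed
qed

section \<open>Commuting and sorting products of thetas\<close>

lemma super_word_Nil: "super_word as [] = prod_list (map theta as)"
  by (simp add: super_word_def)

lemma theta_xvar_left_commute: "theta i * (xvar j * f) = xvar j * (theta i * f)"
  by (metis mult.assoc xvar_theta_commute)

lemma minus_one_power_commute: "f * (-1) ^ k = (-1) ^ k * (f :: superseries)"
  by (induction k) auto

lemma theta_prod_commute:
  "theta i * prod_list (map theta xs) = (-1) ^ length xs * (prod_list (map theta xs) * theta i)"
proof (induction xs)
  case (Cons x xs)
  have "theta i * prod_list (map theta (x # xs)) = - (theta x * (theta i * prod_list (map theta xs)))"
    by (simp add: mult.assoc[symmetric] theta_anticommute[of i x])
  also have "theta x * (theta i * prod_list (map theta xs)) =
      theta x * (-1) ^ length xs * (prod_list (map theta xs) * theta i)"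
    by (simp only: Cons.IH mult.assoc)
  also have "theta x * (-1) ^ length xs = (-1) ^ length xs * theta x"
    by (rule minus_one_power_commute)
  finally show ?case by (simp add: mult.assoc)
qed simp

lemma theta_prod_commute':
  "prod_list (map theta xs) * theta i = (-1) ^ length xs * (theta i * prod_list (map theta xs))"
proof -
  have "(-1) ^ length xs * (-1) ^ length xs = (1 :: superseries)"
    by (simp flip: power_add)
  then show ?thesis
    unfolding theta_prod_commute by (simp flip: mult.assoc)
qed

lemma sorted_list_of_set_split:
  fixes r :: nat
  assumes "finite S"
  shows "sorted_list_of_set S = sorted_list_of_set {x \<in> S. x < r} @ (if r \<in> S then [r] else []) @
    sorted_list_of_set {x \<in> S. r < x}" (is "_ = ?xs")
proof -
  have "sorted ?xs" "distinct ?xs"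
    using assms by (auto simp: sorted_append less_imp_le)
  moreover have "set ?xs = S" using assms by auto
  ultimately show ?thesis by (metis sorted_list_of_set.idem_if_sorted_distinct)
qed

text \<open>Only the last factor is out of place, and it passes one theta for each larger entry of
  \<open>xs\<close>. The function \<open>f\<close> allows sorting by the rows after one step while
  the thetas already carry the rows reached after a further step.\<close>

lemma theta_prod_insert_sorted:
  fixes xs :: "nat list"
  assumes "sorted xs" "distinct (xs @ [r])"
  shows "prod_list (map (\<lambda>x. theta (f x)) (xs @ [r])) = (-1) ^ card {x \<in> set xs. r < x} *
    prod_list (map (\<lambda>x. theta (f x)) (sorted_list_of_set (set (xs @ [r]))))"
proof -
  let ?P = "\<lambda>xs. prod_list (map (\<lambda>x. theta (f x)) xs)"
  define us vs where "us = sorted_list_of_set {x \<in> set xs. x < r}"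
    and "vs = sorted_list_of_set {x \<in> set xs. r < x}"
  have "xs = sorted_list_of_set (set xs)"
    using assms by (simp add: sorted_list_of_set.idem_if_sorted_distinct)
  then have xs: "xs = us @ vs"
    using sorted_list_of_set_split[of "set xs" r] assms(2) by (simp add: us_def vs_def)
  have "{x \<in> set (xs @ [r]). x < r} = {x \<in> set xs. x < r}"
    "{x \<in> set (xs @ [r]). r < x} = {x \<in> set xs. r < x}"
    by auto
  then have eq: "sorted_list_of_set (set (xs @ [r])) = us @ r # vs"
    using sorted_list_of_set_split[of "set (xs @ [r])" r] by (simp add: us_def vs_def)
  have card: "card {x \<in> set xs. r < x} = length vs"
    by (simp add: vs_def)
  have "?P vs * theta (f r) = (-1) ^ length vs * (theta (f r) * ?P vs)"
    using theta_prod_commute'[of "map f vs" "f r"] by (simp add: comp_def)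
  then have "?P us * (?P vs * theta (f r)) = ?P us * (-1) ^ length vs * (theta (f r) * ?P vs)"
    by (simp add: mult.assoc)
  also have "?P us * (-1) ^ length vs = (-1) ^ length vs * ?P us"
    by (rule minus_one_power_commute)
  finally show ?thesis
    unfolding card eq by (subst xs) (simp add: mult.assoc)
qed

section \<open>The exchange identity\<close>

definition zvar :: superseries where
  "zvar = xvar 1"

lemma theta_zvar_left_commute: "theta i * (zvar * f) = zvar * (theta i * f)"
  unfolding zvar_def by (rule theta_xvar_left_commute)

text \<open>Parity in the superalgebra, seen only through the behaviour against thetas; this
  suffices to move a difference \<open>theta i - theta j\<close> across a factor.\<close>

definition theta_parity :: "superseries \<Rightarrow> bool" where
  "theta_parity f \<longleftrightarrow> (\<forall>i. theta i * f = f * theta i) \<or> (\<forall>i. theta i * f = - (f * theta i))"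

lemma theta_parity_simps [simp]:
  "theta_parity 1" "theta_parity (theta i)" "theta_parity (zvar ^ k)"
proof -
  show "theta_parity 1" by (simp add: theta_parity_def)
  show "theta_parity (theta i)" unfolding theta_parity_def using theta_anticommute by blast
  have "theta j * zvar ^ k = zvar ^ k * theta j" for j
  proof (induction k)
    case (Suc k)
    then show ?case by (simp add: theta_zvar_left_commute mult.assoc)
  qed simp
  then show "theta_parity (zvar ^ k)" by (simp add: theta_parity_def)
qed

lemma theta_parity_mult [simp]:
  assumes "theta_parity f" "theta_parity g"
  shows "theta_parity (f * g)"
proof -
  have *: "theta i * (f * g) = (theta i * f) * g" "f * g * theta i = f * (g * theta i)"
    "f * (theta i * g) = (f * theta i) * g" for i
    by (simp_all add: mult.assoc)
  show ?thesis
    using assms unfolding theta_parity_def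
    by (elim disjE) (simp_all add: * flip: *(3))
qed

lemma theta_parity_prod_list: "\<forall>x \<in> set xs. theta_parity (f x) \<Longrightarrow> theta_parity (prod_list (map f xs))"
  by (induction xs) auto

text \<open>The difference passes \<open>f\<close> at the cost of a sign that is the same on both
  sides.\<close>

lemma theta_diff_mult_cong:
  assumes "theta_parity f" "(theta i - theta j) * g = (theta i - theta j) * h"
  shows "(theta i - theta j) * (f * g) = (theta i - theta j) * (f * h)"
proof -
  have "(\<forall>x. (theta i - theta j) * (f * x) = f * ((theta i - theta j) * x)) \<or>
      (\<forall>x. (theta i - theta j) * (f * x) = - (f * ((theta i - theta j) * x)))"
    using assms(1) unfolding theta_parity_def
    by (auto simp: left_diff_distrib right_diff_distrib simp flip: mult.assoc)
  then show ?thesis using assms(2) by (elim disjE) simp_all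
qed

text \<open>As squares vanish, the left side is \<open>- theta j * theta i\<close> and the right
  side \<open>theta i * theta j\<close>, each times \<open>f\<close>. Multiplication by the
  difference thus identifies the two thetas.\<close>

lemma theta_diff_mult:
  "(theta i - theta j) * (theta i * f) = (theta i - theta j) * (theta j * f)"
  by (simp add: left_diff_distrib theta_square theta_anticommute[of j i] flip: mult.assoc)

text \<open>Both sides are z + z^2 + ... + z^d, with the first or the last term split off.\<close>

lemma geometric_shift:
  fixes z :: "'a :: ring_1"
  assumes "1 \<le> d"
  shows "z + z * (\<Sum>n = 1..<d. z ^ n) = (\<Sum>n = 1..<d. z ^ n) + z ^ d"
  using assms by (induction d rule: dec_induct) (auto simp: algebra_simps)

text \<open>
  A pair of consecutive steps with row lengths \<open>\<lambda> \<le> \<mu> \<le> \<nu>\<close> is described by the intermediate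
  shape \<open>\<mu>\<close>, whose rows vary independently between bounds \<open>p\<close> and \<open>q\<close>. The factor
  \<open>theta (Suc s)\<close> stands for a circle in row \<open>s\<close>. Every old circle contributes the factor
  \<open>vec\<close>. A circle that is created in the first or in the second step is still undetermined
  before the rows from \<open>R\<close> on have been examined; \<open>i\<close> and \<open>j\<close> are its provisional rows.
\<close>

locale exchange =
  fixes N R :: nat and p q :: "nat \<Rightarrow> nat" and G :: "nat set" and c :: "nat \<Rightarrow> superseries"
    and u1 u2 :: bool
  assumes bounds: "p t \<le> q t" and far: "N \<le> t \<Longrightarrow> p t = q t" and R_le: "R \<le> N"
    and G: "t \<in> G \<Longrightarrow> p t < q t" and parity_c: "theta_parity (c t)"
begin

text \<open>Rows before \<open>t\<close> are frozen at \<open>p\<close> rather than left out, so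
  that all partial sums run over functions of the same type and one update adds a row.\<close>

definition dom :: "nat \<Rightarrow> (nat \<Rightarrow> nat) set" where
  "dom t = {\<mu>. \<forall>s. p s \<le> \<mu> s \<and> \<mu> s \<le> (if t \<le> s then q s else p s)}"

text \<open>\<open>G\<close> collects the rows whose circle moves once or twice depending on the
  intermediate shape; every other row contributes the factor \<open>c t\<close>, whatever \<mu>
  is.\<close>

definition vec :: "(nat \<Rightarrow> nat) \<Rightarrow> nat \<Rightarrow> superseries" where
  "vec \<mu> t = (if t \<in> G then
     theta (if p t < \<mu> t \<and> \<mu> (Suc t) < q (Suc t) then Suc (Suc (Suc t)) else Suc (Suc t)) else c t)"

text \<open>Later rows overwrite earlier ones, so the last row from \<open>max R t\<close> on with
  property \<open>P\<close> decides and puts the circle one row below itself; without such a row the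
  provisional \<open>i\<close> stands.\<close>

definition res :: "(nat \<Rightarrow> bool) \<Rightarrow> nat \<Rightarrow> nat \<Rightarrow> nat" where
  "res P t i = foldl (\<lambda>i s. if R \<le> s \<and> P s then Suc s else i) i [t..<N]"

definition new_circles :: "nat \<Rightarrow> nat \<Rightarrow> superseries" where
  "new_circles i j = (if u1 then theta (Suc i) else 1) * (if u2 then theta (Suc j) else 1)"

context
  fixes w :: "nat \<Rightarrow> nat \<Rightarrow> superseries" and P1 P2 :: "nat \<Rightarrow> nat \<Rightarrow> bool"
begin

definition summand :: "nat \<Rightarrow> nat \<Rightarrow> nat \<Rightarrow> (nat \<Rightarrow> nat) \<Rightarrow> superseries" where
  "summand t i j \<mu> = prod_list (map (\<lambda>s. w s (\<mu> s) * vec \<mu> s) [t..<N]) *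
     new_circles (res (\<lambda>s. P1 s (\<mu> s)) t i) (res (\<lambda>s. P2 s (\<mu> s)) t j)"

definition total :: "nat \<Rightarrow> nat \<Rightarrow> nat \<Rightarrow> superseries" where
  "total t i j = (\<Sum>\<mu> \<in> dom t. summand t i j \<mu>)"

text \<open>A circle from row \<open>t - 1\<close> can move a second time only if row
  \<open>t\<close> is not maximal, so this sum is the only further information about later rows that
  row \<open>t - 1\<close> requires.\<close>

definition partial :: "nat \<Rightarrow> nat \<Rightarrow> nat \<Rightarrow> superseries" where
  "partial t i j = (\<Sum>\<mu> \<in> dom t. if \<mu> t < q t then summand t i j \<mu> else 0)"

end

section \<open>The recursion over the rows\<close>

lemma dom_N: "dom N = {p}"
proof -
  have "\<mu> = p" if "\<mu> \<in> dom N" for \<mu>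
  proof
    fix s
    have "p s \<le> \<mu> s" "\<mu> s \<le> (if N \<le> s then q s else p s)"
      using that by (auto simp: dom_def)
    then show "\<mu> s = p s" using far[of s] by (auto split: if_splits)
  qed
  moreover have "p \<in> dom N" using bounds by (simp add: dom_def)
  ultimately show ?thesis by blast
qed

lemma sum_dom:
  "(\<Sum>\<mu> \<in> dom t. f \<mu>) = (\<Sum>k = p t..q t. \<Sum>\<mu> \<in> dom (Suc t). f (\<mu>(t := k)))"
proof -
  have "(\<Sum>\<mu> \<in> dom t. f \<mu>) = (\<Sum>(k, \<mu>) \<in> {p t..q t} \<times> dom (Suc t). f (\<mu>(t := k)))"
  proof (rule sum.reindex_bij_witness[where i = "\<lambda>(k, \<mu>). \<mu>(t := k)" and j = "\<lambda>\<mu>. (\<mu> t, \<mu>(t := p t))"])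
    fix \<mu> assume "\<mu> \<in> dom t"
    then have "p s \<le> \<mu> s" "\<mu> s \<le> (if t \<le> s then q s else p s)" for s
      by (auto simp: dom_def)
    then show "(\<mu> t, \<mu>(t := p t)) \<in> {p t..q t} \<times> dom (Suc t)"
      unfolding dom_def by (force simp: Suc_le_eq less_le split: if_splits)
  next
    fix b assume "b \<in> {p t..q t} \<times> dom (Suc t)"
    then obtain k \<mu> where b: "b = (k, \<mu>)" "p t \<le> k" "k \<le> q t"
      and "\<And>s. p s \<le> \<mu> s" "\<And>s. \<mu> s \<le> (if Suc t \<le> s then q s else p s)"
      by (auto simp: dom_def)
    note * = this
    show "(case b of (k, \<mu>) \<Rightarrow> \<mu>(t := k)) \<in> dom t"
      unfolding dom_def b prod.case
    proof (intro CollectI allI)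
      fix s
      show "p s \<le> (\<mu>(t := k)) s \<and> (\<mu>(t := k)) s \<le> (if t \<le> s then q s else p s)"
        using *(2,3) *(4)[of s] *(5)[of s] by (cases "s = t") (auto split: if_splits)
    qed
    have "\<mu> t = p t" using *(4)[of t] *(5)[of t] by simp
    then show "((case b of (k, \<mu>) \<Rightarrow> \<mu>(t := k)) t, (case b of (k, \<mu>) \<Rightarrow> \<mu>(t := k))(t := p t)) = b"
      by (simp add: b fun_upd_idem)
  qed auto
  then show ?thesis by (simp add: sum.cartesian_product)
qed

lemma res_Suc: "t < N \<Longrightarrow> res P t i = res P (Suc t) (if R \<le> t \<and> P t then Suc t else i)"
  by (simp add: res_def upt_conv_Cons)

lemma res_cong: "(\<And>s. t \<le> s \<Longrightarrow> P s = Q s) \<Longrightarrow> res P t i = res Q t i"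
  unfolding res_def by (rule foldl_cong) auto

text \<open>Whether some row overwrites the start value does not depend on that value.\<close>

lemma res_cases: "(\<forall>i. res P t i = i) \<or> (\<exists>k. \<forall>i. res P t i = k)"
proof -
  have "(\<forall>i. foldl (\<lambda>i s. if R \<le> s \<and> P s then Suc s else i) i xs = i) \<or>
      (\<exists>k. \<forall>i. foldl (\<lambda>i s. if R \<le> s \<and> P s then Suc s else i) i xs = k)" for xs
    by (induction xs rule: rev_induct) auto
  then show ?thesis unfolding res_def .
qed

lemma summand_Suc:
  assumes "t < N"
  shows "summand w P1 P2 t i j (\<mu>(t := k)) = w t k * (vec (\<mu>(t := k)) t *
    summand w P1 P2 (Suc t) (if R \<le> t \<and> P1 t k then Suc t else i) (if R \<le> t \<and> P2 t k then Suc t else j) \<mu>)"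
proof -
  have "prod_list (map (\<lambda>s. w s ((\<mu>(t := k)) s) * vec (\<mu>(t := k)) s) [Suc t..<N]) =
      prod_list (map (\<lambda>s. w s (\<mu> s) * vec \<mu> s) [Suc t..<N])"
    by (rule arg_cong[of _ _ prod_list]) (auto simp: vec_def)
  moreover have "res (\<lambda>s. P s ((\<mu>(t := k)) s)) (Suc t) i = res (\<lambda>s. P s (\<mu> s)) (Suc t) i" for P i
    by (rule res_cong) auto
  ultimately show ?thesis
    using assms unfolding summand_def by (simp add: res_Suc upt_conv_Cons mult.assoc fun_upd_same del: fun_upd_apply)
qed

text \<open>The choice between the two end rows of a circle is written as the higher row plus a
  correction by the difference of the two thetas. This confines the dependence on the next row to
  \<open>partial\<close>. The flag \<open>moved\<close> says that row \<open>t\<close> exceeds its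
  minimum.\<close>

definition row :: "(nat \<Rightarrow> nat \<Rightarrow> superseries) \<Rightarrow> (nat \<Rightarrow> nat \<Rightarrow> bool) \<Rightarrow> (nat \<Rightarrow> nat \<Rightarrow> bool) \<Rightarrow>
    nat \<Rightarrow> nat \<Rightarrow> nat \<Rightarrow> bool \<Rightarrow> superseries" where
  "row w P1 P2 t i j moved = (if t \<in> G then
     theta (Suc (Suc t)) * total w P1 P2 (Suc t) i j +
     (if moved then (theta (Suc (Suc (Suc t))) - theta (Suc (Suc t))) * partial w P1 P2 (Suc t) i j else 0)
   else c t * total w P1 P2 (Suc t) i j)"

lemma sum_row:
  assumes "t < N"
  shows "(\<Sum>\<mu> \<in> dom (Suc t). summand w P1 P2 t i j (\<mu>(t := k))) =
    w t k * row w P1 P2 t (if R \<le> t \<and> P1 t k then Suc t else i)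
      (if R \<le> t \<and> P2 t k then Suc t else j) (p t < k)"
proof (cases "t \<in> G")
  case True
  let ?i = "if R \<le> t \<and> P1 t k then Suc t else i" and ?j = "if R \<le> t \<and> P2 t k then Suc t else j"
  have "summand w P1 P2 t i j (\<mu>(t := k)) = w t k *
      (theta (Suc (Suc t)) * summand w P1 P2 (Suc t) ?i ?j \<mu> +
       (if p t < k then (theta (Suc (Suc (Suc t))) - theta (Suc (Suc t))) *
          (if \<mu> (Suc t) < q (Suc t) then summand w P1 P2 (Suc t) ?i ?j \<mu> else 0) else 0))" for \<mu>
    unfolding summand_Suc[OF assms] using True by (simp add: vec_def left_diff_distrib)
  then show ?thesis
    using True by (simp add: row_def total_def partial_def sum.distrib flip: sum_distrib_left)
next
  case False
  then show ?thesis
    unfolding summand_Suc[OF assms]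
    by (simp add: row_def total_def vec_def flip: sum_distrib_left)
qed

lemma total_eq_rows:
  assumes "t < N"
  shows "total w P1 P2 t i j = (\<Sum>k = p t..q t. w t k * row w P1 P2 t
    (if R \<le> t \<and> P1 t k then Suc t else i) (if R \<le> t \<and> P2 t k then Suc t else j) (p t < k))"
  unfolding total_def[of _ _ _ t] sum_dom[of _ t] sum_row[OF assms] ..

lemma partial_eq_rows:
  assumes "t < N"
  shows "partial w P1 P2 t i j = (\<Sum>k = p t..<q t. w t k * row w P1 P2 t
    (if R \<le> t \<and> P1 t k then Suc t else i) (if R \<le> t \<and> P2 t k then Suc t else j) (p t < k))"
proof -
  have "partial w P1 P2 t i j = (\<Sum>k = p t..q t. if k < q t then
      (\<Sum>\<mu> \<in> dom (Suc t). summand w P1 P2 t i j (\<mu>(t := k))) else 0)"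
    unfolding partial_def sum_dom[of _ t] by (intro sum.cong) auto
  also have "\<dots> = (\<Sum>k = p t..<q t. \<Sum>\<mu> \<in> dom (Suc t). summand w P1 P2 t i j (\<mu>(t := k)))"
    by (rule sum.mono_neutral_cong_right) auto
  finally show ?thesis unfolding sum_row[OF assms] .
qed

lemma total_partial:
  assumes "t < N" "p t < q t"
  shows "total w P1 P2 t i j = partial w P1 P2 t i j + w t (q t) * row w P1 P2 t
    (if R \<le> t \<and> P1 t (q t) then Suc t else i) (if R \<le> t \<and> P2 t (q t) then Suc t else j) True"
proof -
  have "{p t..q t} = insert (q t) {p t..<q t}" using assms by auto
  then show ?thesis
    unfolding total_eq_rows[OF assms(1)] partial_eq_rows[OF assms(1)] using assms by (simp add: add.commute)
qed

lemma partial_split: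
  assumes "t < N" "p t < q t"
  shows "partial w P1 P2 t i j = w t (p t) * row w P1 P2 t
      (if R \<le> t \<and> P1 t (p t) then Suc t else i) (if R \<le> t \<and> P2 t (p t) then Suc t else j) False +
    (\<Sum>k \<in> {p t<..<q t}. w t k * row w P1 P2 t
      (if R \<le> t \<and> P1 t k then Suc t else i) (if R \<le> t \<and> P2 t k then Suc t else j) True)"
proof -
  have "{p t..<q t} = insert (p t) {p t<..<q t}" using assms by auto
  then show ?thesis
    unfolding partial_eq_rows[OF assms(1)] by simp
qed

lemma total_degenerate:
  assumes "t < N" "p t = q t" "\<not> P1 t (p t)" "\<not> P2 t (p t)" "w t (p t) = 1"
  shows "total w P1 P2 t i j = c t * total w P1 P2 (Suc t) i j"
  unfolding total_eq_rows[OF assms(1)] using assms G[of t] by (auto simp: row_def)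

lemma partial_degenerate:
  assumes "t \<le> N" "p t = q t"
  shows "partial w P1 P2 t i j = 0"
proof -
  have "\<not> \<mu> t < q t" if "\<mu> \<in> dom t" for \<mu>
    using that assms(2) by (auto simp: dom_def dest: spec[of _ t])
  then show ?thesis unfolding partial_def by (intro sum.neutral) auto
qed

text \<open>By \<open>res_cases\<close> a provisional row enters a summand either not at all or as a
  single theta, and the difference does not see which of its two rows that theta stands for.\<close>

lemma theta_diff_total:
  assumes "\<And>s k. theta_parity (w s k)"
  shows "(theta (Suc i) - theta (Suc i')) * total w P1 P2 t i j =
      (theta (Suc i) - theta (Suc i')) * total w P1 P2 t i' j"
    and "(theta (Suc j) - theta (Suc j')) * total w P1 P2 t i j =
      (theta (Suc j) - theta (Suc j')) * total w P1 P2 t i j'"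
proof -
  have A: "theta_parity (prod_list (map (\<lambda>s. w s (\<mu> s) * vec \<mu> s) xs))" for \<mu> xs
    using assms by (intro theta_parity_prod_list) (auto simp: vec_def parity_c)
  have 1: "(theta (Suc i) - theta (Suc i')) * new_circles (res P t i) j0 =
      (theta (Suc i) - theta (Suc i')) * new_circles (res P t i') j0" for P j0
    using res_cases[of P t]
  proof (elim disjE exE)
    assume "\<forall>i. res P t i = i"
    then show ?thesis unfolding new_circles_def by (cases u1) (simp_all add: theta_diff_mult[of "Suc i" "Suc i'"])
  qed simp
  have 2: "(theta (Suc j) - theta (Suc j')) * new_circles i0 (res P t j) =
      (theta (Suc j) - theta (Suc j')) * new_circles i0 (res P t j')" for P i0
    using res_cases[of P t]
  proof (elim disjE exE)
    assume *: "\<forall>i. res P t i = i"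
    show ?thesis
      unfolding new_circles_def using * theta_diff_mult[of "Suc j" "Suc j'" 1]
      by (intro theta_diff_mult_cong) auto
  qed simp
  show "(theta (Suc i) - theta (Suc i')) * total w P1 P2 t i j =
      (theta (Suc i) - theta (Suc i')) * total w P1 P2 t i' j"
    unfolding total_def summand_def sum_distrib_left
    by (intro sum.cong refl theta_diff_mult_cong A 1)
  show "(theta (Suc j) - theta (Suc j')) * total w P1 P2 t i j =
      (theta (Suc j) - theta (Suc j')) * total w P1 P2 t i j'"
    unfolding total_def summand_def sum_distrib_left
    by (intro sum.cong refl theta_diff_mult_cong A 2)
qed

section \<open>The two generating functions and their exchange\<close>

abbreviation "wV \<equiv> \<lambda>s k. zvar ^ (k - p s)"
abbreviation "wW \<equiv> \<lambda>s k. zvar ^ (q s - k)"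
abbreviation "not_min \<equiv> \<lambda>s k. p s < k"
abbreviation "not_max \<equiv> \<lambda>s k. k < q s"
text \<open>\<open>V\<close> belongs to the given order of two weights, \<open>W\<close> to the
  exchanged one. In both, the exponent refers to the step with the first given weight, and the first
  factor of \<open>new_circles\<close> is the circle of that step; exchanging the steps therefore
  interchanges \<open>not_max\<close> and \<open>not_min\<close>.\<close>

abbreviation "TV \<equiv> total wV not_max not_min"
abbreviation "FV \<equiv> partial wV not_max not_min"
abbreviation "TW \<equiv> total wW not_min not_max"
abbreviation "FW \<equiv> partial wW not_min not_max"

text \<open>
  The invariant of the exchange: the totals of both families agree, and the sums over the
  shapes whose row \<open>t\<close> is not maximal agree up to the factor \<open>zvar\<close> and
  up to elements annihilated by the difference of the two theta variables that can still be
  affected.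
\<close>

definition exchanged :: "nat \<Rightarrow> nat \<Rightarrow> nat \<Rightarrow> bool" where
  "exchanged t i j \<longleftrightarrow> TV t i j = TW t i j"

definition diff_exchanged :: "nat \<Rightarrow> nat \<Rightarrow> bool" where
  "diff_exchanged t i \<longleftrightarrow> zvar * ((theta (Suc (Suc t)) - theta (Suc t)) * FV t i i) =
     (theta (Suc (Suc t)) - theta (Suc t)) * FW t i i"

definition mid :: "nat \<Rightarrow> superseries" where
  "mid t = (\<Sum>n = 1..<q t - p t. zvar ^ n)"

lemma mid_V: "(\<Sum>k \<in> {p t<..<q t}. zvar ^ (k - p t) * f) = mid t * f"
  unfolding mid_def sum_distrib_right
  by (rule sum.reindex_bij_witness[where i = "\<lambda>n. n + p t" and j = "\<lambda>k. k - p t"]) auto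

lemma mid_W: "(\<Sum>k \<in> {p t<..<q t}. zvar ^ (q t - k) * f) = mid t * f"
  unfolding mid_def sum_distrib_right
  by (rule sum.reindex_bij_witness[where i = "\<lambda>n. q t - n" and j = "\<lambda>k. q t - k"]) auto

text \<open>The values of row \<open>t\<close> fall into three classes: minimal, strictly between,
  maximal. Inside the middle class neither the new circles nor the flag \<open>moved\<close> vary,
  so the powers of \<open>zvar\<close> add up to \<open>mid t\<close>. The maximal value is absent
  from \<open>FV\<close> and appears in \<open>TV_eq\<close>.\<close>

lemma FV_eq:
  assumes "t < N" "p t < q t"
  shows "FV t i j = row wV not_max not_min t (if R \<le> t then Suc t else i) j False +
    mid t * row wV not_max not_min t (if R \<le> t then Suc t else i) (if R \<le> t then Suc t else j) True"
  unfolding partial_split[OF assms] using assms by (simp add: flip: mid_V)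

lemma TV_eq:
  assumes "t < N" "p t < q t"
  shows "TV t i j = FV t i j + zvar ^ (q t - p t) *
    row wV not_max not_min t i (if R \<le> t then Suc t else j) True"
  unfolding total_partial[OF assms] using assms by simp

lemma FW_eq:
  assumes "t < N" "p t < q t"
  shows "FW t i j = zvar ^ (q t - p t) *
      row wW not_min not_max t i (if R \<le> t then Suc t else j) False +
    mid t * row wW not_min not_max t (if R \<le> t then Suc t else i) (if R \<le> t then Suc t else j) True"
  unfolding partial_split[OF assms] using assms by (simp add: flip: mid_W)

lemma TW_eq:
  assumes "t < N" "p t < q t"
  shows "TW t i j = FW t i j +
    row wW not_min not_max t (if R \<le> t then Suc t else i) j True"
  unfolding total_partial[OF assms] using assms by simp

text \<open>A row \<open>t\<close> that is not maximal satisfies \<open>not_max\<close> and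
  overwrites the provisional row \<open>i\<close>. In \<open>FW\<close> the same condition governs
  \<open>j\<close>.\<close>

lemma FV_indep:
  assumes "R \<le> t" "t \<le> N"
  shows "FV t i j = FV t i' j"
proof (cases "p t = q t")
  case True
  then show ?thesis using assms by (simp add: partial_degenerate)
next
  case False
  then have "p t < q t" "t < N"
    using bounds[of t] far[of t] assms(2) by (simp, metis le_neq_implies_less)
  then show ?thesis using assms(1) by (simp add: FV_eq)
qed

lemma FW_indep:
  assumes "R \<le> t" "t \<le> N"
  shows "FW t i j = FW t i j'"
proof (cases "p t = q t")
  case True
  then show ?thesis using assms by (simp add: partial_degenerate)
next
  case False
  then have "p t < q t" "t < N"
    using bounds[of t] far[of t] assms(2) by (simp, metis le_neq_implies_less)
  then show ?thesis using assms(1) by (simp add: FW_eq)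
qed

lemma theta_diff_scalar:
  "(theta i - theta j) * (zvar * f) = zvar * ((theta i - theta j) * f)"
  "(theta i - theta j) * (zvar ^ k * f) = zvar ^ k * ((theta i - theta j) * f)"
  "(theta i - theta j) * (mid t * f) = mid t * ((theta i - theta j) * f)"
proof -
  have pow: "theta i * (zvar ^ k * f) = zvar ^ k * (theta i * f)" for i k f
    by (induction k arbitrary: f) (simp_all add: theta_zvar_left_commute mult.assoc)
  have mid: "theta i * (mid t * f) = mid t * (theta i * f)" for i f
    by (simp add: mid_def sum_distrib_left sum_distrib_right pow)
  show
    "(theta i - theta j) * (zvar * f) = zvar * ((theta i - theta j) * f)"
    "(theta i - theta j) * (zvar ^ k * f) = zvar ^ k * ((theta i - theta j) * f)"
    "(theta i - theta j) * (mid t * f) = mid t * ((theta i - theta j) * f)"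
    by (simp_all add: left_diff_distrib right_diff_distrib theta_zvar_left_commute pow mid)
qed

lemma mid_commute: "mid t * (zvar * f) = zvar * (mid t * f)"
proof -
  have "mid t * zvar = zvar * mid t"
    by (simp add: mid_def sum_distrib_left sum_distrib_right power_commutes)
  then show ?thesis by (simp flip: mult.assoc)
qed

lemma mid_shift:
  assumes "p t < q t"
  shows "zvar * f + zvar * (mid t * f) = mid t * f + zvar ^ (q t - p t) * f"
  using geometric_shift[of "q t - p t" "zvar"] assms
  by (simp add: mid_def flip: mult.assoc distrib_right)

text \<open>The terms with \<open>A\<close>, \<open>B\<close>, \<open>C\<close> match as they stand,
  although the minimal class of one side corresponds to the maximal class of the other. Only the
  coefficients of the correction \<open>Y\<close> have to be compared, and that is
  \<open>mid_shift\<close>.\<close>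

lemma exchange_algebra:
  assumes "p t < q t"
  shows "A + mid t * (B + Y) + zvar ^ (q t - p t) * (C + Y) =
    zvar ^ (q t - p t) * C + mid t * (B + zvar * Y) + (A + zvar * Y)"
  using mid_shift[OF assms, of Y] by (simp add: distrib_left mid_commute algebra_simps)

text \<open>Under the difference of thetas \<open>A\<close>, \<open>B\<close> and \<open>C\<close>
  become equal, and the coefficients of their common value agree by \<open>mid_shift\<close>. The
  terms with \<open>Y\<close> agree because \<open>zvar\<close> commutes with
  \<open>mid t\<close>.\<close>

lemma diff_exchange_algebra:
  assumes "p t < q t" "(theta i - theta j) * A = (theta i - theta j) * B"
    "(theta i - theta j) * C = (theta i - theta j) * B"
  shows "zvar * ((theta i - theta j) * (A + mid t * (B + Y))) =
    (theta i - theta j) * (zvar ^ (q t - p t) * C + mid t * (B + zvar * Y))"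
proof -
  define P Q where "P = (theta i - theta j) * B" and "Q = (theta i - theta j) * Y"
  have "zvar * ((theta i - theta j) * (A + mid t * (B + Y))) = zvar * P + zvar * (mid t * (P + Q))"
    unfolding P_def Q_def using assms by (simp only: distrib_left theta_diff_scalar)
  moreover have "(theta i - theta j) * (zvar ^ (q t - p t) * C + mid t * (B + zvar * Y)) =
      zvar ^ (q t - p t) * P + mid t * (P + zvar * Q)"
    unfolding P_def Q_def using assms by (simp only: distrib_left theta_diff_scalar)
  ultimately show ?thesis
    using mid_shift[OF assms(1), of P] by (simp add: distrib_left mid_commute algebra_simps)
qed

definition row_factor :: "nat \<Rightarrow> superseries" where
  "row_factor t = (if t \<in> G then theta (Suc (Suc t)) else c t)"

definition row_correction :: "nat \<Rightarrow> superseries \<Rightarrow> superseries" where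
  "row_correction t f = (if t \<in> G then (theta (Suc (Suc (Suc t))) - theta (Suc (Suc t))) * f else 0)"

lemma row_eq: "row w P1 P2 t i j moved = row_factor t * total w P1 P2 (Suc t) i j +
    (if moved then row_correction t (partial w P1 P2 (Suc t) i j) else 0)"
  by (simp add: row_def row_factor_def row_correction_def)

lemma parity_row_factor: "theta_parity (row_factor t)"
  by (simp add: row_factor_def parity_c)

lemma row_correction_exchanged:
  "diff_exchanged (Suc t) i \<Longrightarrow> row_correction t (FW (Suc t) i i) = zvar * row_correction t (FV (Suc t) i i)"
  by (simp add: diff_exchanged_def row_correction_def)

text \<open>A correction arises only when row \<open>t\<close> exceeds its minimum, and this same
  condition sets one of the provisional rows to \<open>Suc t\<close>: the second one in
  \<open>V\<close>, the first one in \<open>W\<close>. The other one is irrelevant by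
  \<open>FV_indep\<close> and \<open>FW_indep\<close>. Hence \<open>diff_exchanged\<close> is
  required only at the provisional row \<open>Suc t\<close>.\<close>

lemma exchange_step_upper:
  assumes t: "t < N" "R \<le> t"
    and IH: "\<And>i j. exchanged (Suc t) i j" "diff_exchanged (Suc t) (Suc t)"
  shows "exchanged t i j" "diff_exchanged t t"
proof -
  have "exchanged t i j \<and> diff_exchanged t t"
  proof (cases "p t = q t")
    case True
    then have "t \<notin> G" using G[of t] by auto
    with True have "TV t i j = row_factor t * TV (Suc t) i j" "TW t i j = row_factor t * TW (Suc t) i j"
      using t by (simp_all add: total_degenerate row_factor_def)
    then show ?thesis
      using IH(1)[of i j] True t by (simp add: exchanged_def diff_exchanged_def partial_degenerate)
  next
    case False
    then have pq: "p t < q t" using bounds[of t] by simp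
    let ?S = "Suc t"
    define X where "X i j = row_factor t * TV ?S i j" for i j
    define Y where "Y = row_correction t (FV ?S ?S ?S)"
    have X: "row_factor t * TW ?S i j = X i j" for i j
      using IH(1)[of i j] by (simp add: X_def exchanged_def)
    have indep: "FV ?S i ?S = FV ?S ?S ?S" "FW ?S ?S j = FW ?S ?S ?S" for i j
      using t by (intro FV_indep FW_indep; simp)+
    have Y: "row_correction t (FV ?S i ?S) = Y" "row_correction t (FW ?S ?S j) = zvar * Y" for i j
      using row_correction_exchanged[OF IH(2)] indep(1)[of i] indep(2)[of j] by (simp_all only: Y_def)
    note eqs = FV_eq[OF t(1) pq] TV_eq[OF t(1) pq] FW_eq[OF t(1) pq] TW_eq[OF t(1) pq] row_eq
    have FV: "FV t i j = X ?S j + mid t * (X ?S ?S + Y)" for i j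
      using t by (simp add: eqs Y X_def)
    have TV: "TV t i j = FV t i j + zvar ^ (q t - p t) * (X i ?S + Y)"
      using t by (simp add: eqs(2) row_eq Y X_def)
    have FW: "FW t i j = zvar ^ (q t - p t) * X i ?S + mid t * (X ?S ?S + zvar * Y)" for i j
      using t by (simp add: eqs Y X)
    have TW: "TW t i j = FW t i j + (X ?S j + zvar * Y)"
      using t by (simp add: eqs(4) row_eq Y X)
    have "exchanged t i j"
      unfolding exchanged_def TV TW FV FW by (rule exchange_algebra[OF pq])
    moreover have "diff_exchanged t t"
      unfolding diff_exchanged_def FV FW
    proof (rule diff_exchange_algebra[OF pq])
      \<comment> \<open>The thetas in the difference stand for the rows \<open>?S\<close> and
        \<open>t\<close>, which are just the provisional rows that have to be identified
        here.\<close>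
      show "(theta (Suc ?S) - theta ?S) * X ?S t = (theta (Suc ?S) - theta ?S) * X ?S ?S"
        "(theta (Suc ?S) - theta ?S) * X t ?S = (theta (Suc ?S) - theta ?S) * X ?S ?S"
        unfolding X_def
        by (intro theta_diff_mult_cong[OF parity_row_factor];
            metis theta_diff_total[of wV] theta_parity_simps(3))+
    qed
    ultimately show ?thesis ..
  qed
  then show "exchanged t i j" "diff_exchanged t t" by blast+
qed

text \<open>Rows before \<open>R\<close> never decide about a new circle, so both provisional rows
  stay \<open>R\<close> and the three classes of values share one \<open>X\<close>.\<close>

lemma exchange_step_lower:
  assumes t: "t < N" "t < R" and IH: "exchanged (Suc t) R R" "diff_exchanged (Suc t) R"
  shows "exchanged t R R" "diff_exchanged t R"
proof -
  have "exchanged t R R \<and> diff_exchanged t R"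
  proof (cases "p t = q t")
    case True
    then have "t \<notin> G" using G[of t] by auto
    with True have "TV t R R = row_factor t * TV (Suc t) R R" "TW t R R = row_factor t * TW (Suc t) R R"
      using t by (simp_all add: total_degenerate row_factor_def)
    then show ?thesis
      using IH(1) True t by (simp add: exchanged_def diff_exchanged_def partial_degenerate)
  next
    case False
    then have pq: "p t < q t" using bounds[of t] by simp
    define X where "X = row_factor t * TV (Suc t) R R"
    define Y where "Y = row_correction t (FV (Suc t) R R)"
    have X: "row_factor t * TW (Suc t) R R = X"
      using IH(1) by (simp add: X_def exchanged_def)
    have Y: "row_correction t (FW (Suc t) R R) = zvar * Y"
      using row_correction_exchanged[OF IH(2)] by (simp add: Y_def)
    have FV: "FV t R R = X + mid t * (X + Y)"
      using t by (simp add: FV_eq[OF t(1) pq] row_eq X_def Y_def)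
    have TV: "TV t R R = FV t R R + zvar ^ (q t - p t) * (X + Y)"
      using t by (simp add: TV_eq[OF t(1) pq] row_eq X_def Y_def)
    have FW: "FW t R R = zvar ^ (q t - p t) * X + mid t * (X + zvar * Y)"
      using t by (simp add: FW_eq[OF t(1) pq] row_eq X Y)
    have TW: "TW t R R = FW t R R + (X + zvar * Y)"
      using t by (simp add: TW_eq[OF t(1) pq] row_eq X Y)
    have "exchanged t R R"
      unfolding exchanged_def TV TW FV FW by (rule exchange_algebra[OF pq])
    moreover have "diff_exchanged t R"
      unfolding diff_exchanged_def FV FW by (rule diff_exchange_algebra[OF pq]) simp_all
    ultimately show ?thesis ..
  qed
  then show "exchanged t R R" "diff_exchanged t R" by blast+
qed

theorem exchange_identity: "TV 0 R R = TW 0 R R"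
proof -
  have "(\<forall>i j. exchanged t i j) \<and> diff_exchanged t t" if "R \<le> t" "t \<le> N" for t
    using that(2,1)
  proof (induction rule: inc_induct)
    case base
    have "exchanged N i j" for i j
      by (simp add: exchanged_def total_def summand_def dom_N res_def)
    moreover have "diff_exchanged N N"
      using far[of N] by (simp add: diff_exchanged_def partial_degenerate)
    ultimately show ?case by blast
  next
    case (step t)
    then show ?case using exchange_step_upper by simp
  qed
  \<comment> \<open>At row \<open>R\<close> the provisional row used so far, the current row,
    coincides with the constant \<open>R\<close> used for the remaining rows.\<close>
  then have R: "exchanged R R R" "diff_exchanged R R"
    using R_le by auto
  have "exchanged t R R \<and> diff_exchanged t R" if "t \<le> R" for t
    using that
  proof (induction rule: inc_induct)
    case base
    then show ?case using R by simp
  next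
    case (step t)
    then show ?case using exchange_step_lower R_le by simp
  qed
  then show ?thesis unfolding exchanged_def by blast
qed

end

section \<open>Two consecutive steps on shapes\<close>

text \<open>
  A superpartition is encoded by the row lengths of \<open>\<Lambda>\<^sup>+\<close> and the set of rows that carry a
  circle; rows are numbered from 0 here. In a step from \<open>l\<close> to \<open>m\<close>, condition (2) sends a circle in
  row \<open>s\<close> to row \<open>moved l m s\<close>. The first column without a new box is met by the last
  row that is not extended up to the old length of the row above it; so \<open>entry l m\<close>
  is the row of the new circle of a barred step.
\<close>

definition strip :: "(nat \<Rightarrow> nat) \<Rightarrow> (nat \<Rightarrow> nat) \<Rightarrow> bool" where
  "strip l m \<longleftrightarrow> (\<forall>t. l t \<le> m t \<and> m (Suc t) \<le> l t)"

definition moved :: "(nat \<Rightarrow> nat) \<Rightarrow> (nat \<Rightarrow> nat) \<Rightarrow> nat \<Rightarrow> nat" where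
  "moved l m s = (if l s < m s then Suc s else s)"

definition entry :: "(nat \<Rightarrow> nat) \<Rightarrow> (nat \<Rightarrow> nat) \<Rightarrow> nat" where
  "entry l m = (LEAST r. \<forall>t \<ge> r. l t \<le> m (Suc t))"

definition addable :: "(nat \<Rightarrow> nat) \<Rightarrow> nat \<Rightarrow> bool" where
  "addable l t \<longleftrightarrow> (\<forall>r. t = Suc r \<longrightarrow> l t < l r)"

fun barred :: "weight_entry \<Rightarrow> bool" where
  "barred (Plain a) = False"
| "barred (Barred a) = True"

definition next_rows :: "weight_entry \<Rightarrow> (nat \<Rightarrow> nat) \<Rightarrow> (nat \<Rightarrow> nat) \<Rightarrow> nat list \<Rightarrow> nat list" where
  "next_rows a l m ss = map (moved l m) ss @ (if barred a then [entry l m] else [])"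

lemma entry_props:
  assumes "\<And>t. N \<le> t \<Longrightarrow> l t = 0"
  shows "entry l m \<le> N" "\<And>t. entry l m \<le> t \<Longrightarrow> l t \<le> m (Suc t)"
    "\<And>r. entry l m = Suc r \<Longrightarrow> m (Suc r) < l r"
proof -
  let ?P = "\<lambda>r. \<forall>t \<ge> r. l t \<le> m (Suc t)"
  have N: "?P N" using assms by simp
  show "entry l m \<le> N" unfolding entry_def by (rule Least_le[of ?P, OF N])
  have P: "?P (entry l m)" unfolding entry_def by (rule LeastI[of ?P, OF N])
  then show "\<And>t. entry l m \<le> t \<Longrightarrow> l t \<le> m (Suc t)" by blast
  fix r assume r: "entry l m = Suc r"
  then have "\<not> ?P r" unfolding entry_def using not_less_Least[of r ?P] by simp
  then obtain t where t: "r \<le> t" "m (Suc t) < l t" by (auto simp: not_le)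
  then have "t = r" using P r by (metis Suc_leI le_neq_implies_less not_le)
  then show "m (Suc r) < l r" using t by simp
qed

lemma entryI:
  assumes "\<And>t. r \<le> t \<Longrightarrow> l t \<le> m (Suc t)" "\<And>r'. r = Suc r' \<Longrightarrow> m (Suc r') < l r'"
  shows "entry l m = r"
  unfolding entry_def
proof (rule Least_equality)
  show "\<forall>t \<ge> r. l t \<le> m (Suc t)" using assms(1) by blast
  fix s assume s: "\<forall>t \<ge> s. l t \<le> m (Suc t)"
  show "r \<le> s"
  proof (cases r)
    case (Suc r')
    then have "\<not> s \<le> r'" using s assms(2)[OF Suc] by force
    then show ?thesis using Suc by simp
  qed simp
qed

lemma (in exchange) res_props:
  "R \<le> res P 0 R" "\<And>t. res P 0 R \<le> t \<Longrightarrow> t < N \<Longrightarrow> \<not> P t"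
  "res P 0 R = R \<or> (\<exists>r. res P 0 R = Suc r \<and> R \<le> r \<and> r < N \<and> P r)"
proof -
  define g where "g n = foldl (\<lambda>i s. if R \<le> s \<and> P s then Suc s else i) R [0..<n]" for n
  have "R \<le> g n \<and> (\<forall>t. g n \<le> t \<and> t < n \<longrightarrow> \<not> P t) \<and>
      (g n = R \<or> (\<exists>r. g n = Suc r \<and> R \<le> r \<and> r < n \<and> P r))" for n
  proof (induction n)
    case 0
    then show ?case by (simp add: g_def)
  next
    case (Suc n)
    have g: "g (Suc n) = (if R \<le> n \<and> P n then Suc n else g n)" by (simp add: g_def)
    show ?case
    proof (cases "R \<le> n \<and> P n")
      case True
      then show ?thesis using g by auto
    next
      case False
      have "g (Suc n) = g n" unfolding g if_not_P[OF False] ..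
      then show ?thesis using Suc False by (auto simp: less_Suc_eq)
    qed
  qed
  from this[of N] show "R \<le> res P 0 R" "\<And>t. res P 0 R \<le> t \<Longrightarrow> t < N \<Longrightarrow> \<not> P t"
    "res P 0 R = R \<or> (\<exists>r. res P 0 R = Suc r \<and> R \<le> r \<and> r < N \<and> P r)"
    by (auto simp: res_def g_def)
qed

lemma theta_zvar_power_commute: "theta i * zvar ^ k = zvar ^ k * theta i"
  by (induction k) (simp_all add: mult.assoc theta_zvar_left_commute)

locale two_steps =
  fixes N :: nat and l n :: "nat \<Rightarrow> nat" and S :: "nat set" and a b :: weight_entry
  assumes l_zero: "N \<le> t \<Longrightarrow> l t = 0" and n_zero: "N \<le> t \<Longrightarrow> n t = 0"
    and S: "s \<in> S \<Longrightarrow> s < N" "s \<in> S \<Longrightarrow> addable l s"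
begin

definition mids :: "(nat \<Rightarrow> nat) set" where
  "mids = {m. strip l m \<and> strip m n}"

definition ss :: "nat list" where
  "ss = sorted_list_of_set S"

text \<open>The conditions of two consecutive horizontal strips, solved for a single row of the
  intermediate shape. Each bound involves only the two ends, which is why the rows vary
  independently.\<close>

definition lower :: "nat \<Rightarrow> nat" where
  "lower t = max (l t) (n (Suc t))"

definition upper :: "nat \<Rightarrow> nat" where
  "upper t = (case t of 0 \<Rightarrow> n 0 | Suc r \<Rightarrow> min (l r) (n t))"

definition free_rows :: "nat set" where
  "free_rows = {s \<in> S. n (Suc s) \<le> l s \<and> l s < n s}"

text \<open>If \<open>l t < n (Suc t)\<close>, every intermediate shape extends row \<open>t\<close>
  in the first step and row \<open>Suc t\<close> in the second, so the circle moves twice. In a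
  circle row that is neither of this kind nor free, row \<open>t\<close> is never extended and the
  circle stays.\<close>

definition forced :: "nat \<Rightarrow> superseries" where
  "forced t = (if t \<notin> S then 1 else if l t < n (Suc t) then theta (Suc (Suc (Suc t))) else theta (Suc t))"

lemma mids_eq: "m \<in> mids \<longleftrightarrow> (\<forall>t. lower t \<le> m t \<and> m t \<le> upper t)"
proof
  assume "m \<in> mids"
  then have "l t \<le> m t" "m (Suc t) \<le> l t" "m t \<le> n t" "n (Suc t) \<le> m t" for t
    by (auto simp: mids_def strip_def)
  then show "\<forall>t. lower t \<le> m t \<and> m t \<le> upper t"
    by (auto simp: lower_def upper_def split: nat.split)
next
  assume *: "\<forall>t. lower t \<le> m t \<and> m t \<le> upper t"
  have "l t \<le> m t" "n (Suc t) \<le> m t" "m (Suc t) \<le> l t" for t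
    using *[rule_format, of t] *[rule_format, of "Suc t"] by (auto simp: lower_def upper_def)
  moreover have "m t \<le> n t" for t
    using *[rule_format, of t] by (cases t) (auto simp: upper_def)
  ultimately show "m \<in> mids" by (auto simp: mids_def strip_def)
qed

lemma entry_total:
  "entry l n \<le> N" "\<And>t. entry l n \<le> t \<Longrightarrow> l t \<le> n (Suc t)"
  "\<And>r. entry l n = Suc r \<Longrightarrow> n (Suc r) < l r"
  using entry_props[of N l n] l_zero by blast+

lemma ex: "mids \<noteq> {} \<Longrightarrow>
  exchange N (entry l n) lower upper free_rows forced"
proof
  fix t
  assume "mids \<noteq> {}"
  then obtain m where m: "m \<in> mids" by blast
  then show "lower t \<le> upper t" unfolding mids_eq by (meson le_trans)
  show "lower t = upper t" if "N \<le> t"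
    using that l_zero[of t] n_zero[of t] n_zero[of "Suc t"]
    by (cases t) (auto simp: lower_def upper_def)
  show "entry l n \<le> N" by (rule entry_total)
  show "lower t < upper t" if "t \<in> free_rows"
  proof -
    have t: "t \<in> S" "n (Suc t) \<le> l t" "l t < n t" using that by (auto simp: free_rows_def)
    then have "addable l t" using S by blast
    then show ?thesis using t by (cases t) (auto simp: lower_def upper_def addable_def)
  qed
  show "theta_parity (forced t)" by (simp add: forced_def)
qed

definition circle_word :: "weight_entry \<Rightarrow> weight_entry \<Rightarrow> (nat \<Rightarrow> nat) \<Rightarrow> superseries" where
  "circle_word x y m = prod_list (map (\<lambda>t. theta (Suc t)) (next_rows y m n (next_rows x l m ss)))"

text \<open>\<open>lower t\<close> and \<open>upper (Suc t)\<close> are the maximum and the minimum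
  of the same two numbers. It follows that the boxes forced into the first step are as many as those
  forced into the second, so both generating functions have the same power of \<open>zvar\<close> in
  front.\<close>

lemma bounds_sum: "mids \<noteq> {} \<Longrightarrow> (\<Sum>t<N. lower t - l t) = (\<Sum>t<N. n t - upper t)"
proof -
  have lower: "l t \<le> lower t" and upper: "upper t \<le> n t" for t
    by (auto simp: lower_def upper_def split: nat.split)
  have "lower t + upper (Suc t) = l t + n (Suc t)" for t
    by (auto simp: lower_def upper_def)
  then have "(\<Sum>t<N. lower t) + (\<Sum>t<N. upper (Suc t)) = (\<Sum>t<N. l t) + (\<Sum>t<N. n (Suc t))"
    by (simp flip: sum.distrib)
  moreover have "upper 0 + (\<Sum>t<N. upper (Suc t)) = (\<Sum>t<N. upper t) + upper N"
    "n 0 + (\<Sum>t<N. n (Suc t)) = (\<Sum>t<N. n t) + n N"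
    by (simp_all flip: sum.lessThan_Suc_shift)
  moreover have "upper N = n N" "upper 0 = n 0"
    using upper[of N] n_zero[of N] by (auto simp: upper_def)
  ultimately have "(\<Sum>t<N. lower t) + (\<Sum>t<N. upper t) = (\<Sum>t<N. l t) + (\<Sum>t<N. n t)"
    by linarith
  moreover have "(\<Sum>t<N. lower t) = (\<Sum>t<N. l t) + (\<Sum>t<N. lower t - l t)"
    "(\<Sum>t<N. n t) = (\<Sum>t<N. upper t) + (\<Sum>t<N. n t - upper t)"
    using lower upper by (simp_all flip: sum.distrib)
  ultimately show ?thesis by linarith
qed

text \<open>A circle in a free row moves at least once: if row \<open>t\<close> is not extended in
  the first step, it still has to grow to \<open>n t > l t\<close> in the second.\<close>

lemma moved_twice:
  assumes "m \<in> mids" "t \<in> S"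
  shows "moved m n (moved l m t) = (if t \<in> free_rows
      then if lower t < m t \<and> m (Suc t) < upper (Suc t) then Suc (Suc t) else Suc t
      else if l t < n (Suc t) then Suc (Suc t) else t)"
proof -
  have m: "l t \<le> m t" "m (Suc t) \<le> l t" "m t \<le> n t" "n (Suc t) \<le> m t" "m (Suc t) \<le> n (Suc t)"
    using assms(1) by (auto simp: mids_def strip_def)
  then show ?thesis
    using assms(2) by (auto simp: moved_def free_rows_def lower_def upper_def)
qed

text \<open>From row \<open>entry l n\<close> on, \<open>lower t\<close> equals
  \<open>n (Suc t)\<close>. So \<open>m t\<close> exceeds its minimum exactly where the second step
  fails to extend row \<open>Suc t\<close> up to the length \<open>m t\<close>.\<close>

lemma entry_second:
  assumes "m \<in> mids"
  shows "entry m n = exchange.res N (entry l n) (\<lambda>s. lower s < m s) 0 (entry l n)"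
proof -
  interpret exchange N "entry l n" lower upper free_rows forced "barred a" "barred b"
    using ex assms by blast
  let ?R = "entry l n" and ?r = "res (\<lambda>s. lower s < m s) 0 (entry l n)"
  note R = entry_total
  have m: "l t \<le> m t" "m (Suc t) \<le> l t" "m t \<le> n t" "n (Suc t) \<le> m t" for t
    using assms by (auto simp: mids_def strip_def)
  show ?thesis
  proof (rule entryI)
    fix t assume t: "?r \<le> t"
    show "m t \<le> n (Suc t)"
    proof (cases "t < N")
      case True
      then have "\<not> lower t < m t" using res_props(2) t by blast
      moreover have "l t \<le> n (Suc t)"
        using R(2) le_trans[OF res_props(1) t] by blast
      ultimately show ?thesis by (simp add: lower_def max_absorb2 not_less)
    next
      case False
      then show ?thesis using m(3)[of t] n_zero[of t] by simp
    qed
  next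
    fix r assume r: "?r = Suc r"
    from res_props(3)[of "\<lambda>s. lower s < m s"] show "n (Suc r) < m r"
    proof (elim disjE exE conjE)
      assume "?r = ?R"
      then show ?thesis using R(3)[of r] r m(1)[of r] by simp
    next
      fix r' assume "?r = Suc r'" "lower r' < m r'"
      then show ?thesis using r by (simp add: lower_def)
    qed
  qed
qed

text \<open>The circle created first has to be followed through the second step. If some row from
  \<open>entry l n\<close> on is not maximal, the circle is created in the last such row, which the
  second step extends, so it is pushed one row down. Otherwise it is created in row
  \<open>entry l n\<close>, which is not extended again.\<close>

lemma entry_first:
  assumes "m \<in> mids"
  shows "moved m n (entry l m) = exchange.res N (entry l n) (\<lambda>s. m s < upper s) 0 (entry l n)"
proof -
  interpret exchange N "entry l n" lower upper free_rows forced "barred a" "barred b"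
    using ex assms by blast
  let ?R = "entry l n" and ?r = "res (\<lambda>s. m s < upper s) 0 (entry l n)"
  note R = entry_total
  have m: "l t \<le> m t" "m (Suc t) \<le> l t" "m t \<le> n t" "n (Suc t) \<le> m t" "m t \<le> upper t" for t
    using assms mids_eq by (auto simp: mids_def strip_def)
  have full: "l t \<le> m (Suc t)" if "?r \<le> Suc t" "?R \<le> t" for t
  proof (cases "Suc t < N")
    case True
    then have "\<not> m (Suc t) < upper (Suc t)" using res_props(2) that by blast
    then show ?thesis using R(2)[of t] that(2) by (auto simp: upper_def)
  next
    case False
    then show ?thesis using R(2)[of t] n_zero[of "Suc t"] that(2) by simp
  qed
  from res_props(3)[of "\<lambda>s. m s < upper s"] show ?thesis
  proof (elim disjE exE conjE)
    assume r: "?r = ?R"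
    have "entry l m = ?R"
    proof (rule entryI)
      show "l t \<le> m (Suc t)" if "?R \<le> t" for t
        using full r that by simp
      show "m (Suc r') < l r'" if "?R = Suc r'" for r'
        using R(3)[OF that] m(3)[of "Suc r'"] by simp
    qed
    moreover have "n ?R \<le> m ?R"
    proof (cases "?R < N")
      case True
      then have "\<not> m ?R < upper ?R" using res_props(2)[of "\<lambda>s. m s < upper s" ?R] r by simp
      moreover have "upper ?R = n ?R"
        using R(3) by (auto simp: upper_def min_def split: nat.split)
      ultimately show ?thesis by simp
    next
      case False
      then show ?thesis using n_zero by simp
    qed
    ultimately show ?thesis using r by (simp add: moved_def)
  next
    fix r' assume r: "?r = Suc r'" "?R \<le> r'" "r' < N" "m r' < upper r'"
    have "entry l m = r'"
    proof (rule entryI)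
      show "l t \<le> m (Suc t)" if "r' \<le> t" for t
        using full r that by simp
      show "m (Suc r'') < l r''" if "r' = Suc r''" for r''
        using r(4) that by (simp add: upper_def)
    qed
    moreover have "m r' < n r'"
      using r(4) by (cases r') (auto simp: upper_def)
    ultimately show ?thesis using r by (simp add: moved_def)
  qed
qed

lemma scaled_prod:
  assumes "\<And>t. f t = 1 \<or> (\<exists>i. f t = theta i)"
  shows "prod_list (map (\<lambda>t. zvar ^ g t * f t) xs) = zvar ^ (\<Sum>t\<leftarrow>xs. g t) * prod_list (map f xs)"
proof (induction xs)
  case (Cons x xs)
  have "f x * zvar ^ k = zvar ^ k * f x" for k
    using assms[of x] theta_zvar_power_commute by auto
  then have "f x * (zvar ^ k * h) = zvar ^ k * (f x * h)" for k h
    by (metis mult.assoc)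
  then show ?case using Cons by (simp add: power_add mult.assoc)
qed simp

lemma prod_list_indicator:
  "prod_list (map (\<lambda>t. if t \<in> S then f t else 1) xs) = prod_list (map f (filter (\<lambda>t. t \<in> S) xs))"
  for f :: "nat \<Rightarrow> superseries"
  by (induction xs) auto

lemma ss_eq: "ss = filter (\<lambda>t. t \<in> S) [0..<N]"
  unfolding ss_def
  by (rule sorted_list_of_set.idem_if_sorted_distinct[THEN trans[rotated]])
    (use S(1) in \<open>auto intro!: arg_cong[of _ _ sorted_list_of_set] sorted_filter simp: sorted_wrt_filter\<close>)

lemma vec_prod:
  assumes "m \<in> mids"
  shows "prod_list (map (\<lambda>t. zvar ^ g t * exchange.vec lower upper free_rows forced m t) [0..<N]) =
    zvar ^ (\<Sum>t<N. g t) * prod_list (map (\<lambda>t. theta (Suc (moved m n (moved l m t)))) ss)"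
proof -
  interpret exchange N "entry l n" lower upper free_rows forced "barred a" "barred b"
    using ex assms by blast
  have vec: "vec m t = (if t \<in> S then theta (Suc (moved m n (moved l m t))) else 1)" for t
  proof (cases "t \<in> S")
    case True
    show ?thesis
      unfolding vec_def forced_def moved_twice[OF assms True] using True by simp
  next
    case False
    then have "t \<notin> free_rows" by (simp add: free_rows_def)
    then show ?thesis unfolding vec_def forced_def using False by simp
  qed
  have "prod_list (map (\<lambda>t. zvar ^ g t * vec m t) [0..<N]) =
      zvar ^ (\<Sum>t\<leftarrow>[0..<N]. g t) * prod_list (map (vec m) [0..<N])"
    by (rule scaled_prod) (auto simp: vec)
  also have "map (vec m) [0..<N] =
      map (\<lambda>t. if t \<in> S then theta (Suc (moved m n (moved l m t))) else 1) [0..<N]"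
    by (simp add: vec)
  also have "(\<Sum>t\<leftarrow>[0..<N]. g t) = (\<Sum>t<N. g t)"
    by (simp add: interv_sum_list_conv_sum_set_nat atLeast0LessThan)
  finally show ?thesis by (simp only: prod_list_indicator ss_eq)
qed

theorem two_step_exchange:
  "(\<Sum>m \<in> mids. zvar ^ (\<Sum>t<N. m t - l t) * circle_word a b m) =
   (if barred a \<and> barred b then -1 else 1) *
     (\<Sum>m \<in> mids. zvar ^ (\<Sum>t<N. n t - m t) * circle_word b a m)"
proof (cases "mids = {}")
  case False
  interpret exchange N "entry l n" lower upper free_rows forced "barred a" "barred b"
    using ex False by blast
  let ?R = "entry l n"
  let ?e = "(if barred a \<and> barred b then -1 else 1) :: superseries"
  let ?c = "\<Sum>t<N. lower t - l t"
  have dom: "dom 0 = mids" using mids_eq by (auto simp: dom_def)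
  have low: "l t \<le> lower t" and up: "upper t \<le> n t" for t
    by (auto simp: lower_def upper_def split: nat.split)
  have first: "zvar ^ (\<Sum>t<N. m t - l t) * circle_word a b m =
      zvar ^ ?c * summand wV not_max not_min 0 ?R ?R m"
    if m: "m \<in> mids" for m
  proof -
    have "m t - l t = (lower t - l t) + (m t - lower t)" for t
      using m low[of t] unfolding mids_eq by (simp add: add.commute)
    then have exp: "(\<Sum>t<N. m t - l t) = ?c + (\<Sum>t<N. m t - lower t)"
      by (simp add: sum.distrib)
    have "circle_word a b m = prod_list (map (\<lambda>t. theta (Suc (moved m n (moved l m t)))) ss) *
        new_circles (moved m n (entry l m)) (entry m n)"
      by (simp add: circle_word_def next_rows_def new_circles_def comp_def mult.assoc)
    then show ?thesis
      unfolding summand_def vec_prod[OF m] exp power_add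
      by (simp add: entry_first[OF m] entry_second[OF m] mult.assoc)
  qed
  have second: "?e * (zvar ^ (\<Sum>t<N. n t - m t) * circle_word b a m) =
      zvar ^ ?c * summand wW not_min not_max 0 ?R ?R m"
    if m: "m \<in> mids" for m
  proof -
    have "n t - m t = (n t - upper t) + (upper t - m t)" for t
      using m up[of t] unfolding mids_eq by (simp add: add.commute)
    then have exp: "(\<Sum>t<N. n t - m t) = ?c + (\<Sum>t<N. upper t - m t)"
      by (simp add: sum.distrib bounds_sum[OF False])
    \<comment> \<open>The old circles end in the same rows for either order; only the two new thetas
      trade places, and this is the sole origin of the sign.\<close>
    have "?e * circle_word b a m = prod_list (map (\<lambda>t. theta (Suc (moved m n (moved l m t)))) ss) *
        new_circles (entry m n) (moved m n (entry l m))"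
      using theta_anticommute[of "Suc (moved m n (entry l m))" "Suc (entry m n)"]
      by (simp add: circle_word_def next_rows_def new_circles_def comp_def mult.assoc)
    moreover have "?e * (f * g) = f * (?e * g)" for f g by simp
    ultimately have "?e * (zvar ^ (\<Sum>t<N. n t - m t) * circle_word b a m) = zvar ^ (\<Sum>t<N. n t - m t) *
        (prod_list (map (\<lambda>t. theta (Suc (moved m n (moved l m t)))) ss) *
        new_circles (entry m n) (moved m n (entry l m)))"
      by (simp only:)
    then show ?thesis
      unfolding summand_def vec_prod[OF m] exp power_add
      by (simp add: entry_first[OF m] entry_second[OF m] mult.assoc)
  qed
  have "(\<Sum>m \<in> mids. zvar ^ (\<Sum>t<N. m t - l t) * circle_word a b m) =
      zvar ^ ?c * TV 0 ?R ?R"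
    unfolding total_def dom sum_distrib_left by (intro sum.cong refl first)
  also have "\<dots> = zvar ^ ?c * TW 0 ?R ?R"
    by (simp only: exchange_identity)
  also have "\<dots> = ?e * (\<Sum>m \<in> mids. zvar ^ (\<Sum>t<N. n t - m t) * circle_word b a m)"
    unfolding total_def dom sum_distrib_left by (intro sum.cong refl second[symmetric])
  finally show ?thesis .
qed simp

end

section \<open>Superpartitions as shapes with marked rows\<close>

lemma decreasing_props [simp]:
  "mset (decreasing xs) = mset xs" "set (decreasing xs) = set xs" "length (decreasing xs) = length xs"
  "sorted_wrt (\<ge>) (decreasing xs)"
  by (simp_all add: decreasing_def sorted_wrt_rev)

lemma length_filter_sorted:
  fixes ys :: "nat list"
  assumes "sorted_wrt (\<ge>) ys"
  shows "t < length (filter (\<lambda>x. c < x) ys) \<longleftrightarrow> t < length ys \<and> c < ys ! t"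
  using assms
proof (induction ys arbitrary: t)
  case (Cons y ys)
  show ?case
  proof (cases "c < y")
    case True
    then show ?thesis using Cons by (cases t) auto
  next
    case False
    then have "\<forall>x \<in> set (y # ys). \<not> c < x" using Cons.prems by auto
    moreover have "(y # ys) ! t \<in> set (y # ys)" if "t < length (y # ys)"
      using that by (rule nth_mem)
    ultimately show ?thesis by (metis filter_False length_0_conv not_less0)
  qed
qed simp

lemma length_filter_decreasing:
  "t < length (filter (\<lambda>x. c < x) xs) \<longleftrightarrow> t < length (decreasing xs) \<and> c < decreasing xs ! t"
proof -
  have "length (filter (\<lambda>x. c < x) xs) = length (filter (\<lambda>x. c < x) (decreasing xs))"
    by (metis decreasing_props(1) mset_filter size_mset)
  then show ?thesis using length_filter_sorted[of "decreasing xs"] by simp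
qed

text \<open>The conjugate partition of \<open>sp_plus L\<close>, obtained without sorting the
  parts.\<close>

definition column :: "spart \<Rightarrow> nat \<Rightarrow> nat" where
  "column L c = length (filter (\<lambda>x. c < x) (fst L @ snd L))"

definition shape :: "spart \<Rightarrow> nat \<Rightarrow> nat" where
  "shape L t = (if t < length (sp_plus L) then sp_plus L ! t else 0)"

text \<open>The circle of a fermionic part \<open>c\<close> sits in the topmost row of length
  \<open>c\<close>, which is preceded exactly by the rows longer than \<open>c\<close>.\<close>

definition circle_rows :: "spart \<Rightarrow> nat set" where
  "circle_rows L = column L ` set (fst L)"

definition row_list :: "spart \<Rightarrow> nat list" where
  "row_list L = sorted_list_of_set (circle_rows L)"

definition spsize :: "spart \<Rightarrow> nat" where
  "spsize L = sum_list (fst L) + sum_list (snd L)"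

definition rows :: "spart \<Rightarrow> nat" where
  "rows L = length (fst L @ snd L)"

lemma less_shape_iff: "c < shape L t \<longleftrightarrow> t < column L c"
  unfolding shape_def column_def sp_plus_def length_filter_decreasing by auto

lemma shape_antimono: "shape L (Suc t) \<le> shape L t"
  by (rule ccontr) (metis less_shape_iff Suc_lessD linorder_not_le order_less_irrefl)

lemma shape_antimono': "s \<le> t \<Longrightarrow> shape L t \<le> shape L s"
  using lift_Suc_antimono_le[of "shape L"] shape_antimono by blast

lemma shape_eq_0: "rows L \<le> t \<Longrightarrow> shape L t = 0"
  by (simp add: shape_def sp_plus_def rows_def)

lemma sum_shape:
  assumes "\<And>t. N \<le> t \<Longrightarrow> shape L t = 0"
  shows "(\<Sum>t<N. shape L t) = spsize L"
proof -
  have "(\<Sum>t<N. shape L t) = (\<Sum>t<max N (rows L). shape L t)"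
    by (rule sum.mono_neutral_left) (auto intro: assms)
  also have "\<dots> = (\<Sum>t<length (sp_plus L). sp_plus L ! t)"
    by (rule sum.mono_neutral_cong_right) (auto simp: shape_def rows_def sp_plus_def)
  also have "\<dots> = sum_list (sp_plus L)"
    by (simp add: sum_list_sum_nth atLeast0LessThan)
  also have "\<dots> = sum_list (fst L @ snd L)"
    unfolding sp_plus_def by (metis decreasing_props(1) sum_mset_sum_list)
  finally show ?thesis by (simp add: spsize_def)
qed

lemma set_young: "set (young ps) = {(Suc t, Suc c) | t c. t < length ps \<and> c < ps ! t}"
proof (intro equalityI subsetI)
  fix z assume "z \<in> set (young ps)"
  then obtain t c where z: "z = (t, c)" "1 \<le> t" "t < length ps + 1" "1 \<le> c" "c < ps ! (t - 1) + 1"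
    by (auto simp: young_def)
  then show "z \<in> {(Suc t, Suc c) | t c. t < length ps \<and> c < ps ! t}"
    by (cases t; cases c) auto
next
  fix z assume "z \<in> {(Suc t, Suc c) | t c. t < length ps \<and> c < ps ! t}"
  then obtain t c where z: "z = (Suc t, Suc c)" "t < length ps" "c < ps ! t" by auto
  then have "Suc t \<in> set [1..<length ps + 1]" "Suc c \<in> set [1..<ps ! (Suc t - 1) + 1]" by auto
  moreover have "set (young ps) = (\<Union>t \<in> set [1..<length ps + 1]. Pair t ` set [1..<ps ! (t - 1) + 1])"
    by (simp add: young_def)
  ultimately show "z \<in> set (young ps)" unfolding z(1) by blast
qed

lemma set_boxes: "set (boxes L) = {(Suc t, Suc c) | t c. c < shape L t}"
  by (auto simp: boxes_def set_young shape_def)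

lemma young_sorted: "sorted (map fst (young ps))" and young_distinct: "distinct (young ps)"
proof -
  have "sorted (map fst (concat (map (\<lambda>t. map (Pair t) (g t)) ts)))" if "sorted ts"
    for g :: "nat \<Rightarrow> nat list" and ts
    using that by (induction ts) (auto simp: sorted_append comp_def map_replicate_const)
  from this[OF sorted_upt] show "sorted (map fst (young ps))" unfolding young_def .
  have "distinct (concat (map (\<lambda>t. map (Pair t) (g t)) ts))" if "distinct ts" "\<forall>t. distinct (g t)"
    for g :: "nat \<Rightarrow> nat list" and ts :: "nat list"
    using that by (induction ts) (auto simp: distinct_map inj_on_def)
  from this[OF distinct_upt allI[OF distinct_upt]] show "distinct (young ps)" unfolding young_def .
qed

definition is_superpartition :: "spart \<Rightarrow> bool" where
  "is_superpartition L \<longleftrightarrow> (\<exists>n m. superpartition n m L)"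

lemma superpartition_iff:
  "superpartition n m L \<longleftrightarrow> is_superpartition L \<and> spsize L = n \<and> df L = m"
  by (auto simp: is_superpartition_def superpartition_def spsize_def df_def split: prod.splits)

lemma is_superpartition_iff:
  "is_superpartition L \<longleftrightarrow> sorted_wrt (>) (fst L) \<and> sorted_wrt (\<ge>) (snd L) \<and> (\<forall>b \<in> set (snd L). 1 \<le> b)"
  by (cases L) (auto simp: is_superpartition_def superpartition_def)

lemma distinct_fst: "is_superpartition L \<Longrightarrow> distinct (fst L)"
proof -
  assume "is_superpartition L"
  then have "sorted_wrt (<) (rev (fst L))"
    by (simp add: is_superpartition_iff sorted_wrt_rev)
  then have "distinct (rev (fst L))" by (simp only: strict_sorted_iff)
  then show ?thesis by simp
qed

text \<open>A part equal to \<open>c\<close> is counted in every column with a smaller index but not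
  in column \<open>c\<close>, so row \<open>column L c\<close> is longer than every
  \<open>c' < c\<close> and not longer than \<open>c\<close>.\<close>

lemma shape_column:
  assumes "c \<in> set (fst L)"
  shows "shape L (column L c) = c"
proof -
  have "column L c < column L c'" if "c' < c" for c'
  proof -
    have "length (filter (\<lambda>x. c < x) xs) + (if c \<in> set xs then 1 else 0) \<le> length (filter (\<lambda>x. c' < x) xs)"
      for xs
      using that by (induction xs) auto
    from this[of "fst L @ snd L"] show ?thesis using assms by (simp add: column_def)
  qed
  then have "c' < shape L (column L c)" if "c' < c" for c'
    using that less_shape_iff by blast
  moreover have "\<not> c < shape L (column L c)" by (simp add: less_shape_iff)
  ultimately show ?thesis by (metis less_irrefl linorder_neqE_nat)
qed

text \<open>Fermionic parts are distinct, so raising them by one increases the number of parts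
  exceeding \<open>c\<close> by one if \<open>c\<close> is fermionic and leaves it unchanged
  otherwise.\<close>

lemma set_circles:
  assumes "is_superpartition L"
  shows "set (circles L) = (\<lambda>t. (Suc t, Suc (shape L t))) ` circle_rows L"
proof -
  have count: "length (filter (\<lambda>x. c < x) (map Suc xs)) =
      length (filter (\<lambda>x. c < x) xs) + (if c \<in> set xs then 1 else 0)"
    if "distinct xs" for c xs
    using that by (induction xs) (auto simp: less_Suc_eq)
  have "(Suc t, Suc c) \<in> set (young (sp_oplus L)) \<longleftrightarrow>
      t < column L c + (if c \<in> set (fst L) then 1 else 0)" for t c
    using length_filter_decreasing[of t c "map Suc (fst L) @ snd L"] count[OF distinct_fst[OF assms], of c]
    by (auto simp: set_young sp_oplus_def column_def)
  then have "(Suc t, Suc c) \<in> set (circles L) \<longleftrightarrow> c \<in> set (fst L) \<and> t = column L c" for t c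
    by (auto simp: circles_def set_boxes less_shape_iff split: if_splits)
  moreover have "\<exists>t c. z = (Suc t, Suc c)" if "z \<in> set (circles L)" for z
    using that by (auto simp: circles_def set_young)
  ultimately have "set (circles L) = (\<lambda>c. (Suc (column L c), Suc c)) ` set (fst L)"
    by fast
  also have "\<dots> = (\<lambda>t. (Suc t, Suc (shape L t))) ` circle_rows L"
    unfolding circle_rows_def image_image by (intro image_cong refl) (simp add: shape_column)
  finally show ?thesis .
qed

lemma finite_circle_rows [simp]: "finite (circle_rows L)"
  by (simp add: circle_rows_def)

lemma row_list_props [simp]: "set (row_list L) = circle_rows L" "sorted (row_list L)" "distinct (row_list L)"
  by (simp_all add: row_list_def)

lemma circles_eq:
  assumes "is_superpartition L"
  shows "circles L = map (\<lambda>t. (Suc t, Suc (shape L t))) (row_list L)"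
proof -
  let ?f = "\<lambda>t. (Suc t, Suc (shape L t))"
  have "sorted (map fst (circles L))"
    unfolding circles_def using sorted_filter[of fst "young (sp_oplus L)"] young_sorted by blast
  moreover have "distinct (map fst (circles L))"
    unfolding distinct_map using young_distinct set_circles[OF assms]
    by (auto simp: circles_def inj_on_def)
  moreover have "set (map fst (circles L)) = set (map Suc (row_list L))"
    using set_circles[OF assms] by force
  moreover have "sorted (map Suc (row_list L))" "distinct (map Suc (row_list L))"
    by (simp_all add: distinct_map sorted_map)
  ultimately have fst: "map fst (circles L) = map Suc (row_list L)"
    by (metis sorted_distinct_set_unique)
  have "circles L = map (\<lambda>i. (i, Suc (shape L (i - 1)))) (map fst (circles L))"
    using set_circles[OF assms] by (auto simp: comp_def intro!: map_idI[symmetric])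
  then show ?thesis unfolding fst by (simp add: comp_def)
qed

lemma length_row_list: "is_superpartition L \<Longrightarrow> length (row_list L) = df L"
proof -
  assume L: "is_superpartition L"
  have "inj_on (column L) (set (fst L))"
    by (rule inj_on_inverseI[of _ "shape L"]) (rule shape_column)
  then have "card (circle_rows L) = df L"
    using distinct_card[OF distinct_fst[OF L]] by (simp add: circle_rows_def card_image df_def)
  then show ?thesis by (simp add: row_list_def)
qed

lemma circle_rows_props:
  assumes "s \<in> circle_rows L"
  shows "addable (shape L) s" "s < rows L"
proof -
  obtain c where c: "c \<in> set (fst L)" "s = column L c" using assms by (auto simp: circle_rows_def)
  show "addable (shape L) s"
    unfolding addable_def
  proof (intro allI impI)
    fix r assume "s = Suc r"
    then have "c < shape L r" using c by (simp add: less_shape_iff)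
    then show "shape L s < shape L r" using shape_column[OF c(1)] c(2) by simp
  qed
  have "length (filter (\<lambda>x. c < x) (fst L @ snd L)) < length (fst L @ snd L)"
    by (rule length_filter_less[of c]) (use c(1) in auto)
  then show "s < rows L" using c by (simp add: column_def rows_def)
qed

text \<open>The fermionic parts are the lengths of the circle rows. Taking them out of the column
  counts leaves the counts of the remaining parts, which are sorted and positive and therefore
  determined.\<close>

lemma superpartition_eqI:
  assumes sp: "is_superpartition L" "is_superpartition M"
    and eq: "shape L = shape M" "circle_rows L = circle_rows M"
  shows "L = M"
proof -
  have col: "column L = column M"
  proof
    fix c
    have "t < column L c \<longleftrightarrow> t < column M c" for t
      using eq(1) by (simp flip: less_shape_iff)
    then show "column L c = column M c" by (metis linorder_neqE_nat less_irrefl)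
  qed
  have "set (fst L) = shape L ` circle_rows L" for L
    by (simp add: circle_rows_def image_image shape_column)
  then have "set (rev (fst L)) = set (rev (fst M))" using eq by simp
  then have "rev (fst L) = rev (fst M)"
    using sp by (intro sorted_distinct_set_unique)
      (auto simp: is_superpartition_iff sorted_wrt_rev distinct_fst elim: sorted_wrt_mono_rel[rotated])
  then have fst: "fst L = fst M" by simp
  have "length (filter (\<lambda>x. c < x) (snd L)) = length (filter (\<lambda>x. c < x) (snd M))" for c
    using fun_cong[OF col, of c] fst by (simp add: column_def)
  then have *: "t < length (snd L) \<and> c < snd L ! t \<longleftrightarrow> t < length (snd M) \<and> c < snd M ! t" for t c
    using sp length_filter_sorted by (metis is_superpartition_iff)
  have pos: "0 < snd K ! t" if "is_superpartition K" "t < length (snd K)" for K t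
    using that by (simp add: is_superpartition_iff Suc_le_eq)
  have len: "t < length (snd L) \<longleftrightarrow> t < length (snd M)" for t
    using *[of t 0] pos sp by blast
  have "snd L = snd M"
  proof (rule nth_equalityI)
    show "length (snd L) = length (snd M)" using len by (metis linorder_neqE_nat less_irrefl)
    fix t assume "t < length (snd L)"
    then have "c < snd L ! t \<longleftrightarrow> c < snd M ! t" for c using *[of t c] len[of t] by simp
    then show "snd L ! t = snd M ! t" by (metis linorder_neqE_nat less_irrefl)
  qed
  then show ?thesis using fst by (simp add: prod_eq_iff)
qed

text \<open>A row of \<open>S\<close> is strictly shorter than its predecessor. Hence the lengths of
  these rows are distinct, as fermionic parts must be, and each such row is the topmost one of its
  length, as \<open>circle_rows\<close> demands. A row of \<open>S\<close> of length 0 yields the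
  fermionic part 0.\<close>

lemma superpartition_of_shape:
  assumes l: "\<And>t. l (Suc t) \<le> l t" "\<And>t. N \<le> t \<Longrightarrow> l t = 0"
    and S: "finite S" "\<And>s. s \<in> S \<Longrightarrow> addable l s"
  obtains L where "is_superpartition L" "shape L = l" "circle_rows L = S"
proof -
  have anti: "l t \<le> l s" if "s \<le> t" for s t
    using that lift_Suc_antimono_le[of l] l(1) by blast
  have strict: "l t < l s" if st: "s < t" "t \<in> S" for s t
  proof -
    obtain r where "t = Suc r" using st(1) by (cases t) auto
    then show ?thesis using S(2)[OF st(2)] anti[of s r] st(1) by (simp add: addable_def)
  qed
  define L where "L = (map l (sorted_list_of_set S), map l (filter (\<lambda>t. t \<notin> S \<and> 0 < l t) [0..<N]))"
  have 1: "is_superpartition L"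
    unfolding is_superpartition_iff L_def fst_conv snd_conv
  proof (intro conjI)
    show "sorted_wrt (>) (map l (sorted_list_of_set S))"
      unfolding sorted_wrt_map
      by (rule sorted_wrt_mono_rel[OF _ sorted_list_of_set.strict_sorted_key_list_of_set]) (use S(1) strict in auto)
    have "sorted_wrt (<) (filter (\<lambda>t. t \<notin> S \<and> 0 < l t) [0..<N])"
      by (intro sorted_wrt_filter sorted_wrt_upt)
    then show "sorted_wrt (\<ge>) (map l (filter (\<lambda>t. t \<notin> S \<and> 0 < l t) [0..<N]))"
      unfolding sorted_wrt_map by (rule sorted_wrt_mono_rel[rotated]) (auto intro: anti)
  qed auto
  have bound: "{t. c < l t} \<subseteq> {..<N}" for c
  proof
    fix t assume "t \<in> {t. c < l t}"
    then show "t \<in> {..<N}" using l(2)[of t] by (cases "N \<le> t") auto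
  qed
  then have fin: "finite {t. c < l t}" for c
    using finite_subset by blast
  have col: "column L c = card {t. c < l t}" for c
  proof -
    have "length (filter (\<lambda>x. c < x) (map l (sorted_list_of_set S))) =
        card (set (filter (\<lambda>t. c < l t) (sorted_list_of_set S)))"
      by (subst distinct_card) (auto simp: filter_map comp_def)
    also have "set (filter (\<lambda>t. c < l t) (sorted_list_of_set S)) = {t. c < l t} \<inter> S"
      using S(1) by auto
    finally have 1: "length (filter (\<lambda>x. c < x) (map l (sorted_list_of_set S))) = card ({t. c < l t} \<inter> S)" .
    have "length (filter (\<lambda>x. c < x) (map l (filter (\<lambda>t. t \<notin> S \<and> 0 < l t) [0..<N]))) =
        card (set (filter (\<lambda>t. c < l t) (filter (\<lambda>t. t \<notin> S \<and> 0 < l t) [0..<N])))"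
      by (subst distinct_card) (auto simp: filter_map comp_def simp del: filter_filter)
    also have "set (filter (\<lambda>t. c < l t) (filter (\<lambda>t. t \<notin> S \<and> 0 < l t) [0..<N])) = {t. c < l t} - S"
      using bound[of c] by auto
    finally have 2: "length (filter (\<lambda>x. c < x) (map l (filter (\<lambda>t. t \<notin> S \<and> 0 < l t) [0..<N]))) =
        card ({t. c < l t} - S)" .
    have "card {t. c < l t} = card ({t. c < l t} \<inter> S) + card ({t. c < l t} - S)"
      by (subst card_Un_disjoint[symmetric]) (use fin in \<open>auto intro!: arg_cong[of _ _ card]\<close>)
    then show ?thesis using 1 2 by (simp add: column_def L_def)
  qed
  have cell: "t < card {t. c < l t} \<longleftrightarrow> c < l t" for t c
  proof
    assume "c < l t"
    then have "{..t} \<subseteq> {t. c < l t}" using anti by (auto intro: less_le_trans)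
    then have "card {..t} \<le> card {t. c < l t}" by (intro card_mono fin)
    then show "t < card {t. c < l t}" by simp
  next
    assume *: "t < card {t. c < l t}"
    show "c < l t"
    proof (rule ccontr)
      assume "\<not> c < l t"
      have "{t. c < l t} \<subseteq> {..<t}"
      proof
        fix s assume "s \<in> {t. c < l t}"
        then show "s \<in> {..<t}"
          using anti[of t s] \<open>\<not> c < l t\<close> by (cases "t \<le> s") auto
      qed
      then have "card {t. c < l t} \<le> card {..<t}" by (intro card_mono) auto
      then show False using * by simp
    qed
  qed
  have 2: "shape L = l"
  proof
    fix t
    have "c < shape L t \<longleftrightarrow> c < l t" for c by (simp add: less_shape_iff col cell)
    then show "shape L t = l t" by (metis linorder_neqE_nat less_irrefl)
  qed
  have "card {t. l s < l t} = s" if "s \<in> S" for s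
  proof -
    have "{t. l s < l t} = {..<s}"
      using strict[OF _ that] anti by (auto simp: not_less[symmetric])
    then show ?thesis by simp
  qed
  moreover have "set (fst L) = l ` S" using S(1) by (simp add: L_def)
  ultimately have 3: "circle_rows L = S"
    by (simp add: circle_rows_def col image_image)
  show ?thesis using that[OF 1 2 3] .
qed

section \<open>Tableau steps\<close>

lemma new_boxes_eq: "new_boxes L M = {(Suc t, Suc c) | t c. shape L t \<le> c \<and> c < shape M t}"
  by (auto simp: new_boxes_def set_boxes)

lemma boxes_subset_iff: "set (boxes L) \<subseteq> set (boxes M) \<longleftrightarrow> (\<forall>t. shape L t \<le> shape M t)"
proof
  assume sub: "set (boxes L) \<subseteq> set (boxes M)"
  show "\<forall>t. shape L t \<le> shape M t"
  proof (rule allI, rule ccontr)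
    fix t assume "\<not> shape L t \<le> shape M t"
    then have "(Suc t, Suc (shape M t)) \<in> set (boxes L)" by (simp add: set_boxes)
    then show False using sub by (auto simp: set_boxes)
  qed
qed (auto simp: set_boxes intro: less_le_trans)

lemma card_new_boxes:
  assumes "\<And>t. shape L t \<le> shape M t"
  shows "card (new_boxes L M) + spsize L = spsize M"
proof -
  let ?N = "max (rows L) (rows M)"
  have "new_boxes L M = (\<lambda>(t, c). (Suc t, Suc c)) ` (SIGMA t:{..<?N}. {shape L t..<shape M t})"
  proof (intro equalityI subsetI)
    fix z assume "z \<in> new_boxes L M"
    then obtain t c where z: "z = (Suc t, Suc c)" "shape L t \<le> c" "c < shape M t"
      by (auto simp: new_boxes_eq)
    then have "t < ?N" using shape_eq_0[of M t] by (cases "rows M \<le> t") auto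
    then show "z \<in> (\<lambda>(t, c). (Suc t, Suc c)) ` (SIGMA t:{..<?N}. {shape L t..<shape M t})"
      using z by force
  qed (auto simp: new_boxes_eq)
  then have "card (new_boxes L M) = card (SIGMA t:{..<?N}. {shape L t..<shape M t})"
    by (simp add: card_image inj_on_def)
  also have "\<dots> = (\<Sum>t<?N. shape M t - shape L t)"
    by simp
  finally have "card (new_boxes L M) + (\<Sum>t<?N. shape L t) = (\<Sum>t<?N. shape M t)"
    using assms by (simp flip: sum.distrib)
  moreover have "(\<Sum>t<?N. shape L t) = spsize L" "(\<Sum>t<?N. shape M t) = spsize M"
    by (intro sum_shape shape_eq_0; simp)+
  ultimately show ?thesis by simp
qed

lemma horizontal_strip_iff:
  "horizontal_strip r L M \<longleftrightarrow> strip (shape L) (shape M) \<and> spsize M = spsize L + r"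
proof (cases "\<forall>t. shape L t \<le> shape M t")
  case True
  have "inj_on snd (new_boxes L M) \<longleftrightarrow> (\<forall>t. shape M (Suc t) \<le> shape L t)"
  proof
    assume inj: "inj_on snd (new_boxes L M)"
    show "\<forall>t. shape M (Suc t) \<le> shape L t"
    proof (rule allI, rule ccontr)
      fix t assume *: "\<not> shape M (Suc t) \<le> shape L t"
      \<comment> \<open>Both boxes lie in the first column beyond the old end of row
        \<open>t\<close>.\<close>
      have "(Suc t, Suc (shape L t)) \<in> new_boxes L M" "(Suc (Suc t), Suc (shape L t)) \<in> new_boxes L M"
        using * shape_antimono[of L t] shape_antimono[of M t] by (auto simp: new_boxes_eq)
      then show False
        using inj_onD[OF inj, of "(Suc t, Suc (shape L t))" "(Suc (Suc t), Suc (shape L t))"] by simp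
    qed
  next
    assume strip: "\<forall>t. shape M (Suc t) \<le> shape L t"
    have "\<not> t < s" if "shape L t \<le> c" "c < shape M s" for s t c
    proof
      assume "t < s"
      then have "shape M s \<le> shape M (Suc t)" by (intro shape_antimono') simp
      then show False using that strip[rule_format, of t] by linarith
    qed
    then show "inj_on snd (new_boxes L M)"
      unfolding inj_on_def new_boxes_eq by clarsimp (metis linorder_neqE_nat)
  qed
  moreover have "card (new_boxes L M) = r \<longleftrightarrow> spsize M = spsize L + r"
    using card_new_boxes[of L M] True by auto
  ultimately show ?thesis
    using True by (auto simp: horizontal_strip_def boxes_subset_iff strip_def)
qed (auto simp: horizontal_strip_def boxes_subset_iff strip_def)

lemma circles_follow_iff:
  assumes "is_superpartition L"
  shows "circles_follow (new_boxes L M) (circles L) cs \<longleftrightarrow>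
    map fst cs = map (\<lambda>s. Suc (moved (shape L) (shape M) s)) (row_list L)"
proof -
  have row: "(\<exists>z \<in> new_boxes L M. fst z = Suc t) \<longleftrightarrow> shape L t < shape M t" for t
  proof
    assume "shape L t < shape M t"
    then have "(Suc t, Suc (shape L t)) \<in> new_boxes L M" by (simp add: new_boxes_eq)
    then show "\<exists>z \<in> new_boxes L M. fst z = Suc t" by force
  qed (auto simp: new_boxes_eq)
  show ?thesis
    unfolding circles_follow_def circles_eq[OF assms] list_eq_iff_nth_eq[of "map fst cs"]
    by (auto simp: Let_def row moved_def)
qed

text \<open>From the entry row on, each new row has the old length of the row above it, so the new
  boxes of these rows lie side by side and fill all columns up to the new length of the entry row.
  The rows above it reached beyond that length already before the step, so the next column stays
  free.\<close>

lemma first_free_column: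
  assumes strip: "strip (shape L) (shape M)"
  shows "(\<forall>y \<in> new_boxes L M. snd y \<noteq> Suc c) \<and>
      (\<forall>d. 1 \<le> d \<and> d < Suc c \<longrightarrow> (\<exists>y \<in> new_boxes L M. snd y = d)) \<longleftrightarrow>
    c = shape M (entry (shape L) (shape M))"
proof -
  let ?r = "entry (shape L) (shape M)"
  have zero: "shape L t = 0" if "rows L \<le> t" for t using that by (rule shape_eq_0)
  note r = entry_props[of "rows L" "shape L" "shape M", OF zero, simplified]
  have eq: "shape M (Suc t) = shape L t" if "?r \<le> t" for t
    using r(2)[OF that] strip by (auto simp: strip_def intro: antisym)
  define full where "full c \<longleftrightarrow> (\<exists>y \<in> new_boxes L M. snd y = Suc c)" for c
  have full: "full c \<longleftrightarrow> (\<exists>t. shape L t \<le> c \<and> c < shape M t)" for c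
    by (force simp: full_def new_boxes_eq)
  have below: "full c" if "c < shape M ?r" for c
  proof -
    have "\<exists>t. ?r \<le> t \<and> c < shape M t \<and> \<not> c < shape M (Suc t)"
    proof (rule ccontr)
      assume *: "\<not> (\<exists>t. ?r \<le> t \<and> c < shape M t \<and> \<not> c < shape M (Suc t))"
      have "c < shape M (?r + k)" for k
        by (induction k) (use that * in auto)
      from this[of "rows M"] show False using shape_eq_0[of M "?r + rows M"] by simp
    qed
    then obtain t where "?r \<le> t" "c < shape M t" "\<not> c < shape M (Suc t)" by blast
    then show ?thesis unfolding full using eq[of t] by (intro exI[of _ t]) simp
  qed
  have at: "\<not> full (shape M ?r)"
  proof
    assume "full (shape M ?r)"
    then obtain t where t: "shape L t \<le> shape M ?r" "shape M ?r < shape M t" unfolding full by blast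
    have "t < ?r" using t(2) shape_antimono'[of ?r t M] by (meson not_le)
    then obtain s where s: "?r = Suc s" "t \<le> s" by (cases ?r) auto
    then have "shape M ?r < shape L s" using r(3) by simp
    also have "\<dots> \<le> shape L t" using s(2) by (rule shape_antimono')
    finally show False using t(1) by simp
  qed
  have "\<not> full c \<and> (\<forall>d < c. full d) \<longleftrightarrow> c = shape M ?r"
    using below at by (metis linorder_neqE_nat)
  moreover have "(\<forall>d. 1 \<le> d \<and> d < Suc c \<longrightarrow> (\<exists>y \<in> new_boxes L M. snd y = d)) \<longleftrightarrow> (\<forall>d < c. full d)"
  proof
    assume *: "\<forall>d < c. full d"
    show "\<forall>d. 1 \<le> d \<and> d < Suc c \<longrightarrow> (\<exists>y \<in> new_boxes L M. snd y = d)"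
    proof (intro allI impI)
      fix d assume "1 \<le> d \<and> d < Suc c"
      then have "d = Suc (d - 1)" "d - 1 < c" by auto
      then show "\<exists>y \<in> new_boxes L M. snd y = d" using * unfolding full_def by metis
    qed
  qed (simp add: full_def)
  ultimately show ?thesis by (auto simp: full_def)
qed

lemma addable_entry:
  assumes "strip l m" "\<And>t. N \<le> t \<Longrightarrow> l t = 0"
  shows "addable m (entry l m)"
  unfolding addable_def
proof (intro allI impI)
  fix r assume r: "entry l m = Suc r"
  have "m (Suc r) < l r" using entry_props(3)[of N l] assms(2) r by blast
  also have "\<dots> \<le> m r" using assms(1) by (simp add: strip_def)
  finally show "m (entry l m) < m r" using r by simp
qed

lemma addable_shape_inj:
  assumes "addable (shape M) s" "addable (shape M) t" "shape M s = shape M t"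
  shows "s = t"
proof (rule ccontr)
  have *: False if "addable (shape M) t" "s < t" "shape M s = shape M t" for s t
  proof -
    obtain r where "t = Suc r" using \<open>s < t\<close> by (cases t) auto
    then show False
      using that shape_antimono'[of s r M] by (simp add: addable_def)
  qed
  assume "s \<noteq> t"
  then show False using * assms by (metis linorder_neqE_nat)
qed

text \<open>The definition fixes only the column of the new circle. Circle rows and the entry row
  are addable, and addable rows have different lengths, so the column determines the row.\<close>

lemma is_new_circle_iff:
  assumes "is_superpartition M" "strip (shape L) (shape M)"
  shows "is_new_circle L M z \<longleftrightarrow> z \<in> set (circles M) \<and> fst z = Suc (entry (shape L) (shape M))"
proof -
  have "is_new_circle L M z \<longleftrightarrow> fst z = Suc (entry (shape L) (shape M))" if z: "z \<in> set (circles M)"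
  proof -
    obtain t where t: "t \<in> circle_rows M" "z = (Suc t, Suc (shape M t))"
      using z set_circles[OF assms(1)] by auto
    have "is_new_circle L M z \<longleftrightarrow> shape M t = shape M (entry (shape L) (shape M))"
      using z first_free_column[OF assms(2), of "shape M t"] t by (simp add: is_new_circle_def)
    also have "\<dots> \<longleftrightarrow> t = entry (shape L) (shape M)"
      using addable_shape_inj circle_rows_props(1)[OF t(1)] addable_entry[OF assms(2) shape_eq_0] by metis
    finally show ?thesis using t by simp
  qed
  then show ?thesis by (auto simp: is_new_circle_def)
qed

lemma sorted_map_moved: "sorted xs \<Longrightarrow> sorted (map (moved l m) xs)"
  by (induction xs) (auto simp: moved_def le_Suc_eq Suc_le_eq le_less)

lemma row_list_eq_iff: "sorted xs \<Longrightarrow> row_list M = xs \<longleftrightarrow> distinct xs \<and> set xs = circle_rows M"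
  by (metis row_list_props sorted_distinct_set_unique)

lemma map_fst_circles: "is_superpartition M \<Longrightarrow> map fst (circles M) = map Suc (row_list M)"
  by (simp add: circles_eq comp_def)

lemma map_Suc_eq_iff: "map Suc xs = map (\<lambda>s. Suc (f s)) ys \<longleftrightarrow> xs = map f ys"
proof -
  have "map (\<lambda>s. Suc (f s)) ys = map Suc (map f ys)" by simp
  then show ?thesis by (metis inj_Suc inj_map_eq_map)
qed

lemma ex1_new_circle_iff:
  assumes "is_superpartition M" "strip (shape L) (shape M)"
  shows "(\<exists>!z. is_new_circle L M z) \<longleftrightarrow> entry (shape L) (shape M) \<in> circle_rows M"
proof -
  have "is_new_circle L M z \<longleftrightarrow> entry (shape L) (shape M) \<in> circle_rows M \<and>
      z = (Suc (entry (shape L) (shape M)), Suc (shape M (entry (shape L) (shape M))))" for z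
    unfolding is_new_circle_iff[OF assms] set_circles[OF assms(1)] by auto
  moreover have "(\<exists>!z. Q \<and> z = c) \<longleftrightarrow> Q" for Q and c :: "nat \<times> nat"
    by (cases Q) (simp_all add: Ex1_def)
  ultimately show ?thesis by (simp only:)
qed

text \<open>\<open>moved\<close> is weakly increasing and so preserves the order of the circles from
  top to bottom. Comparing circles one by one thus amounts to an equality of sets together with the
  absence of collisions.\<close>

lemma tableau_step_iff:
  assumes L: "is_superpartition L" and M: "is_superpartition M"
  shows "tableau_step a L M \<longleftrightarrow> strip (shape L) (shape M) \<and> spsize M = spsize L + wsize a \<and>
    distinct (next_rows a (shape L) (shape M) (row_list L)) \<and>
    set (next_rows a (shape L) (shape M) (row_list L)) = circle_rows M"
proof (cases "strip (shape L) (shape M)")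
  case strip: True
  let ?xs = "map (moved (shape L) (shape M)) (row_list L)"
  let ?r = "entry (shape L) (shape M)"
  have sorted: "sorted ?xs" by (simp add: sorted_map_moved)
  have df: "df M = card (circle_rows M)" "length ?xs = df L"
    using length_row_list[OF L] length_row_list[OF M] by (simp_all add: row_list_def)
  show ?thesis
  proof (cases a)
    case (Plain r)
    have "circles_follow (new_boxes L M) (circles L) (circles M) \<longleftrightarrow> row_list M = ?xs"
      by (simp add: circles_follow_iff[OF L] map_fst_circles[OF M] map_Suc_eq_iff)
    also have "\<dots> \<longleftrightarrow> distinct ?xs \<and> set ?xs = circle_rows M"
      by (rule row_list_eq_iff[OF sorted])
    finally show ?thesis
      using strip df distinct_card[of ?xs] Plain
      by (auto simp: horizontal_strip_iff next_rows_def simp del: length_map)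
  next
    case (Barred r)
    have "map fst (filter (\<lambda>z. \<not> is_new_circle L M z) (circles M)) = map Suc (filter (\<lambda>s. s \<noteq> ?r) (row_list M))"
      using set_circles[OF M]
      by (auto simp: is_new_circle_iff[OF M strip] circles_eq[OF M] filter_map comp_def intro!: filter_cong)
    then have "circles_follow (new_boxes L M) (circles L) (filter (\<lambda>z. \<not> is_new_circle L M z) (circles M)) \<longleftrightarrow>
        filter (\<lambda>s. s \<noteq> ?r) (row_list M) = ?xs"
      by (simp add: circles_follow_iff[OF L] map_Suc_eq_iff)
    also have "\<dots> \<longleftrightarrow> distinct ?xs \<and> set ?xs = circle_rows M - {?r}"
    proof -
      have "filter (\<lambda>s. s \<noteq> ?r) (row_list M) = sorted_list_of_set (circle_rows M - {?r})"
        by (rule sorted_distinct_set_unique) (auto simp: sorted_filter[of id, simplified])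
      then show ?thesis
        using sorted by (metis finite_Diff finite_circle_rows sorted_list_of_set.distinct_sorted_key_list_of_set
          sorted_list_of_set.set_sorted_key_list_of_set sorted_list_of_set.sorted_sorted_key_list_of_set
          sorted_distinct_set_unique)
    qed
    finally have *: "tableau_step a L M \<longleftrightarrow> spsize M = spsize L + r \<and> df M = df L + 1 \<and>
        ?r \<in> circle_rows M \<and> distinct ?xs \<and> set ?xs = circle_rows M - {?r}"
      using strip Barred by (auto simp: horizontal_strip_iff ex1_new_circle_iff[OF M strip])
    have "df M = df L + 1" if "distinct (?xs @ [?r])" "set (?xs @ [?r]) = circle_rows M"
      using distinct_card[OF that(1)] that(2) df by simp
    then show ?thesis
      using strip Barred unfolding * by (auto simp: next_rows_def) (metis imageI)
  qed
next
  case False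
  then show ?thesis by (cases a) (simp_all add: horizontal_strip_iff)
qed

section \<open>Signs of steps\<close>

definition step_sign :: "weight_entry \<Rightarrow> spart \<Rightarrow> spart \<Rightarrow> int" where
  "step_sign a L M =
     (if barred a then (-1) ^ card {s \<in> circle_rows M. entry (shape L) (shape M) < s} else 1)"

lemma theta_prod_next_rows:
  assumes "distinct (next_rows a (shape L) (shape M) (row_list L))"
    "set (next_rows a (shape L) (shape M) (row_list L)) = circle_rows M"
  shows "prod_list (map (\<lambda>x. theta (f x)) (next_rows a (shape L) (shape M) (row_list L))) =
    of_int (step_sign a L M) * prod_list (map (\<lambda>x. theta (f x)) (row_list M))"
proof (cases "barred a")
  case True
  let ?xs = "map (moved (shape L) (shape M)) (row_list L)"
  let ?r = "entry (shape L) (shape M)"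
  have eq: "next_rows a (shape L) (shape M) (row_list L) = ?xs @ [?r]"
    using True by (simp add: next_rows_def)
  have "{x \<in> set ?xs. ?r < x} = {s \<in> circle_rows M. ?r < s}"
    using assms(2)[unfolded eq, symmetric] by auto
  moreover have "sorted ?xs" by (simp add: sorted_map_moved)
  ultimately have "prod_list (map (\<lambda>x. theta (f x)) (?xs @ [?r])) =
      (-1) ^ card {s \<in> circle_rows M. ?r < s} * prod_list (map (\<lambda>x. theta (f x)) (row_list M))"
    using theta_prod_insert_sorted[of ?xs ?r f] assms[unfolded eq] by (simp only: row_list_def[of M])
  then show ?thesis unfolding eq step_sign_def using True by simp
next
  case False
  then have "next_rows a (shape L) (shape M) (row_list L) = row_list M"
    using assms row_list_eq_iff[of "map (moved (shape L) (shape M)) (row_list L)" M] sorted_map_moved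
    by (auto simp: next_rows_def)
  then show ?thesis using False by (simp add: step_sign_def)
qed

section \<open>Exchange of adjacent weights\<close>

definition paths :: "weight_entry \<Rightarrow> weight_entry \<Rightarrow> spart \<Rightarrow> spart \<Rightarrow> spart set" where
  "paths a b K L = {M. is_superpartition M \<and> tableau_step a K M \<and> tableau_step b M L}"

lemma inversions_sorted: "sorted xs \<Longrightarrow> inversions xs = 0"
proof -
  assume "sorted xs"
  then have "\<not> xs ! i > xs ! j" if "i < j" "j < length xs" for i j
    using sorted_nth_mono[of xs i j] that by simp
  then have "{(i, j). i < j \<and> j < length xs \<and> xs ! i > xs ! j} = {}"
    by auto
  then show ?thesis unfolding inversions_def by (metis card.empty)
qed

lemma scoeff_theta_prod:
  "scoeff (prod_list (map (\<lambda>t. theta (Suc t)) xs)) (Suc ` U) [] =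
    (if distinct xs \<and> set xs = U then (-1) ^ inversions (map Suc xs) else 0)"
proof -
  have "prod_list (map (\<lambda>t. theta (Suc t)) xs) = super_word (map Suc xs) []"
    by (simp add: super_word_Nil comp_def)
  then show ?thesis
    by (auto simp: scoeff_super_word distinct_map inj_image_eq_iff)
qed

text \<open>Words consisting of ones select the power of \<open>zvar\<close>, that is, the size of a
  step.\<close>

lemma scoeff_zvar_power:
  "scoeff (zvar ^ j * prod_list (map theta xs)) A (replicate k 1) =
    (if j = k then scoeff (prod_list (map theta xs)) A [] else 0)"
proof -
  have "zvar ^ j * prod_list (map theta xs) = prod_list (map theta xs) * zvar ^ j"
    by (induction xs) (simp_all, metis mult.assoc theta_zvar_power_commute)
  moreover have "prod_list (map xvar (replicate j 1)) = zvar ^ j"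
    by (induction j) (simp_all add: zvar_def)
  ultimately have "zvar ^ j * prod_list (map theta xs) = super_word xs (replicate j 1)"
    by (simp only: super_word_def)
  then show ?thesis
    unfolding super_word_Nil[symmetric] by (auto simp: scoeff_super_word dest: arg_cong[of _ _ length])
qed

section \<open>From shapes back to superpartitions with fixed first and last members\<close>

locale path_ends =
  fixes K L :: spart
  assumes K: "is_superpartition K" and L: "is_superpartition L"
begin

definition size_bound :: nat where
  "size_bound = max (rows K) (rows L)"

text \<open>The weights stay free because both of their orders refer to the same ends.\<close>

sublocale two_steps size_bound "shape K" "shape L" "circle_rows K" a b
  rewrites "two_steps.ss (circle_rows K) = row_list K"
  for a b
proof -
  show ts: "two_steps size_bound (shape K) (shape L) (circle_rows K)"
    using circle_rows_props[of _ K]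
    by unfold_locales (auto simp: size_bound_def shape_eq_0 less_max_iff_disj)
  show "two_steps.ss (circle_rows K) = row_list K"
    by (simp add: two_steps.ss_def[OF ts] row_list_def)
qed

text \<open>The circles of \<open>M\<close> are sorted while their thetas already carry the rows
  reached after the second step; then the result of the second step is sorted. Each sorting costs
  the sign of its own step.\<close>

lemma circle_word_path:
  assumes "M \<in> paths a b K L"
  shows "circle_word a b (shape M) = of_int (step_sign a K M * step_sign b M L) *
    prod_list (map (\<lambda>t. theta (Suc t)) (row_list L))"
proof -
  have M: "is_superpartition M" and steps: "tableau_step a K M" "tableau_step b M L"
    using assms by (auto simp: paths_def)
  let ?f = "\<lambda>t. theta (Suc t)" and ?g = "\<lambda>t. theta (Suc (moved (shape M) (shape L) t))"
  let ?ss = "next_rows a (shape K) (shape M) (row_list K)"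
  have 1: "distinct ?ss" "set ?ss = circle_rows M"
    using steps(1) by (simp_all add: tableau_step_iff[OF K M])
  have 2: "distinct (next_rows b (shape M) (shape L) (row_list M))"
    "set (next_rows b (shape M) (shape L) (row_list M)) = circle_rows L"
    using steps(2) by (simp_all add: tableau_step_iff[OF M L])
  have split: "prod_list (map ?f (next_rows b (shape M) (shape L) xs)) =
      prod_list (map ?g xs) * (if barred b then ?f (entry (shape M) (shape L)) else 1)" for xs
    by (simp add: next_rows_def comp_def)
  have "circle_word a b (shape M) =
      prod_list (map ?g ?ss) * (if barred b then ?f (entry (shape M) (shape L)) else 1)"
    by (simp only: circle_word_def split)
  also have "prod_list (map ?g ?ss) = of_int (step_sign a K M) * prod_list (map ?g (row_list M))"
    by (rule theta_prod_next_rows[OF 1])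
  finally have "circle_word a b (shape M) =
      of_int (step_sign a K M) * prod_list (map ?f (next_rows b (shape M) (shape L) (row_list M)))"
    by (simp only: split mult.assoc)
  then show ?thesis
    by (simp add: theta_prod_next_rows[OF 2] mult.assoc)
qed

lemma scoeff_circle_word_path:
  assumes "M \<in> paths a b K L"
  shows "scoeff (circle_word a b (shape M)) (Suc ` circle_rows L) [] =
    of_int (step_sign a K M * step_sign b M L)"
proof -
  have "inversions (map Suc (row_list L)) = 0"
    by (rule inversions_sorted) (simp add: sorted_map)
  then show ?thesis
    unfolding circle_word_path[OF assms] scoeff_of_int_mult scoeff_theta_prod by simp
qed

lemma sum_diff_mids:
  assumes "m \<in> mids"
  shows "(\<Sum>t<size_bound. m t - shape K t) + (\<Sum>t<size_bound. shape K t) = (\<Sum>t<size_bound. m t)"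
    "(\<Sum>t<size_bound. shape L t - m t) + (\<Sum>t<size_bound. m t) = (\<Sum>t<size_bound. shape L t)"
  using assms by (auto simp: mids_def strip_def simp flip: sum.distrib)

lemma sum_ends:
  "(\<Sum>t<size_bound. shape K t) = spsize K" "(\<Sum>t<size_bound. shape L t) = spsize L"
  by (intro sum_shape shape_eq_0; simp add: size_bound_def)+

text \<open>\<open>mids\<close> knows only row lengths. The nonzero coefficient supplies what is
  missing to make them a superpartition between two valid steps, namely circles that neither collide
  nor miss the rows of \<open>L\<close>.\<close>

lemma path_of_mid:
  assumes m: "m \<in> mids" "(\<Sum>t<size_bound. m t - shape K t) = wsize a"
    and size: "spsize L = spsize K + wsize a + wsize b"
    and nz: "scoeff (circle_word a b m) (Suc ` circle_rows L) [] \<noteq> 0"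
  shows "\<exists>M \<in> paths a b K L. shape M = m"
proof -
  let ?ss = "next_rows a (shape K) m (row_list K)"
  have strips: "strip (shape K) m" "strip m (shape L)" using m by (auto simp: mids_def)
  have rs: "distinct (next_rows b m (shape L) ?ss)" "set (next_rows b m (shape L) ?ss) = circle_rows L"
    using nz unfolding circle_word_def scoeff_theta_prod by (auto split: if_splits)
  have zero: "m t = 0" if "size_bound \<le> t" for t
    using strips(2) n_zero[OF that] by (simp add: strip_def) (metis le_zero_eq)
  \<comment> \<open>A circle moves only below a row that grew past its old length, which bounds the
    row it enters. A circle that stays keeps a row of unchanged length, and the row above it did not
    shrink.\<close>
  have "addable m s" if "s \<in> set ?ss" for s
  proof -
    have "addable m (moved (shape K) m r)" if r: "r \<in> circle_rows K" for r
    proof (cases "shape K r < m r")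
      case True
      then show ?thesis
        using strips(1) by (auto simp: moved_def addable_def strip_def intro: le_less_trans)
    next
      case False
      then have "m r = shape K r" using strips(1) by (simp add: strip_def le_antisym not_less)
      then show ?thesis
        using circle_rows_props(1)[OF r] strips(1)
        by (auto simp: moved_def addable_def strip_def intro: less_le_trans)
    qed
    moreover have "addable m (entry (shape K) m)"
      using addable_entry[OF strips(1)] l_zero by blast
    ultimately show ?thesis using that by (auto simp: next_rows_def split: if_splits)
  qed
  moreover have "m (Suc t) \<le> m t" for t
    using strips(1) by (auto simp: strip_def intro: le_trans)
  ultimately obtain M where M: "is_superpartition M" "shape M = m" "circle_rows M = set ?ss"
    using superpartition_of_shape[of m size_bound "set ?ss", OF _ zero finite_set] by blast
  have "spsize M = (\<Sum>t<size_bound. m t)"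
    using sum_shape[of size_bound M] zero M(2) by simp
  then have sizes: "spsize M = spsize K + wsize a" "spsize L = spsize M + wsize b"
    using sum_diff_mids[OF m(1)] sum_ends m(2) size by auto
  \<comment> \<open>Circles that coincide after the first step would stay together in the
    second.\<close>
  have "distinct ?ss"
    using rs(1) unfolding next_rows_def[of b] distinct_append distinct_map by blast
  then have 1: "tableau_step a K M"
    using M strips sizes by (simp add: tableau_step_iff[OF K M(1)])
  have "mset (row_list M) = mset ?ss"
    using \<open>distinct ?ss\<close> M(3) by (metis row_list_props(1,3) set_eq_iff_mset_eq_distinct)
  then have "mset (next_rows b m (shape L) (row_list M)) = mset (next_rows b m (shape L) ?ss)"
    by (simp add: next_rows_def[of b])
  then have "distinct (next_rows b m (shape L) (row_list M))"
    "set (next_rows b m (shape L) (row_list M)) = circle_rows L"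
    using rs mset_eq_imp_distinct_iff mset_eq_setD by blast+
  then have "tableau_step b M L"
    using M strips sizes by (simp add: tableau_step_iff[OF M(1) L])
  then have "M \<in> paths a b K L" using 1 M by (simp add: paths_def)
  then show ?thesis using M(2) by blast
qed

lemma shape_path:
  assumes "M \<in> paths a b K L"
  shows "shape M \<in> mids" "(\<Sum>t<size_bound. shape M t - shape K t) = wsize a"
    "spsize L = spsize K + wsize a + wsize b"
proof -
  have M: "is_superpartition M" and steps: "tableau_step a K M" "tableau_step b M L"
    using assms by (auto simp: paths_def)
  show mid: "shape M \<in> mids" and size: "spsize L = spsize K + wsize a + wsize b"
    using steps by (auto simp: mids_def tableau_step_iff[OF K M] tableau_step_iff[OF M L])
  have "shape M t = 0" if "size_bound \<le> t" for t
    using mid n_zero[OF that] by (simp add: mids_def strip_def) (metis le_zero_eq)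
  then have "(\<Sum>t<size_bound. shape M t) = spsize M" by (rule sum_shape)
  then show "(\<Sum>t<size_bound. shape M t - shape K t) = wsize a"
    using sum_diff_mids(1)[OF mid] sum_ends steps(1) by (simp add: tableau_step_iff[OF K M])
qed

lemma inj_on_shape_paths: "inj_on shape (paths a b K L)"
proof (rule inj_onI)
  fix M M' assume "M \<in> paths a b K L" "M' \<in> paths a b K L" "shape M = shape M'"
  then show "M = M'"
    by (intro superpartition_eqI) (auto simp: paths_def tableau_step_iff[OF K])
qed

lemma finite_mids: "finite mids"
proof (rule finite_subset)
  show "mids \<subseteq> (\<lambda>f t. if t < size_bound then f t else 0) ` PiE {..<size_bound} (\<lambda>t. {..shape L t})"
  proof
    fix m assume "m \<in> mids"
    then have m: "m t \<le> shape L t" for t by (auto simp: mids_def strip_def)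
    then have "m t = 0" if "size_bound \<le> t" for t using n_zero[OF that] by (metis le_zero_eq)
    then have "m = (\<lambda>t. if t < size_bound then restrict m {..<size_bound} t else 0)" by (auto simp: not_less)
    moreover have "restrict m {..<size_bound} \<in> PiE {..<size_bound} (\<lambda>t. {..shape L t})" using m by auto
    ultimately show "m \<in> (\<lambda>f t. if t < size_bound then f t else 0) `
        PiE {..<size_bound} (\<lambda>t. {..shape L t})"
      by blast
  qed
qed (intro finite_imageI finite_PiE; simp)

text \<open>Shapes of other sizes are excluded by the condition on the right, and shapes of the
  right size that are not on a path have coefficient zero.\<close>

lemma path_sum:
  assumes "spsize L = spsize K + wsize a + wsize b"
  shows "(\<Sum>M \<in> paths a b K L. of_int (step_sign a K M * step_sign b M L)) =
    (\<Sum>m \<in> mids. if (\<Sum>t<size_bound. m t - shape K t) = wsize a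
       then scoeff (circle_word a b m) (Suc ` circle_rows L) [] else 0)"
proof -
  let ?h = "\<lambda>m. scoeff (circle_word a b m) (Suc ` circle_rows L) []"
  have "(\<Sum>M \<in> paths a b K L. of_int (step_sign a K M * step_sign b M L)) = (\<Sum>m \<in> shape ` paths a b K L. ?h m)"
    by (simp add: sum.reindex inj_on_shape_paths scoeff_circle_word_path)
  also have "\<dots> = (\<Sum>m \<in> mids. if (\<Sum>t<size_bound. m t - shape K t) = wsize a then ?h m else 0)"
    by (rule sum.mono_neutral_cong_left)
      (use finite_mids shape_path path_of_mid[OF _ _ assms] in \<open>fastforce+\<close>)
  finally show ?thesis .
qed

text \<open>This is the coefficient of \<open>zvar ^ wsize a\<close> in
  \<open>two_step_exchange\<close>, where in either order the exponent is the size of the step with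
  weight \<open>a\<close>.\<close>

lemma paths_exchange:
  "(\<Sum>M \<in> paths a b K L. step_sign a K M * step_sign b M L) =
   (if barred a \<and> barred b then -1 else 1) *
     (\<Sum>M \<in> paths b a K L. step_sign b K M * step_sign a M L)"
proof (cases "spsize L = spsize K + wsize a + wsize b")
  case True
  let ?U = "Suc ` circle_rows L" and ?w = "replicate (wsize a) 1 :: nat list"
  let ?e = "if barred a \<and> barred b then -1 else 1 :: rat"
  have coeff: "scoeff (zvar ^ j * circle_word x y m) ?U ?w =
      (if j = wsize a then scoeff (circle_word x y m) ?U [] else 0)" for j x y m
    using scoeff_zvar_power[of j "map Suc (next_rows y m (shape L) (next_rows x (shape K) m (row_list K)))"]
    by (simp add: circle_word_def comp_def)
  \<comment> \<open>In the exchanged order the exponent counts the boxes of the second step, so the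
    first step takes the remaining \<open>wsize b\<close> boxes.\<close>
  have iff: "(\<Sum>t<size_bound. shape L t - m t) = wsize a \<longleftrightarrow> (\<Sum>t<size_bound. m t - shape K t) = wsize b"
    if "m \<in> mids" for m
    using sum_diff_mids[OF that] sum_ends True by auto
  have "rat_of_int (\<Sum>M \<in> paths a b K L. step_sign a K M * step_sign b M L) =
      (\<Sum>m \<in> mids. scoeff (zvar ^ (\<Sum>t<size_bound. m t - shape K t) * circle_word a b m) ?U ?w)"
    using path_sum[OF True] unfolding of_int_sum coeff .
  also have "\<dots> = scoeff (\<Sum>m \<in> mids. zvar ^ (\<Sum>t<size_bound. m t - shape K t) * circle_word a b m) ?U ?w"
    by (simp only: scoeff_sum)
  also have "\<dots> = ?e * (\<Sum>m \<in> mids. scoeff (zvar ^ (\<Sum>t<size_bound. shape L t - m t) * circle_word b a m) ?U ?w)"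
    by (simp add: two_step_exchange[of a b] scoeff_sum)
  also have "(\<Sum>m \<in> mids. scoeff (zvar ^ (\<Sum>t<size_bound. shape L t - m t) * circle_word b a m) ?U ?w) =
      (\<Sum>m \<in> mids. if (\<Sum>t<size_bound. m t - shape K t) = wsize b then scoeff (circle_word b a m) ?U [] else 0)"
    by (intro sum.cong refl) (simp only: coeff iff)
  also have "\<dots> = rat_of_int (\<Sum>M \<in> paths b a K L. step_sign b K M * step_sign a M L)"
    using path_sum[of b a] True by simp
  finally have "rat_of_int (\<Sum>M \<in> paths a b K L. step_sign a K M * step_sign b M L) =
      rat_of_int ((if barred a \<and> barred b then -1 else 1) *
        (\<Sum>M \<in> paths b a K L. step_sign b K M * step_sign a M L))"
    by (simp split del: if_split) (simp split: if_split)
  then show ?thesis by (simp only: of_int_eq_iff)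
next
  case False
  then have "paths a b K L = {}" "paths b a K L = {}"
    using shape_path(3)[of _ a b] shape_path(3)[of _ b a] by (force simp: algebra_simps)+
  then show ?thesis by simp
qed

end

section \<open>Symmetry of the signed number of tableaux\<close>

definition before :: "weight_entry \<Rightarrow> spart \<Rightarrow> spart set" where
  "before a L = {M. is_superpartition M \<and> tableau_step a M L}"

text \<open>The list of weights is reversed: its head belongs to the last step.\<close>

fun signed_count :: "weight_entry list \<Rightarrow> spart \<Rightarrow> int" where
  "signed_count [] L = of_bool (L = ([], []))"
| "signed_count (a # as) L = (\<Sum>M \<in> before a L. step_sign a M L * signed_count as M)"

lemma finite_superpartitions: "finite {L. superpartition n m L}"
proof (rule finite_subset)
  show "{L. superpartition n m L} \<subseteq>
      {xs. set xs \<subseteq> {..n} \<and> length xs = m} \<times> {xs. set xs \<subseteq> {..n} \<and> length xs \<le> n}"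
  proof
    fix L assume "L \<in> {L. superpartition n m L}"
    then obtain fs bs where L: "L = (fs, bs)" "length fs = m" "\<forall>b \<in> set bs. 1 \<le> b"
      "sum_list fs + sum_list bs = n"
      by (cases L) (auto simp: superpartition_def)
    have "length bs \<le> sum_list bs" using L(3) by (induction bs) auto
    moreover have "x \<le> n" if "x \<in> set fs \<or> x \<in> set bs" for x
      using that L(4) member_le_sum_list[of x fs] member_le_sum_list[of x bs] by auto
    ultimately show "L \<in> {xs. set xs \<subseteq> {..n} \<and> length xs = m} \<times> {xs. set xs \<subseteq> {..n} \<and> length xs \<le> n}"
      using L by auto
  qed
qed (intro finite_cartesian_product finite_lists_length_eq finite_lists_length_le; simp)

lemma finite_before:
  assumes "is_superpartition L"
  shows "finite (before a L)"
proof (rule finite_subset)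
  show "before a L \<subseteq> (\<Union>n \<in> {..spsize L}. \<Union>m \<in> {..df L}. {M. superpartition n m M})"
  proof
    fix M assume "M \<in> before a L"
    then have M: "is_superpartition M" and step: "tableau_step a M L" by (auto simp: before_def)
    have "spsize M \<le> spsize L" using step by (simp add: tableau_step_iff[OF M assms])
    moreover have "df M \<le> df L" using step by (cases a) auto
    ultimately show "M \<in> (\<Union>n \<in> {..spsize L}. \<Union>m \<in> {..df L}. {M. superpartition n m M})"
      using M superpartition_iff by auto
  qed
qed (simp add: finite_superpartitions)

text \<open>Induction removes the steps after the exchanged pair. The steps before it enter only
  through \<open>signed_count vs K\<close>, so the pairs can be grouped by their first
  superpartition \<open>K\<close> and exchanged for each \<open>K\<close> separately.\<close>

lemma signed_count_exchange:
  assumes L: "is_superpartition L"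
  shows "signed_count (us @ a # b # vs) L =
    (if barred a \<and> barred b then -1 else 1) * signed_count (us @ b # a # vs) L"
  using L
proof (induction us arbitrary: L)
  case Nil
  \<comment> \<open>All superpartitions two steps back in either order: a common finite index set
    for both sums.\<close>
  define X where "X = (\<Union>M \<in> before a L. before b M) \<union> (\<Union>M \<in> before b L. before a M)"
  have sp: "M \<in> before x L \<Longrightarrow> is_superpartition M" for x M L
    by (simp add: before_def)
  have X1: "finite X"
    unfolding X_def by (intro finite_UnI finite_UN_I finite_before Nil sp)
  have X2: "is_superpartition K" if "K \<in> X" for K
    using that by (auto simp: X_def before_def)
  have "signed_count (x # y # vs) L =
      (\<Sum>K \<in> X. signed_count vs K * (\<Sum>M \<in> paths y x K L. step_sign y K M * step_sign x M L))"
    if xy: "(x = a \<and> y = b) \<or> (x = b \<and> y = a)" for x y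
  proof -
    have "signed_count (x # y # vs) L =
        (\<Sum>M \<in> before x L. \<Sum>K | K \<in> X \<and> tableau_step y K M.
          step_sign x M L * (step_sign y K M * signed_count vs K))"
    proof -
      have "before y M = {K. K \<in> X \<and> tableau_step y K M}" if "M \<in> before x L" for M
      proof -
        have "before y M \<subseteq> X"
          using xy
        proof
          assume "x = a \<and> y = b"
          then show ?thesis using that unfolding X_def by blast
        next
          assume "x = b \<and> y = a"
          then show ?thesis using that unfolding X_def by blast
        qed
        then show ?thesis using X2 unfolding before_def by blast
      qed
      then show ?thesis by (simp add: sum_distrib_left)
    qed
    also have "\<dots> = (\<Sum>K \<in> X. \<Sum>M | M \<in> before x L \<and> tableau_step y K M.
          step_sign x M L * (step_sign y K M * signed_count vs K))"
      by (rule sum.swap_restrict) (use X1 finite_before Nil in auto)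
    also have "\<dots> = (\<Sum>K \<in> X. signed_count vs K * (\<Sum>M \<in> paths y x K L. step_sign y K M * step_sign x M L))"
      unfolding sum_distrib_left
      by (intro sum.cong refl) (auto simp: paths_def before_def)
    finally show ?thesis .
  qed
  from this[of a b] this[of b a] show ?case
    using path_ends.paths_exchange[OF path_ends.intro[OF X2 Nil], of _ b a]
    by (simp add: sum_distrib_left mult.left_commute conj_commute cong: sum.cong)
next
  case (Cons u us)
  have "signed_count (us @ a # b # vs) M =
      (if barred a \<and> barred b then -1 else 1) * signed_count (us @ b # a # vs) M"
    if "M \<in> before u L" for M
    using that Cons.IH by (simp add: before_def)
  then show ?case by (simp add: sum_distrib_left mult.left_commute cong: sum.cong)
qed

lemma tableau_step_Plain_0_iff:
  assumes L: "is_superpartition L" and M: "is_superpartition M"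
  shows "tableau_step (Plain 0) M L \<longleftrightarrow> M = L"
proof
  assume step: "tableau_step (Plain 0) M L"
  then have strip: "strip (shape M) (shape L)" and size: "spsize L = spsize M"
    by (simp_all add: tableau_step_iff[OF M L])
  have le: "shape M t \<le> shape L t" for t using strip by (simp add: strip_def)
  have "shape M = shape L"
  proof (rule ccontr)
    assume "shape M \<noteq> shape L"
    then obtain t where "shape M t < shape L t" using le by (metis ext le_neq_implies_less)
    then have "(Suc t, Suc (shape M t)) \<in> new_boxes M L" by (simp add: new_boxes_eq)
    moreover have "finite (new_boxes M L)" by (simp add: new_boxes_def)
    ultimately have "card (new_boxes M L) \<noteq> 0" by auto
    then show False using card_new_boxes[of M L] le size by simp
  qed
  moreover have "circle_rows M = circle_rows L"
    using step calculation by (auto simp: tableau_step_iff[OF M L] next_rows_def moved_def)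
  ultimately show "M = L" using superpartition_eqI L M by blast
next
  assume "M = L"
  then show "tableau_step (Plain 0) M L"
    using shape_antimono by (simp add: tableau_step_iff[OF L L] strip_def next_rows_def
        moved_def[abs_def] del: tableau_step.simps)
qed

lemma signed_count_Plain_0:
  assumes "is_superpartition L"
  shows "signed_count (us @ Plain 0 # vs) L = signed_count (us @ vs) L"
  using assms
proof (induction us arbitrary: L)
  case Nil
  then have "before (Plain 0) L = {L}"
    unfolding before_def using tableau_step_Plain_0_iff by blast
  then show ?case by (simp add: step_sign_def)
next
  case (Cons u us)
  then have "signed_count (us @ Plain 0 # vs) M = signed_count (us @ vs) M" if "M \<in> before u L" for M
    using that by (simp add: before_def)
  then show ?case by (simp cong: sum.cong)
qed

subsection \<open>Functions of lists that are (anti)symmetric under adjacent exchanges\<close>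

lemma move_entry:
  fixes g :: "'a list \<Rightarrow> int"
  assumes "\<And>us v ws. v \<in> set vs \<Longrightarrow> g (us @ x # v # ws) = s * g (us @ v # x # ws)"
  shows "g (us @ x # vs @ ws) = s ^ length vs * g (us @ vs @ x # ws)"
  using assms
proof (induction vs arbitrary: us)
  case (Cons v vs)
  have "g (us @ x # v # vs @ ws) = s * g ((us @ [v]) @ x # vs @ ws)"
    using Cons.prems[of v us "vs @ ws"] by simp
  also have "g ((us @ [v]) @ x # vs @ ws) = s ^ length vs * g ((us @ [v]) @ vs @ x # ws)"
    by (rule Cons.IH) (use Cons.prems in auto)
  finally show ?case by simp
qed simp

lemma symmetric_mset_cong:
  fixes g :: "'a list \<Rightarrow> int"
  assumes "\<And>us x y vs. g (us @ x # y # vs) = g (us @ y # x # vs)" "mset xs = mset ys"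
  shows "g xs = g ys"
  using assms
proof (induction xs arbitrary: ys g)
  case (Cons x xs)
  then have "x \<in> set ys" by (metis list.set_intros(1) mset_eq_setD)
  then obtain us vs where ys: "ys = us @ x # vs" by (meson split_list)
  have "g (x # xs) = g (x # us @ vs)"
  proof (rule Cons.IH[of "\<lambda>l. g (x # l)"])
    show "g (x # us' @ a # b # vs') = g (x # us' @ b # a # vs')" for us' a b vs'
      using Cons.prems(1)[of "x # us'" a b vs'] by simp
    show "mset xs = mset (us @ vs)" using Cons.prems(2) ys by simp
  qed
  also have "\<dots> = g (us @ x # vs)"
    using move_entry[of us g x 1 "[]" vs] Cons.prems(1) by simp
  finally show ?case using ys by simp
qed simp

text \<open>Every exchange moves an entry with \<open>P\<close> to the left past one without
  \<open>P\<close>; the order within either class is never touched.\<close>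

lemma stable_partition_cong:
  fixes g :: "'a list \<Rightarrow> int"
  assumes "\<And>us x y vs. \<not> P x \<Longrightarrow> P y \<Longrightarrow> g (us @ x # y # vs) = g (us @ y # x # vs)"
  shows "g (us @ xs) = g (us @ filter P xs @ filter (\<lambda>x. \<not> P x) xs)"
proof (induction xs arbitrary: us)
  case (Cons x xs)
  have IH: "g (us @ x # xs) = g (us @ x # filter P xs @ filter (\<lambda>x. \<not> P x) xs)"
    using Cons.IH[of "us @ [x]"] by simp
  show ?case
  proof (cases "P x")
    case False
    then show ?thesis
      using IH move_entry[of "filter P xs" g x 1 us] assms by simp
  qed (use IH in simp)
qed simp

context
  fixes h :: "'a list \<Rightarrow> int"
  assumes anti: "\<And>us x y vs. h (us @ x # y # vs) = - h (us @ y # x # vs)"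
begin

lemma antisymmetric_move: "h (us @ x # vs @ ws) = (-1) ^ length vs * h (us @ vs @ x # ws)"
  by (rule move_entry) (unfold mult_minus1, rule anti)

text \<open>Carrying \<open>x\<close> to the right over \<open>vs\<close> and \<open>y\<close> back
  to the left costs the same sign twice; what remains is the exchange of two neighbours.\<close>

lemma antisymmetric_swap: "h (us @ x # vs @ y # ws) = - h (us @ y # vs @ x # ws)"
proof -
  have "h (us @ x # vs @ y # ws) = (-1) ^ length vs * h ((us @ vs) @ x # y # ws)"
    using antisymmetric_move[of us x vs "y # ws"] by simp
  also have "h ((us @ vs) @ x # y # ws) = - h ((us @ vs) @ y # x # ws)"
    by (rule anti)
  also have "h ((us @ vs) @ y # x # ws) = (-1) ^ length vs * h (us @ y # vs @ x # ws)"
    using antisymmetric_move[of us y vs "x # ws"] by (simp flip: power_mult_distrib)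
  finally show ?thesis by (simp flip: power_mult_distrib)
qed

lemma antisymmetric_eq_0:
  assumes "\<not> distinct xs"
  shows "h xs = 0"
proof -
  obtain us vs ws x where xs: "xs = us @ [x] @ vs @ [x] @ ws"
    using not_distinct_decomp[OF assms] by blast
  then show ?thesis using antisymmetric_swap[of us x vs x ws] by simp
qed

lemma antisymmetric_permute:
  assumes "p permutes {..<length xs}"
  shows "h (permute_list p xs) = sign p * h xs"
proof -
  have less: "h (permute_list (transpose i j) xs) = - h xs" if "i < j" "j < length xs" for i j and xs :: "'a list"
  proof -
    let ?us = "take i xs" and ?vs = "take (j - Suc i) (drop (Suc i) xs)" and ?ws = "drop (Suc j) xs"
    have xs: "xs = ?us @ xs ! i # ?vs @ xs ! j # ?ws"
    proof -
      have "xs = ?us @ xs ! i # drop (Suc i) xs" using that by (simp add: id_take_nth_drop)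
      also have "drop (Suc i) xs = ?vs @ drop (j - Suc i) (drop (Suc i) xs)"
        by (rule append_take_drop_id[symmetric])
      also have "drop (j - Suc i) (drop (Suc i) xs) = xs ! j # ?ws"
        using that by (simp add: Cons_nth_drop_Suc)
      finally show ?thesis .
    qed
    have "permute_list (transpose i j) xs = ?us @ xs ! j # ?vs @ xs ! i # ?ws"
      by (rule nth_equalityI)
        (use that in \<open>auto simp: permute_list_def nth_append nth_Cons' transpose_def min_def\<close>)
    then show ?thesis using antisymmetric_swap xs by metis
  qed
  have tr: "h (permute_list (transpose i j) xs) = - h xs"
    if "i \<noteq> j" "i < length xs" "j < length xs" for i j and xs :: "'a list"
    using that less[of i j xs] less[of j i xs] by (metis linorder_neqE_nat transpose_commute)
  have "\<forall>xs. length xs = n \<longrightarrow> h (permute_list p xs) = sign p * h xs" if "p permutes {..<n}" for n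
    using that finite_lessThan
  proof (induction rule: permutes_induct)
    case (swap a b p)
    show ?case
    proof (intro allI impI)
      fix xs :: "'a list" assume n: "length xs = n"
      have "transpose a b permutes {..<length xs}"
        using swap.hyps n by (intro permutes_swap_id) auto
      then have "permute_list (transpose a b \<circ> p) xs = permute_list p (permute_list (transpose a b) xs)"
        using swap.hyps n by (intro permute_list_compose) auto
      moreover have "sign (transpose a b \<circ> p) = - sign p"
        using swap.hyps by (subst sign_compose) (auto simp: sign_swap_id permutation_swap_id
            intro: permutes_imp_permutation[OF finite_lessThan])
      ultimately show "h (permute_list (transpose a b \<circ> p) xs) = sign (transpose a b \<circ> p) * h xs"
        using swap n tr[of a b xs] by simp
    qed
  qed simp_all
  then show ?thesis using assms by blast
qed

end

text \<open>Once the tail is sorted, the head passes exactly the smaller entries, which are its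
  inversions.\<close>

lemma antisymmetric_sort:
  fixes h :: "nat list \<Rightarrow> int"
  assumes "\<And>us x y vs. h (us @ x # y # vs) = - h (us @ y # x # vs)" "distinct xs"
  shows "h xs = (-1) ^ inversions xs * h (sorted_list_of_set (set xs))"
  using assms
proof (induction xs arbitrary: h)
  case (Cons x xs)
  let ?ys = "sorted_list_of_set (set xs)"
  let ?us = "sorted_list_of_set {c \<in> set xs. c < x}" and ?vs = "sorted_list_of_set {c \<in> set xs. x < c}"
  have ys: "?us @ ?vs = ?ys"
    using sorted_list_of_set_split[of "set xs" x] Cons.prems(2) by simp
  have "{c \<in> set (x # xs). c < x} = {c \<in> set xs. c < x}" "{c \<in> set (x # xs). x < c} = {c \<in> set xs. x < c}"
    by auto
  then have sorted: "?us @ x # ?vs = sorted_list_of_set (set (x # xs))"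
    using sorted_list_of_set_split[of "set (x # xs)" x] by simp
  have len: "length ?us = card {c \<in> set xs. c < x}" by simp
  have "h (x # xs) = (-1) ^ inversions xs * h (x # ?ys)"
  proof (rule Cons.IH[of "\<lambda>l. h (x # l)"])
    show "h (x # us @ a # b # vs) = - h (x # us @ b # a # vs)" for us a b vs
      using Cons.prems(1)[of "x # us" a b vs] by simp
  qed (use Cons.prems in simp)
  also have "h (x # ?ys) = h ([] @ x # ?us @ ?vs)" by (simp only: ys append_Nil)
  also have "\<dots> = (-1) ^ length ?us * h ([] @ ?us @ x # ?vs)"
    by (rule antisymmetric_move[where h = h, OF Cons.prems(1)])
  finally show ?case
    using sorted len inversions_Cons[OF Cons.prems(2)] by (simp add: power_add)
qed simp

text \<open>A permutation attaining the minimum in \<open>sort_length\<close> sorts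
  \<open>xs\<close>, and the parity of any of its factorizations into transpositions gives its
  sign.\<close>

lemma antisymmetric_decreasing:
  fixes h :: "nat list \<Rightarrow> int"
  assumes "\<And>us x y vs. h (us @ x # y # vs) = - h (us @ y # x # vs)"
  shows "h (decreasing xs) = (-1) ^ sort_length xs * h xs"
proof -
  let ?Q = "\<lambda>r. \<exists>p. p permutes {..<length xs} \<and> swapidseq r p \<and> sorted_wrt (\<ge>) (permute_list p xs)"
  obtain p where p: "p permutes {..<length xs}" "permute_list p xs = decreasing xs"
    using mset_eq_permutation[of "decreasing xs" xs] by auto
  have "permutation p" using p(1) permutation_permutes by blast
  then obtain r where "swapidseq r p" by (auto simp: permutation_def)
  then have "?Q r" using p by auto
  then have "\<exists>r. ?Q r" by (rule exI)
  then have "?Q (sort_length xs)" unfolding sort_length_def by (rule LeastI_ex)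
  then obtain q where q: "q permutes {..<length xs}" "swapidseq (sort_length xs) q"
    "sorted_wrt (\<ge>) (permute_list q xs)" by blast
  have "permute_list q xs = decreasing xs"
  proof -
    have "sorted (rev (permute_list q xs))" "sorted (rev (decreasing xs))"
      using q(3) by (simp_all add: sorted_wrt_rev)
    moreover have "mset (rev (permute_list q xs)) = mset (rev (decreasing xs))"
      using q(1) by (simp add: mset_permute_list)
    ultimately have "rev (permute_list q xs) = rev (decreasing xs)"
      by (metis properties_for_sort)
    then show ?thesis by simp
  qed
  moreover have "sign q = (-1) ^ sort_length xs"
    using evenperm_unique[OF q(2) refl] by (simp add: sign_def)
  ultimately show ?thesis using antisymmetric_permute[where h = h, OF assms q(1)] by simp
qed

subsection \<open>Tableaux and their labels\<close>

lemma tableau_Nil: "tableau L [] T \<longleftrightarrow> L = ([], []) \<and> T = [([], [])]"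
proof
  assume "tableau L [] T"
  then show "L = ([], []) \<and> T = [([], [])]"
    by (cases T) (auto simp: tableau_def)
qed (auto simp: tableau_def superpartition_def)

lemma tableau_snoc:
  "tableau L (as @ [a]) T \<longleftrightarrow> is_superpartition L \<and>
    (\<exists>T' M. T = T' @ [L] \<and> tableau M as T' \<and> M \<in> before a L)"
proof
  assume T: "tableau L (as @ [a]) T"
  then have len: "length T = length as + 2" and last: "T ! (length as + 1) = L"
    by (auto simp: tableau_def)
  then obtain T' where T': "T = T' @ [L]" "length T' = length as + 1"
    by (cases T rule: rev_cases) (auto simp: nth_append)
  let ?M = "T' ! length as"
  have "tableau ?M as T'"
    unfolding tableau_def
  proof (intro conjI allI impI)
    fix i assume i: "i < length as"
    then have "tableau_step ((as @ [a]) ! i) (T ! i) (T ! (i + 1))"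
      using T by (auto simp: tableau_def)
    then show "tableau_step (as ! i) (T' ! i) (T' ! (i + 1))"
      using i T' by (simp add: nth_append)
  qed (use T T' in \<open>auto simp: tableau_def nth_append\<close>)
  moreover have "?M \<in> set T'" using T'(2) by simp
  then have "?M \<in> before a L" "is_superpartition L"
    using T T' by (auto simp: tableau_def before_def is_superpartition_def nth_append)
  ultimately show "is_superpartition L \<and> (\<exists>T' M. T = T' @ [L] \<and> tableau M as T' \<and> M \<in> before a L)"
    using T'(1) by blast
next
  assume "is_superpartition L \<and> (\<exists>T' M. T = T' @ [L] \<and> tableau M as T' \<and> M \<in> before a L)"
  then obtain T' M where *: "is_superpartition L" "T = T' @ [L]" "tableau M as T'" "M \<in> before a L" by blast
  show "tableau L (as @ [a]) T"
    unfolding tableau_def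
  proof (intro conjI allI impI)
    fix i assume "i < length (as @ [a])"
    then consider "i < length as" | "i = length as" by force
    then show "tableau_step ((as @ [a]) ! i) (T ! i) (T ! (i + 1))"
      by cases (use * in \<open>auto simp: tableau_def before_def nth_append\<close>)
  qed (use * in \<open>auto simp: tableau_def is_superpartition_def nth_append\<close>)
qed

lemma tableau_superpartition: "tableau L as T \<Longrightarrow> is_superpartition L"
  by (cases as rule: rev_cases) (auto simp: tableau_Nil tableau_snoc is_superpartition_iff)

lemma finite_tableaux: "finite {T. tableau L as T}"
proof (induction as arbitrary: L rule: rev_induct)
  case Nil
  then show ?case by (simp add: tableau_Nil)
next
  case (snoc a as)
  show ?case
  proof (cases "is_superpartition L")
    case True
    have "{T. tableau L (as @ [a]) T} = (\<Union>M \<in> before a L. (\<lambda>T'. T' @ [L]) ` {T'. tableau M as T'})"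
      using True by (auto simp: tableau_snoc)
    then show ?thesis using snoc finite_before[OF True] by simp
  next
    case False
    then show ?thesis by (simp add: tableau_snoc)
  qed
qed

lemma circle_labels_append:
  assumes "length T = length as + 1" "i \<le> length as"
  shows "circle_labels (as @ [a]) (T @ [L]) i = circle_labels as T i"
  using assms(2)
proof (induction i)
  case (Suc i)
  then show ?case using assms(1) by (simp add: nth_append)
qed simp

lemma inversions_insert_max:
  assumes "distinct (us @ x # vs)" "\<And>y. y \<in> set (us @ vs) \<Longrightarrow> y < x"
  shows "inversions (us @ x # vs) = inversions (us @ vs) + length vs"
  using assms
proof (induction us)
  case Nil
  then have "{c \<in> set vs. c < x} = set vs" by auto
  then show ?case using inversions_Cons[of x vs] Nil(1) distinct_card[of vs] by simp
next
  case (Cons u us)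
  have "{c \<in> set (us @ x # vs). c < u} = {c \<in> set (us @ vs). c < u}"
    using Cons.prems(2)[of u] by auto
  moreover have "inversions (us @ x # vs) = inversions (us @ vs) + length vs"
    by (rule Cons.IH) (use Cons.prems in auto)
  ultimately show ?case
    using inversions_Cons[of u "us @ x # vs"] inversions_Cons[of u "us @ vs"] Cons.prems(1) by simp
qed

text \<open>The new label exceeds all older ones, so it forms one inversion with each circle below
  the new circle; their number is the exponent of \<open>step_sign\<close>. The sign of a tableau is
  thereby a product over its steps.\<close>

lemma circle_labels_snoc:
  assumes L: "is_superpartition L" and T: "tableau M as T" and M: "M \<in> before a L"
    and ls: "ls = circle_labels as T (length as)"
    and ls_props: "distinct ls" "set ls \<subseteq> {..length as}" "length ls = df M"
  defines "ls' \<equiv> circle_labels (as @ [a]) (T @ [L]) (Suc (length as))"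
  shows "distinct ls'" "set ls' = (if barred a then insert (Suc (length as)) (set ls) else set ls)"
    "length ls' = df L" "(-1) ^ inversions ls' = step_sign a M L * (-1) ^ inversions ls"
proof -
  have M': "is_superpartition M" and step: "tableau_step a M L" using M by (auto simp: before_def)
  have len: "length T = length as + 1" and last: "T ! length as = M"
    using T by (auto simp: tableau_def)
  define p where "p = length (takeWhile (\<lambda>z. \<not> is_new_circle M L z) (circles L))"
  have ls': "ls' = (if barred a then take p ls @ Suc (length as) # drop p ls else ls)"
    using len last by (cases a) (simp_all add: ls'_def circle_labels_append nth_append Let_def p_def ls)
  show "distinct ls'" "set ls' = (if barred a then insert (Suc (length as)) (set ls) else set ls)"
  proof -
    have U: "set (take p ls) \<union> set (drop p ls) = set ls"
      by (metis append_take_drop_id set_append)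
    have D: "set (take p ls) \<inter> set (drop p ls) = {}"
      using ls_props(1) by (rule set_take_disj_set_drop_if_distinct) simp
    have "Suc (length as) \<notin> set ls" using ls_props(2) by auto
    then have "Suc (length as) \<notin> set (take p ls)" "Suc (length as) \<notin> set (drop p ls)"
      using U by blast+
    with D show "distinct ls'" using ls_props(1) by (auto simp: ls')
    show "set ls' = (if barred a then insert (Suc (length as)) (set ls) else set ls)"
      using U by (auto simp: ls')
  qed
  show df: "length ls' = df L"
    using step ls_props(3) by (cases a) (auto simp: ls')
  show "(-1) ^ inversions ls' = step_sign a M L * (-1) ^ inversions ls"
  proof (cases a)
    case (Barred r)
    let ?r = "entry (shape M) (shape L)"
    have strip: "strip (shape M) (shape L)" and rows: "?r \<in> circle_rows L"
      using step Barred by (auto simp: tableau_step_iff[OF M' L] next_rows_def simp del: tableau_step.simps)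
    define us vs where "us = sorted_list_of_set {s \<in> circle_rows L. s < ?r}"
      and "vs = sorted_list_of_set {s \<in> circle_rows L. ?r < s}"
    have us_vs: "\<forall>s \<in> set us. s < ?r" by (simp add: us_def)
    have split: "row_list L = us @ ?r # vs"
      using sorted_list_of_set_split[of "circle_rows L" ?r] rows by (simp add: row_list_def us_def vs_def)
    then have circles: "circles L = map (\<lambda>t. (Suc t, Suc (shape L t))) us @
        (Suc ?r, Suc (shape L ?r)) # map (\<lambda>t. (Suc t, Suc (shape L t))) vs"
      by (simp add: circles_eq[OF L])
    have new: "is_new_circle M L z \<longleftrightarrow> fst z = Suc ?r" if "z \<in> set (circles L)" for z
      using that by (simp add: is_new_circle_iff[OF L strip])
    have "\<not> is_new_circle M L z" if "z \<in> set (map (\<lambda>t. (Suc t, Suc (shape L t))) us)" for z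
      using that us_vs new[of z] circles by auto
    moreover have "is_new_circle M L (Suc ?r, Suc (shape L ?r))"
      using new circles by simp
    ultimately have p: "p = length us"
      unfolding p_def circles by (subst takeWhile_append2) auto
    have "length us + Suc (length vs) = df L"
      using split length_row_list[OF L] by simp
    then have drop: "length (drop p ls) = length vs"
      using step Barred ls_props(3) p by auto
    have "step_sign a M L = (-1) ^ length vs"
      using Barred by (simp add: step_sign_def vs_def)
    moreover have "inversions ls' = inversions (take p ls @ drop p ls) + length (drop p ls)"
    proof -
      have "distinct ls'" by fact
      moreover have "y < Suc (length as)" if "y \<in> set (take p ls @ drop p ls)" for y
        using that ls_props(2) by auto
      ultimately show ?thesis
        using inversions_insert_max[of "take p ls" "Suc (length as)" "drop p ls"] Barred
        unfolding ls' by simp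
    qed
    ultimately show ?thesis using drop by (simp add: power_add)
  qed (simp add: ls' step_sign_def)
qed

lemma circle_labels_props:
  assumes "tableau L as T"
  shows "distinct (circle_labels as T (length as))"
    "set (circle_labels as T (length as)) = {i. 1 \<le> i \<and> i \<le> length as \<and> barred (as ! (i - 1))}"
    "length (circle_labels as T (length as)) = df L"
proof -
  have "distinct (circle_labels as T (length as)) \<and>
      set (circle_labels as T (length as)) = {i. 1 \<le> i \<and> i \<le> length as \<and> barred (as ! (i - 1))} \<and>
      length (circle_labels as T (length as)) = df L"
    using assms
  proof (induction as arbitrary: L T rule: rev_induct)
    case Nil
    then show ?case by (simp add: tableau_Nil df_def)
  next
    case (snoc a as)
    then obtain T' M where *: "is_superpartition L" "T = T' @ [L]" "tableau M as T'" "M \<in> before a L"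
      by (auto simp: tableau_snoc)
    note IH = snoc.IH[OF *(3)]
    have sub: "set (circle_labels as T' (length as)) \<subseteq> {..length as}" using IH by auto
    note new = circle_labels_snoc[OF *(1,3,4) refl _ sub]
    have "{i. 1 \<le> i \<and> i \<le> length (as @ [a]) \<and> barred ((as @ [a]) ! (i - 1))} =
        {i. 1 \<le> i \<and> i \<le> length as \<and> barred (as ! (i - 1))} \<union> (if barred a then {Suc (length as)} else {})"
      by (auto simp: nth_append le_Suc_eq)
    then show ?case using IH new(1-3) *(2) by auto
  qed
  then show "distinct (circle_labels as T (length as))"
    "set (circle_labels as T (length as)) = {i. 1 \<le> i \<and> i \<le> length as \<and> barred (as ! (i - 1))}"
    "length (circle_labels as T (length as)) = df L"
    by blast+
qed

lemma last_tableau: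
  assumes "tableau L as T"
  shows "last T = L"
proof -
  have "length T = length as + 1" "T ! length as = L" using assms by (simp_all add: tableau_def)
  moreover from this have "T \<noteq> []" by auto
  ultimately show ?thesis by (simp add: last_conv_nth)
qed

lemma sum_tableaux:
  assumes "is_superpartition L"
  shows "(\<Sum>T | tableau L as T. (-1) ^ inversions (circle_labels as T (length as))) = signed_count (rev as) L"
  using assms
proof (induction as arbitrary: L rule: rev_induct)
  case Nil
  then show ?case by (cases "L = ([], [])") (simp_all add: tableau_Nil)
next
  case (snoc a as)
  let ?s = "\<lambda>as T. (-1) ^ inversions (circle_labels as T (length as)) :: int"
  have "(\<Sum>T | tableau L (as @ [a]) T. ?s (as @ [a]) T) =
      (\<Sum>(M, T) \<in> (SIGMA M : before a L. {T. tableau M as T}). step_sign a M L * ?s as T)"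
  proof (rule sum.reindex_bij_witness[where i = "\<lambda>(M, T). T @ [L]" and j = "\<lambda>T. (last (butlast T), butlast T)"])
    fix T assume "T \<in> {T. tableau L (as @ [a]) T}"
    then obtain T' M where *: "T = T' @ [L]" "tableau M as T'" "M \<in> before a L"
      by (auto simp: tableau_snoc)
    note last = last_tableau[OF *(2)]
    show "(case (last (butlast T), butlast T) of (M, T) \<Rightarrow> T @ [L]) = T"
      "(last (butlast T), butlast T) \<in> (SIGMA M : before a L. {T. tableau M as T})"
      using * last by simp_all
    have sub: "set (circle_labels as T' (length as)) \<subseteq> {..length as}"
      using circle_labels_props(2)[OF *(2)] by auto
    show "(case (last (butlast T), butlast T) of (M, T) \<Rightarrow> step_sign a M L * ?s as T) = ?s (as @ [a]) T"
      using circle_labels_snoc(4)[OF snoc.prems *(2,3) refl circle_labels_props(1)[OF *(2)] sub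
          circle_labels_props(3)[OF *(2)]] * last by simp
  next
    fix b assume "b \<in> (SIGMA M : before a L. {T. tableau M as T})"
    then obtain M T where *: "b = (M, T)" "M \<in> before a L" "tableau M as T" by auto
    have "tableau L (as @ [a]) (T @ [L])"
      unfolding tableau_snoc using * snoc.prems by blast
    then show "(last (butlast (case b of (M, T) \<Rightarrow> T @ [L])), butlast (case b of (M, T) \<Rightarrow> T @ [L])) = b"
      "(case b of (M, T) \<Rightarrow> T @ [L]) \<in> {T. tableau L (as @ [a]) T}"
      using * last_tableau[OF *(3)] by simp_all
  qed
  also have "\<dots> = (\<Sum>M \<in> before a L. \<Sum>T | tableau M as T. step_sign a M L * ?s as T)"
    by (rule sum.Sigma[symmetric]) (use finite_before[OF snoc.prems] finite_tableaux in auto)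
  also have "\<dots> = (\<Sum>M \<in> before a L. step_sign a M L * signed_count (rev as) M)"
    using snoc.IH by (intro sum.cong refl) (simp add: before_def flip: sum_distrib_left)
  finally show ?case by simp
qed

section \<open>Fillings\<close>

lemma tableau_step_boxes:
  assumes "tableau_step a M L"
  shows "set (boxes M) \<subseteq> set (boxes L)" "card (new_boxes M L) = wsize a"
  using assms by (cases a; simp add: horizontal_strip_def)+

lemma tableau_boxes_mono:
  assumes "tableau L as T" "i \<le> j" "j \<le> length as"
  shows "set (boxes (T ! i)) \<subseteq> set (boxes (T ! j))"
  using assms(2,3)
proof (induction j rule: dec_induct)
  case (step j)
  have "tableau_step (as ! j) (T ! j) (T ! (j + 1))"
    using assms(1) step.prems by (simp add: tableau_def)
  then show ?case using step tableau_step_boxes(1) by fastforce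
qed simp

lemma boxes_empty [simp]: "boxes ([], []) = []"
  by (simp add: boxes_def sp_plus_def decreasing_def young_def)

text \<open>The shapes only grow, so a box is new exactly in the step in which it first occurs. This
  justifies the definite description in \<open>filling\<close>.\<close>

lemma ex1_label:
  assumes T: "tableau L as T" and z: "z \<in> set (boxes L)"
  shows "\<exists>!i. 1 \<le> i \<and> i \<le> length as \<and> z \<in> new_boxes (T ! (i - 1)) (T ! i)"
proof -
  have ends: "T ! 0 = ([], [])" "T ! length as = L" using T by (auto simp: tableau_def)
  let ?P = "\<lambda>i. i \<le> length as \<and> z \<in> set (boxes (T ! i))"
  have "?P (length as)" using z ends by simp
  define i where "i = (LEAST i. ?P i)"
  have i: "?P i" unfolding i_def by (rule LeastI[of ?P, OF \<open>?P (length as)\<close>])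
  have least: "\<not> ?P k" if "k < i" for k using that unfolding i_def by (rule not_less_Least)
  have "i \<noteq> 0" using i ends by (auto intro: gr0I)
  then have new: "1 \<le> i \<and> i \<le> length as \<and> z \<in> new_boxes (T ! (i - 1)) (T ! i)"
    using i least[of "i - 1"] by (auto simp: new_boxes_def)
  have "j = i" if j: "1 \<le> j \<and> j \<le> length as \<and> z \<in> new_boxes (T ! (j - 1)) (T ! j)" for j
  proof (rule ccontr)
    assume "j \<noteq> i"
    moreover have "\<not> j < i" using least[of j] j by (auto simp: new_boxes_def)
    ultimately have "i \<le> j - 1" "j - 1 \<le> length as" using j by linarith+
    then have "z \<in> set (boxes (T ! (j - 1)))"
      using tableau_boxes_mono[OF T, of i "j - 1"] i by blast
    then show False using j by (simp add: new_boxes_def)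
  qed
  then show ?thesis using new by blast
qed

lemma filling_box_iff:
  assumes "tableau L as T" "z \<in> set (boxes L)"
  shows "filling L as T z = i \<longleftrightarrow> 1 \<le> i \<and> i \<le> length as \<and> z \<in> new_boxes (T ! (i - 1)) (T ! i)"
  using ex1_label[OF assms] theI'[OF ex1_label[OF assms]] assms(2)
  unfolding filling_def if_P[OF assms(2)] by blast

lemma set_circles_boxes: "set (circles L) \<inter> set (boxes L) = {}"
  by (auto simp: circles_def)

lemma map_filling_circles:
  assumes "tableau L as T"
  shows "map (filling L as T) (circles L) = circle_labels as T (length as)"
proof (rule nth_equalityI)
  have L: "is_superpartition L" using assms by (rule tableau_superpartition)
  have len: "length (circles L) = df L" using length_row_list[OF L] by (simp add: circles_eq[OF L])
  then show "length (map (filling L as T) (circles L)) = length (circle_labels as T (length as))"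
    using circle_labels_props(3)[OF assms] by simp
  fix j assume j: "j < length (map (filling L as T) (circles L))"
  have dist: "distinct (circles L)" by (simp add: circles_def young_distinct)
  have "(THE k. k < length (circles L) \<and> circles L ! k = circles L ! j) = j"
    using j dist by (intro the_equality) (auto simp: nth_eq_iff_index_eq)
  moreover have "circles L ! j \<in> set (circles L)" using j by simp
  moreover from this have "circles L ! j \<notin> set (boxes L)" using set_circles_boxes by blast
  ultimately show "map (filling L as T) (circles L) ! j = circle_labels as T (length as) ! j"
    using j by (simp add: filling_def)
qed

lemma boxes_filling:
  assumes T: "tableau L as T" and i: "i \<le> length as"
  shows "set (boxes (T ! i)) = {z \<in> set (boxes L). filling L as T z \<le> i}"
proof (intro equalityI subsetI)
  have last: "T ! length as = L" using T by (simp add: tableau_def)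
  fix z assume z: "z \<in> set (boxes (T ! i))"
  then have zL: "z \<in> set (boxes L)" using tableau_boxes_mono[OF T i] last by auto
  define k where "k = filling L as T z"
  have k: "1 \<le> k \<and> k \<le> length as \<and> z \<in> new_boxes (T ! (k - 1)) (T ! k)"
    using filling_box_iff[OF T zL] k_def by blast
  have "k \<le> i"
  proof (rule ccontr)
    assume "\<not> k \<le> i"
    then have "i \<le> k - 1" "k - 1 \<le> length as" using k by linarith+
    then have "z \<in> set (boxes (T ! (k - 1)))"
      using tableau_boxes_mono[OF T, of i "k - 1"] z by blast
    then show False using k by (simp add: new_boxes_def)
  qed
  then show "z \<in> {z \<in> set (boxes L). filling L as T z \<le> i}" using zL k_def by simp
next
  fix z assume "z \<in> {z \<in> set (boxes L). filling L as T z \<le> i}"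
  then have zL: "z \<in> set (boxes L)" and le: "filling L as T z \<le> i" by auto
  have "z \<in> new_boxes (T ! (filling L as T z - 1)) (T ! filling L as T z)"
    using filling_box_iff[OF T zL] by blast
  then show "z \<in> set (boxes (T ! i))"
    using tableau_boxes_mono[OF T le i] by (auto simp: new_boxes_def)
qed

lemma in_boxes_iff: "(Suc t, Suc c) \<in> set (boxes L) \<longleftrightarrow> c < shape L t"
  by (simp add: set_boxes)

lemma shape_eqI: "set (boxes M) = set (boxes L) \<Longrightarrow> shape M = shape L"
proof
  fix t assume eq: "set (boxes M) = set (boxes L)"
  have "c < shape M t \<longleftrightarrow> c < shape L t" for c
    using eq by (simp flip: in_boxes_iff)
  then show "shape M t = shape L t" by (metis linorder_neqE_nat less_irrefl)
qed

text \<open>The boxes with label at most \<open>i\<close> form the \<open>i\<close>-th shape. Given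
  the shapes and the weight, \<open>tableau_step_iff\<close> determines the circle rows of each
  superpartition from those of its predecessor.\<close>

lemma inj_on_filling: "inj_on (filling L as) {T. tableau L as T}"
proof (rule inj_onI)
  fix T T' assume "T \<in> {T. tableau L as T}" "T' \<in> {T. tableau L as T}" and eq: "filling L as T = filling L as T'"
  then have T: "tableau L as T" and T': "tableau L as T'" by auto
  have sp: "is_superpartition (T ! i)" "is_superpartition (T' ! i)" if "i \<le> length as" for i
    using T T' that by (auto simp: tableau_def is_superpartition_def)
  have shape: "shape (T ! i) = shape (T' ! i)" if "i \<le> length as" for i
    by (rule shape_eqI) (use boxes_filling[OF T that] boxes_filling[OF T' that] eq in simp)
  have "T ! i = T' ! i" if "i \<le> length as" for i
    using that
  proof (induction i)
    case 0
    then show ?case using T T' by (simp add: tableau_def)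
  next
    case (Suc i)
    then have IH: "T ! i = T' ! i" by simp
    have "tableau_step (as ! i) (T ! i) (T ! Suc i)"
      using T Suc.prems by (simp add: tableau_def)
    moreover have "tableau_step (as ! i) (T ! i) (T' ! Suc i)"
      using T' Suc.prems by (simp add: tableau_def IH)
    ultimately have "circle_rows (T ! Suc i) = circle_rows (T' ! Suc i)"
      using sp Suc.prems shape[OF Suc.prems] by (auto simp: tableau_step_iff simp del: tableau_step.simps)
    then show ?case
      using superpartition_eqI sp[OF Suc.prems] shape[OF Suc.prems] by blast
  qed
  then show "T = T'"
    using T T' by (intro nth_equalityI) (auto simp: tableau_def)
qed

lemma count_filling:
  assumes T: "tableau L as T"
  shows "count (mset (map (filling L as T) (boxes L))) i =
    (if 1 \<le> i \<and> i \<le> length as then wsize (as ! (i - 1)) else 0)"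
proof -
  have dist: "distinct (boxes L)" by (simp add: boxes_def young_distinct)
  have "count (mset (map f xs)) i = length (filter (\<lambda>z. f z = i) xs)" for f and xs :: "(nat \<times> nat) list"
    by (induction xs) auto
  then have "count (mset (map (filling L as T) (boxes L))) i = length (filter (\<lambda>z. filling L as T z = i) (boxes L))" .
  also have "\<dots> = card {z \<in> set (boxes L). filling L as T z = i}"
    using dist distinct_card[of "filter (\<lambda>z. filling L as T z = i) (boxes L)"] by simp
  also have "\<dots> = (if 1 \<le> i \<and> i \<le> length as then wsize (as ! (i - 1)) else 0)"
  proof (cases "1 \<le> i \<and> i \<le> length as")
    case True
    have "{z \<in> set (boxes L). filling L as T z = i} = new_boxes (T ! (i - 1)) (T ! i)"
    proof -
      have "new_boxes (T ! (i - 1)) (T ! i) \<subseteq> set (boxes L)"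
        using tableau_boxes_mono[OF T, of i "length as"] True T by (auto simp: new_boxes_def tableau_def)
      then show ?thesis using filling_box_iff[OF T, of _ i] True by blast
    qed
    moreover have "tableau_step (as ! (i - 1)) (T ! (i - 1)) (T ! i)"
      using True T unfolding tableau_def by (cases i) auto
    ultimately show ?thesis using True tableau_step_boxes(2) by simp
  next
    case False
    then have empty: "{z \<in> set (boxes L). filling L as T z = i} = {}"
      using filling_box_iff[OF T, of _ i] by blast
    show ?thesis unfolding empty if_not_P[OF False] by simp
  qed
  finally show ?thesis .
qed

section \<open>Weights read off from fillings\<close>

definition fillings :: "spart \<Rightarrow> weight_entry list \<Rightarrow> (nat \<times> nat \<Rightarrow> nat) set" where
  "fillings L as = filling L as ` {T. tableau L as T}"

lemma before_Plain_0: "is_superpartition L \<Longrightarrow> before (Plain 0) L = {L}"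
  unfolding before_def using tableau_step_Plain_0_iff by blast

text \<open>A final weight 0 merely repeats the last superpartition and creates no label. This is
  the identification of tableaux that differ by trailing zeros.\<close>

lemma fillings_Plain_0: "fillings L (as @ [Plain 0]) = fillings L as"
proof -
  have "filling L (as @ [Plain 0]) (T @ [L]) = filling L as T" if T: "tableau L as T" for T
  proof
    fix z
    have sp: "is_superpartition L" using T by (rule tableau_superpartition)
    have T1: "tableau L (as @ [Plain 0]) (T @ [L])"
      unfolding tableau_snoc before_Plain_0[OF sp] using T sp by blast
    have len: "length T = length as + 1" using T by (simp add: tableau_def)
    consider "z \<in> set (boxes L)" | "z \<in> set (circles L)" "z \<notin> set (boxes L)"
      | "z \<notin> set (boxes L)" "z \<notin> set (circles L)" by blast
    then show "filling L (as @ [Plain 0]) (T @ [L]) z = filling L as T z"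
    proof cases
      case 1
      define k where "k = filling L as T z"
      have k: "1 \<le> k \<and> k \<le> length as \<and> z \<in> new_boxes (T ! (k - 1)) (T ! k)"
        using filling_box_iff[OF T 1] k_def by blast
      then have "filling L (as @ [Plain 0]) (T @ [L]) z = k"
        using len by (subst filling_box_iff[OF T1 1]) (auto simp: nth_append)
      then show ?thesis by (simp add: k_def)
    next
      case 2
      have "circle_labels (as @ [Plain 0]) (T @ [L]) (length as) = circle_labels as T (length as)"
        by (rule circle_labels_append) (use len in auto)
      then show ?thesis using 2 by (simp add: filling_def nth_append Let_def)
    next
      case 3
      then show ?thesis by (simp add: filling_def)
    qed
  qed
  moreover have "{T. tableau L (as @ [Plain 0]) T} = (\<lambda>T. T @ [L]) ` {T. tableau L as T}"
  proof -
    have "tableau L (as @ [Plain 0]) T \<longleftrightarrow> (\<exists>T'. T = T' @ [L] \<and> tableau L as T')" for T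
    proof (cases "is_superpartition L")
      case True
      then show ?thesis unfolding tableau_snoc before_Plain_0[OF True] by blast
    next
      case False
      then show ?thesis unfolding tableau_snoc using tableau_superpartition by blast
    qed
    then show ?thesis by auto
  qed
  ultimately show ?thesis
    unfolding fillings_def by (simp only: image_image) (intro image_cong refl, simp)
qed

lemma fillings_replicate_Plain_0: "fillings L (as @ replicate k (Plain 0)) = fillings L as"
proof (induction k)
  case (Suc k)
  then show ?case
    using fillings_Plain_0[of L "as @ replicate k (Plain 0)"] by (simp flip: replicate_append_same)
qed simp

text \<open>
  The weight of all tableaux that contribute to the coefficient at \<open>\<theta>\<^sub>A w\<close>, cut off after a bound
  \<open>r\<close> for the labels.
\<close>

definition content :: "nat \<Rightarrow> nat set \<Rightarrow> nat list \<Rightarrow> weight_entry list" where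
  "content r A w =
     map (\<lambda>i. if i \<in> A then Barred (count_list w i) else Plain (count_list w i)) [1..<Suc r]"

lemma weight_entry_cases: "a = (if barred a then Barred (wsize a) else Plain (wsize a))"
  by (cases a) auto

lemma nth_content: "i < r \<Longrightarrow> content r A w ! i =
    (if Suc i \<in> A then Barred (count_list w (Suc i)) else Plain (count_list w (Suc i)))"
  by (simp add: content_def del: upt_Suc)

lemma length_content [simp]: "length (content r A w) = r"
  by (simp add: content_def del: upt_Suc)

lemma count_list_mset: "count (mset xs) x = count_list xs x"
  by (induction xs) auto

text \<open>A filling reveals its weight: the circle labels are the barred places, and the
  multiplicities of the box labels are the sizes. So all fillings with prescribed labels come from
  one weight, which reduces the sum over all weights to a single finite set of tableaux.\<close>

lemma fillings_content:
  assumes "0 \<notin> A" "0 \<notin> set w" "\<And>x. x \<in> A \<union> set w \<Longrightarrow> x \<le> r"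
  shows "fillings L (content r A w) = {F \<in> sSSYT L. distinct (map F (circles L)) \<and>
    set (map F (circles L)) = A \<and> mset (map F (boxes L)) = mset w}"
proof (intro equalityI subsetI)
  fix F assume "F \<in> fillings L (content r A w)"
  then obtain T where T: "tableau L (content r A w) T" "F = filling L (content r A w) T"
    by (auto simp: fillings_def)
  have labels: "map F (circles L) = circle_labels (content r A w) T r"
    using map_filling_circles[OF T(1)] T(2) by simp
  have "{i. 1 \<le> i \<and> i \<le> r \<and> barred (content r A w ! (i - 1))} = A"
  proof -
    have "1 \<le> i \<and> i \<le> r \<and> barred (content r A w ! (i - 1)) \<longleftrightarrow> i \<in> A" for i
      using assms(1) assms(3)[of i] by (cases i) (auto simp: nth_content split: if_splits)
    then show ?thesis by blast
  qed
  then have "distinct (map F (circles L))" "set (map F (circles L)) = A"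
    using circle_labels_props[OF T(1)] unfolding labels by simp_all
  moreover have "mset (map F (boxes L)) = mset w"
  proof (rule multiset_eqI)
    fix i
    have "count_list w i = 0" if "\<not> (1 \<le> i \<and> i \<le> r)"
      using that assms(2) assms(3)[of i] by (cases i) (auto simp: count_list_0_iff)
    then show "count (mset (map F (boxes L))) i = count (mset w) i"
      unfolding T(2) count_filling[OF T(1)] unfolding count_list_mset
      by (cases i) (auto simp: nth_content)
  qed
  ultimately show "F \<in> {F \<in> sSSYT L. distinct (map F (circles L)) \<and>
      set (map F (circles L)) = A \<and> mset (map F (boxes L)) = mset w}"
    using T by (auto simp: sSSYT_def)
next
  fix F assume "F \<in> {F \<in> sSSYT L. distinct (map F (circles L)) \<and>
      set (map F (circles L)) = A \<and> mset (map F (boxes L)) = mset w}"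
  then obtain as T where T: "tableau L as T" and F: "F = filling L as T"
    and FA: "set (map F (circles L)) = A" and Fw: "mset (map F (boxes L)) = mset w"
    by (auto simp: sSSYT_def)
  have A: "A = {i. 1 \<le> i \<and> i \<le> length as \<and> barred (as ! (i - 1))}"
    using circle_labels_props(2)[OF T] map_filling_circles[OF T] FA F by simp
  have w: "count_list w i = (if 1 \<le> i \<and> i \<le> length as then wsize (as ! (i - 1)) else 0)" for i
    using count_filling[OF T, of i] Fw F by (metis count_list_mset)
  have entry: "as ! i = (if Suc i \<in> A then Barred (count_list w (Suc i)) else Plain (count_list w (Suc i)))"
    if "i < length as" for i
    using weight_entry_cases[of "as ! i"] that w[of "Suc i"] A by auto
  have outside: "Suc i \<notin> A" "count_list w (Suc i) = 0" if "\<not> i < length as \<or> \<not> i < r" for i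
  proof -
    show "Suc i \<notin> A" using that A assms(3)[of "Suc i"] by auto
    show "count_list w (Suc i) = 0"
    proof (cases "i < length as")
      case True
      then have "Suc i \<notin> set w" using that assms(3)[of "Suc i"] by auto
      then show ?thesis by (simp add: count_list_0_iff)
    qed (simp add: w)
  qed
  have F_in: "F \<in> fillings L as" using T F by (auto simp: fillings_def)
  show "F \<in> fillings L (content r A w)"
  \<comment> \<open>Either weight may be the longer one; its surplus consists of entries
    \<open>Plain 0\<close>.\<close>
  proof (cases "length as \<le> r")
    case True
    have "content r A w = as @ replicate (r - length as) (Plain 0)"
      by (rule nth_equalityI) (use True entry outside in \<open>auto simp: nth_content nth_append\<close>)
    then show ?thesis using F_in by (simp add: fillings_replicate_Plain_0)
  next
    case False
    have "as = content r A w @ replicate (length as - r) (Plain 0)"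
      by (rule nth_equalityI) (use False entry outside in \<open>auto simp: nth_content nth_append\<close>)
    then show ?thesis using F_in by (metis fillings_replicate_Plain_0)
  qed
qed

section \<open>Rearrangements of words and the coefficients of the Schur function\<close>

definition stabilizer_size :: "nat list \<Rightarrow> nat" where
  "stabilizer_size w = (\<Prod>x \<in> set w. fact (count_list w x))"

text \<open>Composition with a permutation carries the arrangements yielding one word bijectively to
  those yielding another word of the same content. All fibres thus have equal size, namely the
  factorial of the length divided by the number of rearrangements.\<close>

lemma card_rearrangements:
  "card {p. p permutes {..<length l} \<and> permute_list p l = w} = (if mset l = mset w then stabilizer_size w else 0)"
proof (cases "mset l = mset w")
  case True
  let ?n = "length l"
  define f where "f w = {p. p permutes {..<length l} \<and> permute_list p l = w}" for w
  have fin: "finite (f w)" for w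
    unfolding f_def by (rule finite_subset[OF _ finite_permutations[of "{..<?n}"]]) auto
  have card_f: "card (f v) = card (f l)" if v: "mset v = mset l" for v
  proof -
    obtain q where q: "q permutes {..<?n}" "permute_list q l = v"
      using mset_eq_permutation[OF v] by auto
    have "bij_betw (\<lambda>p. p \<circ> q) (f l) (f v)"
    proof (rule bij_betw_byWitness[where f' = "\<lambda>p. p \<circ> inv q"])
      have inv: "q \<circ> inv q = id" "inv q \<circ> q = id" "inv q permutes {..<?n}"
        using permutes_inv_o[OF q(1)] permutes_inv[OF q(1)] by simp_all
      show "\<forall>p \<in> f l. p \<circ> q \<circ> inv q = p" "\<forall>p \<in> f v. p \<circ> inv q \<circ> q = p"
        by (simp_all add: o_assoc[symmetric] inv)
      show "(\<lambda>p. p \<circ> q) ` f l \<subseteq> f v"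
        using q by (auto simp: f_def permute_list_compose permutes_compose)
      have "permute_list (inv q) v = l"
        using permute_list_compose[OF inv(3), of q] inv(1) q(2) by simp
      then show "(\<lambda>p. p \<circ> inv q) ` f v \<subseteq> f l"
        using inv(3) by (auto simp: f_def permute_list_compose permutes_compose)
    qed
    then show ?thesis by (simp add: bij_betw_same_card)
  qed
  have union: "{p. p permutes {..<?n}} = (\<Union>v \<in> permutations_of_multiset (mset l). f v)"
    by (auto simp: f_def permutations_of_multiset_def mset_permute_list)
  have "fact ?n = card {p. p permutes {..<?n}}"
    by (simp add: card_permutations[of _ ?n])
  also have "\<dots> = (\<Sum>v \<in> permutations_of_multiset (mset l). card (f v))"
    unfolding union
  proof (rule card_UN_disjoint)
    show "\<forall>v \<in> permutations_of_multiset (mset l). finite (f v)" using fin by blast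
  qed (auto simp: f_def)
  also have "\<dots> = card (permutations_of_multiset (mset l)) * card (f l)"
  proof -
    have "(\<Sum>v \<in> permutations_of_multiset (mset l). card (f v)) =
        (\<Sum>v \<in> permutations_of_multiset (mset l). card (f l))"
      by (rule sum.cong[OF refl]) (rule card_f, erule permutations_of_multisetD)
    then show ?thesis by simp
  qed
  finally have 1: "fact ?n = card (permutations_of_multiset (mset l)) * card (f l)" .
  have "(\<Prod>x \<in> set_mset (mset l). fact (count (mset l) x)) = stabilizer_size w"
    unfolding stabilizer_size_def True set_mset_mset count_list_mset ..
  then have 2: "card (permutations_of_multiset (mset l)) = fact ?n div stabilizer_size w"
      "stabilizer_size w dvd fact ?n"
    using card_permutations_of_multiset[of "mset l"] by simp_all
  then have "card (permutations_of_multiset (mset l)) * stabilizer_size w = fact ?n" by simp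
  then have "card (f l) = stabilizer_size w"
    using 1 by (metis fact_nonzero mult_cancel1 mult_zero_left)
  then show ?thesis using True card_f[of w] by (simp add: f_def)
next
  case False
  then have empty: "{p. p permutes {..<length l} \<and> permute_list p l = w} = {}"
    by (auto simp: mset_permute_list)
  show ?thesis unfolding empty if_not_P[OF False] by simp
qed

lemma super_kostka_eq: "is_superpartition L \<Longrightarrow> super_kostka L O' = signed_count (rev (weight_of O')) L"
  unfolding super_kostka_def
  by (subst sum_tableaux[symmetric]) (auto intro!: sum.cong simp: map_filling_circles)

text \<open>For a filling whose box labels have the content of \<open>w\<close>, exactly
  \<open>stabilizer_size w\<close> permutations of the boxes read off \<open>w\<close>, all with the
  same sign from the circles.\<close>

lemma scoeff_super_schur:
  assumes L: "is_superpartition L" and A: "finite A" and r: "\<And>x. x \<in> A \<union> set w \<Longrightarrow> x \<le> r"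
  shows "scoeff (super_schur L) A w = (if 0 \<notin> A \<and> 0 \<notin> set w
    then of_nat (stabilizer_size w) * of_int (signed_count (rev (content r A w)) L) else 0)"
proof -
  let ?cs = "circles L" and ?bs = "boxes L"
  let ?n = "length ?bs"
  define g where "g F = (\<Sum>p | p permutes {..<?n}.
    super_word (map F ?cs) (map (\<lambda>i. F (?bs ! p i)) [0..<?n]))" for F
  have g: "scoeff (g F) B v = (if distinct (map F ?cs) \<and> set (map F ?cs) = B \<and> 0 \<notin> B \<and> 0 \<notin> set v \<and>
      mset (map F ?bs) = mset v then of_nat (stabilizer_size v) * (-1) ^ inversions (map F ?cs) else 0)" for F B v
  proof -
    let ?Q = "distinct (map F ?cs) \<and> set (map F ?cs) = B \<and> 0 \<notin> B \<and> 0 \<notin> set v"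
    let ?s = "(-1) ^ inversions (map F ?cs) :: rat"
    have perm: "map (\<lambda>i. F (?bs ! p i)) [0..<?n] = permute_list p (map F ?bs)" if "p permutes {..<?n}" for p
      using permutes_in_image[OF that] by (auto simp: permute_list_def)
    have "scoeff (g F) B v = (\<Sum>p | p permutes {..<?n}. if ?Q \<and> permute_list p (map F ?bs) = v then ?s else 0)"
      unfolding g_def scoeff_sum by (intro sum.cong refl) (auto simp: scoeff_super_word perm)
    also have "\<dots> = (if ?Q then (\<Sum>p | p permutes {..<?n} \<and> permute_list p (map F ?bs) = v. ?s) else 0)"
    proof (cases ?Q)
      case True
      then have "(\<Sum>p | p permutes {..<?n}. if ?Q \<and> permute_list p (map F ?bs) = v then ?s else 0) =
          (\<Sum>p \<in> {p \<in> {p. p permutes {..<?n}}. permute_list p (map F ?bs) = v}. ?s)"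
        by (subst sum.inter_filter) (auto simp: finite_permutations)
      then show ?thesis using True by simp
    next
      case False
      then show ?thesis unfolding if_not_P[OF False] by (intro sum.neutral) auto
    qed
    also have "\<dots> = (if ?Q \<and> mset (map F ?bs) = mset v then of_nat (stabilizer_size v) * ?s else 0)"
      using card_rearrangements[of "map F ?bs" v] by simp
    finally show ?thesis by auto
  qed
  have "scoeff (super_schur L) A w = (\<Sum>F \<in> {F \<in> sSSYT L. scoeff (g F) A w \<noteq> 0}. scoeff (g F) A w)"
    unfolding super_schur_def g_def[symmetric]
  proof (rule scoeff_formal_sum[where d = "length ?cs + ?n"])
    fix F B v assume "scoeff (g F) B v \<noteq> 0"
    then have "set (map F ?cs) = B" "mset (map F ?bs) = mset v"
      unfolding g by (auto split: if_splits)
    moreover from this have "length v = ?n"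
      using mset_eq_length[of "map F ?bs" v] by simp
    ultimately have "card B \<le> length ?cs" "length v = ?n"
      using card_length[of "map F ?cs"] by auto
    then show "card B + length v \<le> length ?cs + ?n" by simp
  qed
  also have "\<dots> = (if 0 \<notin> A \<and> 0 \<notin> set w
    then of_nat (stabilizer_size w) * of_int (signed_count (rev (content r A w)) L) else 0)"
  proof (cases "0 \<notin> A \<and> 0 \<notin> set w")
    case True
    have st: "stabilizer_size w \<noteq> 0" by (simp add: stabilizer_size_def)
    have FC: "fillings L (content r A w) = {F \<in> sSSYT L. distinct (map F ?cs) \<and>
        set (map F ?cs) = A \<and> mset (map F ?bs) = mset w}"
      using True r by (intro fillings_content) auto
    have val: "scoeff (g F) A w = of_nat (stabilizer_size w) * (-1) ^ inversions (map F ?cs)"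
      if "F \<in> fillings L (content r A w)" for F
      using that True unfolding FC g by simp
    have "{F \<in> sSSYT L. scoeff (g F) A w \<noteq> 0} = fillings L (content r A w)"
      unfolding FC g using True st by (auto simp del: set_map mset_map)
    then have "(\<Sum>F \<in> {F \<in> sSSYT L. scoeff (g F) A w \<noteq> 0}. scoeff (g F) A w) =
        (\<Sum>F \<in> fillings L (content r A w). of_nat (stabilizer_size w) * (-1) ^ inversions (map F ?cs))"
      by (intro sum.cong val)
    also have "\<dots> = (\<Sum>T | tableau L (content r A w) T. of_nat (stabilizer_size w) *
        (-1) ^ inversions (circle_labels (content r A w) T (length (content r A w))))"
      unfolding fillings_def by (subst sum.reindex[OF inj_on_filling]) (auto simp: map_filling_circles)
    also have "\<dots> = of_nat (stabilizer_size w) * of_int (\<Sum>T | tableau L (content r A w) T.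
        (-1) ^ inversions (circle_labels (content r A w) T (length (content r A w))))"
      by (simp add: sum_distrib_left)
    finally show ?thesis using True unfolding sum_tableaux[OF L] by simp
  next
    case False
    then show ?thesis by (auto intro!: sum.neutral simp: g)
  qed
  finally show ?thesis .
qed

section \<open>Bringing a weight into the standard order\<close>

lemma signed_count_rev_exchange:
  assumes "is_superpartition L"
  shows "signed_count (rev (us @ a # b # vs)) L =
    (if barred a \<and> barred b then -1 else 1) * signed_count (rev (us @ b # a # vs)) L"
  using signed_count_exchange[OF assms, of "rev vs" b a "rev us"] by (simp add: conj_commute)

text \<open>Plain weights may be permuted freely and zeros dropped, so only the multiset of positive
  entries counts.\<close>

lemma signed_count_plain_part:
  assumes L: "is_superpartition L" and eq: "mset (filter (\<lambda>c. 0 < c) xs) = mset (filter (\<lambda>c. 0 < c) ys)"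
  shows "signed_count (rev (us @ map Plain xs)) L = signed_count (rev (us @ map Plain ys)) L"
proof -
  have drop: "signed_count (rev (us @ map Plain xs)) L =
      signed_count (rev (us @ map Plain (filter (\<lambda>c. 0 < c) xs))) L" for us xs
  proof (induction xs arbitrary: us)
    case (Cons x xs)
    show ?case
    proof (cases "x = 0")
      case True
      then show ?thesis
        using Cons.IH[of us] signed_count_Plain_0[OF L, of "rev (map Plain xs)" "rev us"] by simp
    next
      case False
      then show ?thesis using Cons.IH[of "us @ [Plain x]"] by simp
    qed
  qed simp
  have "signed_count (rev (us @ map Plain (filter (\<lambda>c. 0 < c) xs))) L =
      signed_count (rev (us @ map Plain (filter (\<lambda>c. 0 < c) ys))) L"
  proof (rule symmetric_mset_cong[OF _ eq, of "\<lambda>l. signed_count (rev (us @ map Plain l)) L"])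
    fix us' x y vs
    show "signed_count (rev (us @ map Plain (us' @ x # y # vs))) L =
        signed_count (rev (us @ map Plain (us' @ y # x # vs))) L"
      using signed_count_rev_exchange[OF L, of "us @ map Plain us'" "Plain x" "Plain y" "map Plain vs"] by simp
  qed
  then show ?thesis by (simp only: drop[of us xs] drop[of us ys])
qed

text \<open>Moving a barred weight past a plain one costs no sign. The barred weights keep the order
  of their labels, since an exchange among them would cost one.\<close>

lemma signed_count_content:
  assumes L: "is_superpartition L" and A: "finite A" "0 \<notin> A" and w: "0 \<notin> set w"
    and r: "\<And>x. x \<in> A \<union> set w \<Longrightarrow> x \<le> r"
    and bs: "mset bs = image_mset (count_list w) (mset_set (set w - A))"
  shows "signed_count (rev (content r A w)) L =
    signed_count (rev (map Barred (map (count_list w) (sorted_list_of_set A)) @ map Plain bs)) L"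
proof -
  let ?c = "count_list w"
  have E1: "signed_count (rev ([] @ content r A w)) L = signed_count (rev ([] @ filter barred (content r A w) @
      filter (\<lambda>a. \<not> barred a) (content r A w))) L"
    by (rule stable_partition_cong[of barred "\<lambda>l. signed_count (rev l) L"])
      (subst signed_count_rev_exchange[OF L], simp)
  have E2: "filter barred (content r A w) = map Barred (map ?c (sorted_list_of_set A))"
  proof -
    have "filter barred (content r A w) = map (\<lambda>i. Barred (?c i)) (filter (\<lambda>i. i \<in> A) [1..<Suc r])"
      unfolding content_def by (induction "[1..<Suc r]" rule: rev_induct)
        (auto simp: filter_map comp_def intro!: map_cong filter_cong simp del: upt_Suc)
    moreover have "filter (\<lambda>i. i \<in> A) [1..<Suc r] = sorted_list_of_set A"
    proof (rule sorted_distinct_set_unique)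
      have "A \<subseteq> {1..<Suc r}"
      proof
        fix x assume "x \<in> A"
        then show "x \<in> {1..<Suc r}" using A(2) r[of x] by (cases x) auto
      qed
      then show "set (filter (\<lambda>i. i \<in> A) [1..<Suc r]) = set (sorted_list_of_set A)"
        using A(1) by (auto simp del: upt_Suc)
    qed (simp_all add: sorted_wrt_filter del: upt_Suc)
    ultimately show ?thesis by (simp add: comp_def)
  qed
  have E3: "filter (\<lambda>a. \<not> barred a) (content r A w) = map Plain (map ?c (filter (\<lambda>i. i \<notin> A) [1..<Suc r]))"
    unfolding content_def
    by (auto simp: filter_map comp_def intro!: map_cong filter_cong simp del: upt_Suc)
  have E4: "mset (filter (\<lambda>c. 0 < c) (map ?c (filter (\<lambda>i. i \<notin> A) [1..<Suc r]))) = mset (filter (\<lambda>c. 0 < c) bs)"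
  proof -
    have "mset (filter (\<lambda>c. 0 < c) (map ?c (filter (\<lambda>i. i \<notin> A) [1..<Suc r]))) =
        image_mset ?c (mset (filter (\<lambda>i. 0 < ?c i) (filter (\<lambda>i. i \<notin> A) [1..<Suc r])))"
      by (simp add: filter_map comp_def del: upt_Suc filter_filter)
    also have "mset (filter (\<lambda>i. 0 < ?c i) (filter (\<lambda>i. i \<notin> A) [1..<Suc r])) =
        mset_set (set (filter (\<lambda>i. 0 < ?c i) (filter (\<lambda>i. i \<notin> A) [1..<Suc r])))"
      by (subst mset_set_set) (simp_all del: upt_Suc)
    also have "set (filter (\<lambda>i. 0 < ?c i) (filter (\<lambda>i. i \<notin> A) [1..<Suc r])) = set w - A"
    proof -
      have "0 < ?c i \<longleftrightarrow> i \<in> set w" for i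
        using count_list_0_iff[of w i] by auto
      moreover have "i \<in> {1..<Suc r}" if "i \<in> set w" for i
      proof -
        have "i \<noteq> 0" using that w by metis
        then show ?thesis using that r[of i] by simp
      qed
      ultimately show ?thesis by (auto simp del: upt_Suc)
    qed
    also have "image_mset ?c (mset_set (set w - A)) = mset (filter (\<lambda>c. 0 < c) bs)"
    proof -
      have "0 < c" if "c \<in> set bs" for c
      proof -
        have "c \<in># image_mset ?c (mset_set (set w - A))" using that bs by (metis set_mset_mset)
        then obtain i where "i \<in> set w" "c = ?c i" by auto
        then show ?thesis using count_list_0_iff[of w i] by auto
      qed
      then show ?thesis using bs by (simp add: filter_True)
    qed
    finally show ?thesis .
  qed
  show ?thesis
    using E1 signed_count_plain_part[OF L E4] unfolding E2 E3 append_Nil by (rule trans)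
qed

lemma signed_count_barred_anti:
  assumes "is_superpartition L"
  shows "signed_count (rev (map Barred (us @ x # y # vs) @ ps)) L =
    - signed_count (rev (map Barred (us @ y # x # vs) @ ps)) L"
  using signed_count_rev_exchange[OF assms, of "map Barred us" "Barred x" "Barred y" "map Barred vs @ ps"] by simp

text \<open>Equal barred weights can be exchanged at the cost of a sign, so the count is its own
  negative. On the other side of the expansion this is the case in which the type is
  undefined.\<close>

lemma content_zero:
  assumes L: "is_superpartition L" and A: "finite A" "0 \<notin> A" and w: "0 \<notin> set w"
    and r: "\<And>x. x \<in> A \<union> set w \<Longrightarrow> x \<le> r" and eq: "\<not> inj_on (count_list w) A"
  shows "signed_count (rev (content r A w)) L = 0"
proof -
  obtain bs where bs: "mset bs = image_mset (count_list w) (mset_set (set w - A))"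
    using ex_mset by blast
  have "\<not> distinct (map (count_list w) (sorted_list_of_set A))"
    using eq A(1) by (simp add: distinct_map)
  moreover have "signed_count (rev (content r A w)) L =
      signed_count (rev (map Barred (map (count_list w) (sorted_list_of_set A)) @ map Plain bs)) L"
    using A w r bs by (intro signed_count_content[OF L]) auto
  moreover have "signed_count (rev (map Barred l @ map Plain bs)) L = 0" if "\<not> distinct l" for l
    using that by (rule antisymmetric_eq_0[of "\<lambda>l. signed_count (rev (map Barred l @ map Plain bs)) L", rotated])
      (rule signed_count_barred_anti[OF L])
  ultimately show ?thesis by (simp only: not_False_eq_True)
qed

text \<open>Two sortings meet: passing from \<open>a\<close> to increasing labels costs its
  inversions, and passing to decreasing multiplicities costs \<open>sort_length\<close>. Both signs
  square to 1 and can therefore be moved to the other side.\<close>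

lemma content_value:
  assumes L: "is_superpartition L" and a: "distinct a" "0 \<notin> set a" and w: "0 \<notin> set w"
    and r: "\<And>x. x \<in> set a \<union> set w \<Longrightarrow> x \<le> r"
    and bs: "mset bs = image_mset (count_list w) (mset_set (set w - set a))"
  shows "signed_count (rev (content r (set a) w)) L =
    (-1) ^ sort_length (map (count_list w) a) * (-1) ^ inversions a *
    super_kostka L (decreasing (map (count_list w) a), decreasing bs)"
proof -
  define h where "h l = signed_count (rev (map Barred l @ map Plain (decreasing bs))) L" for l
  have anti: "h (us @ x # y # vs) = - h (us @ y # x # vs)" for us x y vs
    unfolding h_def by (rule signed_count_barred_anti[OF L])
  let ?c = "count_list w"
  have "signed_count (rev (content r (set a) w)) L = h (map ?c (sorted_list_of_set (set a)))"
    unfolding h_def using a(2) w r bs by (intro signed_count_content[OF L]) auto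
  moreover have "h (map ?c a) = (-1) ^ inversions a * h (map ?c (sorted_list_of_set (set a)))"
  proof (rule antisymmetric_sort[of "\<lambda>l. h (map ?c l)"])
    show "h (map ?c (us @ x # y # vs)) = - h (map ?c (us @ y # x # vs))" for us x y vs
      unfolding map_append list.map by (rule anti)
  qed (rule a(1))
  moreover have "h (decreasing (map ?c a)) = (-1) ^ sort_length (map ?c a) * h (map ?c a)"
    by (rule antisymmetric_decreasing) (rule anti)
  moreover have "super_kostka L (decreasing (map ?c a), decreasing bs) = h (decreasing (map ?c a))"
    by (simp add: super_kostka_eq[OF L] weight_of_def h_def)
  ultimately have "(-1) ^ sort_length (map ?c a) * (-1) ^ inversions a *
      super_kostka L (decreasing (map ?c a), decreasing bs) =
    ((-1) ^ sort_length (map ?c a) * (-1) ^ sort_length (map ?c a)) *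
      ((-1) ^ inversions a * (-1) ^ inversions a) * signed_count (rev (content r (set a) w)) L"
    by (simp only: ac_simps)
  moreover have "(-1) ^ k * (-1) ^ k = (1 :: int)" for k
    by (simp flip: power_add)
  ultimately show ?thesis by (simp only: mult_1)
qed

section \<open>Set superpartitions\<close>

definition positions :: "nat list \<Rightarrow> nat \<Rightarrow> nat set" where
  "positions w v = {j \<in> {1..length w}. w ! (j - 1) = v}"

text \<open>A label absent from \<open>w\<close> gets the value 0, in accordance with the convention
  for the minimum of the empty set; its block is \<open>{0}\<close> and comes first.\<close>

definition first_position :: "nat list \<Rightarrow> nat \<Rightarrow> nat" where
  "first_position w v = min0 (positions w v)"

text \<open>The equality pattern of \<open>w\<close> as a list of blocks, each represented by a
  letter: \<open>a\<close> lists the letters of the fermionic blocks, \<open>c\<close> those of the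
  others.\<close>

definition blocks :: "nat list \<Rightarrow> nat list \<Rightarrow> nat list \<Rightarrow> nat set list" where
  "blocks w a c = map (\<lambda>v. insert 0 (positions w v)) a @ map (positions w) c"

definition ordered :: "nat list \<Rightarrow> nat list \<Rightarrow> bool" where
  "ordered w xs \<longleftrightarrow> sorted_wrt (\<lambda>x y. first_position w x < first_position w y) xs"

definition words_of :: "nat \<Rightarrow> nat \<Rightarrow> nat set list \<Rightarrow> (nat list \<times> nat list) set" where
  "words_of n m I = {(a, b). length a = m \<and> length b = n \<and> (\<forall>i \<in> set a \<union> set b. 1 \<le> i) \<and>
     (\<forall>i < m. \<forall>j \<in> {1..n}. a ! i = b ! (j - 1) \<longleftrightarrow> j \<in> I ! i - {0}) \<and>
     (\<forall>i \<in> {1..n}. \<forall>j \<in> {1..n}. b ! (i - 1) = b ! (j - 1) \<longleftrightarrow> (\<exists>B \<in> set I. i \<in> B \<and> j \<in> B))}"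

lemma positions_props [simp]: "finite (positions w v)" "0 \<notin> positions w v"
  by (auto simp: positions_def)

lemma positions_disjoint: "u \<noteq> v \<Longrightarrow> positions w u \<inter> positions w v = {}"
  by (auto simp: positions_def)

lemma positions_empty_iff: "positions w v = {} \<longleftrightarrow> v \<notin> set w"
proof
  show "v \<notin> set w" if "positions w v = {}"
  proof
    assume "v \<in> set w"
    then obtain i where "i < length w" "w ! i = v" by (auto simp: in_set_conv_nth)
    then have "Suc i \<in> positions w v" by (simp add: positions_def)
    then show False using that by simp
  qed
  show "positions w v = {}" if "v \<notin> set w"
    using that by (auto simp: positions_def)
qed

lemma card_positions: "card (positions w v) = count_list w v"
proof -
  have "positions w v = Suc ` {i. i < length w \<and> w ! i = v}"
  proof (intro equalityI subsetI)
    fix j assume "j \<in> positions w v"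
    then show "j \<in> Suc ` {i. i < length w \<and> w ! i = v}"
      by (cases j) (auto simp: positions_def)
  qed (auto simp: positions_def)
  then have "card (positions w v) = card {i. i < length w \<and> w ! i = v}"
    by (simp add: card_image)
  also have "\<dots> = length (filter (\<lambda>x. x = v) w)"
    by (simp add: length_filter_conv_card)
  also have "\<dots> = count_list w v"
    by (induction w) auto
  finally show ?thesis .
qed

lemma first_position_cases:
  "first_position w v = 0 \<and> v \<notin> set w \<or> first_position w v \<in> positions w v"
  using Min_in[of "positions w v"] by (auto simp: first_position_def min0_def positions_empty_iff)

lemma first_position_eq:
  assumes "first_position w u = first_position w v"
  shows "u = v \<or> u \<notin> set w \<and> v \<notin> set w"
proof (cases "u = v")
  case False
  then have "\<not> (first_position w u \<in> positions w u \<and> first_position w v \<in> positions w v)"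
    using positions_disjoint[of u v w] assms by auto
  moreover have "first_position w u \<noteq> 0 \<or> first_position w u \<notin> positions w u"
    "first_position w v \<noteq> 0 \<or> first_position w v \<notin> positions w v"
    by (metis positions_props(2))+
  ultimately show ?thesis
    using first_position_cases[of w u] first_position_cases[of w v] assms by auto
qed simp

lemma first_position_le: "first_position w v \<le> length w"
  using first_position_cases[of w v] by (auto simp: positions_def)

lemma ordered_distinct: "ordered w xs \<Longrightarrow> distinct xs"
  unfolding ordered_def by (induction xs) auto

lemma ordered_unique:
  assumes "ordered w xs" "ordered w ys" "set xs = set ys"
  shows "xs = ys"
proof -
  have s: "sorted_wrt (<) (map (first_position w) xs)" "sorted_wrt (<) (map (first_position w) ys)"
    using assms(1,2) by (simp_all add: ordered_def sorted_wrt_map)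
  then have "map (first_position w) xs = map (first_position w) ys"
    using assms(3) by (intro sorted_distinct_set_unique) (simp_all add: strict_sorted_iff)
  moreover have "inj_on (first_position w) (set xs \<union> set ys)"
    using s(1) assms(3) by (simp add: strict_sorted_iff distinct_map)
  ultimately show ?thesis by (simp add: inj_on_map_eq_map)
qed

lemma ordered_exists:
  assumes "finite A" "inj_on (first_position w) A"
  obtains xs where "ordered w xs" "set xs = A"
proof
  let ?xs = "sort_key (first_position w) (sorted_list_of_set A)"
  have "sorted (map (first_position w) ?xs)" "distinct (map (first_position w) ?xs)"
    using assms by (simp_all add: distinct_map)
  then show "ordered w ?xs"
    unfolding ordered_def sorted_wrt_map[symmetric] by (simp only: strict_sorted_iff)
  show "set ?xs = A" using assms(1) by simp
qed

text \<open>Position sets of different letters are disjoint, so a difference of blocks can lose only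
  the element 0. The order required of a set superpartition thus says that fermionic blocks come
  first and that each kind is ordered by first positions.\<close>

lemma min0_fermionic:
  assumes "u \<noteq> v"
  shows "min0 (insert 0 (positions w u) - insert 0 (positions w v)) = first_position w u"
    "min0 (insert 0 (positions w u) - positions w v) = 0"
    "min0 (positions w u - insert 0 (positions w v)) = first_position w u"
    "min0 (positions w u - positions w v) = first_position w u"
proof -
  have disj: "positions w u \<inter> positions w v = {}" "0 \<notin> positions w u" "0 \<notin> positions w v"
    using positions_disjoint[OF assms] by simp_all
  then have eqs: "insert 0 (positions w u) - insert 0 (positions w v) = positions w u"
    "positions w u - insert 0 (positions w v) = positions w u"
    "positions w u - positions w v = positions w u"
    "insert 0 (positions w u) - positions w v = insert 0 (positions w u)"
    by blast+
  show "min0 (insert 0 (positions w u) - insert 0 (positions w v)) = first_position w u"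
    "min0 (positions w u - insert 0 (positions w v)) = first_position w u"
    "min0 (positions w u - positions w v) = first_position w u"
    by (simp_all only: eqs first_position_def)
  show "min0 (insert 0 (positions w u) - positions w v) = 0"
    unfolding eqs by (simp add: min0_def Min_eqI)
qed

lemma nth_blocks:
  assumes "i < length a + length c"
  shows "blocks w a c ! i = (if i < length a then insert 0 (positions w (a ! i)) else positions w (c ! (i - length a)))"
  using assms by (simp add: blocks_def nth_append)

lemma set_superpartition_blocks:
  assumes n: "length w = n" and a: "length a = m" "ordered w a" and c: "ordered w c" "set c = set w - set a"
  shows "set_superpartition n m (blocks w a c)"
proof -
  let ?I = "blocks w a c"
  have len: "length ?I = m + length c" using a by (simp add: blocks_def)
  have dist: "distinct a" "distinct c" using ordered_distinct a(2) c(1) by blast+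
  define lab where "lab i = (if i < m then a ! i else c ! (i - m))" for i
  have nth: "?I ! i = (if i < m then insert 0 (positions w (lab i)) else positions w (lab i))" if "i < length ?I" for i
    using nth_blocks[of i a c w] that len a(1) by (simp add: lab_def)
  have lab_a: "lab i \<in> set a" if "i < m" for i using that a(1) by (simp add: lab_def)
  have lab_c: "lab i \<in> set c" if "\<not> i < m" "i < length ?I" for i using that len by (simp add: lab_def)
  have lab_inj: "lab i \<noteq> lab j" if "i < length ?I" "j < length ?I" "i \<noteq> j" for i j
  proof (cases "i < m \<longleftrightarrow> j < m")
    case True
    then show ?thesis
      using that dist len a(1) by (auto simp: lab_def nth_eq_iff_index_eq)
  next
    case False
    then show ?thesis using lab_a lab_c that c(2) by (metis DiffD2)
  qed
  \<comment> \<open>The first positions of the fermionic letters are pairwise different, and the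
    value 0 is available for a letter absent from \<open>w\<close>.\<close>
  have "m \<le> n + 1"
  proof -
    have "distinct (map (first_position w) a)"
      using a(2) unfolding ordered_def sorted_wrt_map[symmetric] by (simp only: strict_sorted_iff)
    moreover have "set (map (first_position w) a) \<subseteq> {0..n}"
      using first_position_le n by auto
    ultimately have "length (map (first_position w) a) \<le> card {0..n}"
      by (metis card_mono distinct_card finite_atLeastAtMost)
    then show ?thesis using a(1) by simp
  qed
  moreover have zero: "0 \<in> ?I ! i \<longleftrightarrow> i < m" if "i < length ?I" for i
    using nth[OF that] by simp
  moreover have inter: "?I ! i \<inter> ?I ! j \<subseteq> {0}" if "i < length ?I" "j < length ?I" "i \<noteq> j" for i j
    using nth[OF that(1)] nth[OF that(2)] positions_disjoint[OF lab_inj[OF that], of w] by auto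
  moreover have order: "min0 (?I ! i - ?I ! j) < min0 (?I ! j - ?I ! i)" if "i < length ?I" "j < length ?I" "i < j" for i j
  proof -
    have ne: "lab i \<noteq> lab j" "lab j \<noteq> lab i" using lab_inj that by auto
    consider "j < m" | "i < m" "\<not> j < m" | "\<not> i < m" using that(3) by linarith
    then show ?thesis
    proof cases
      case 1
      then have "first_position w (lab i) < first_position w (lab j)"
        using a that(3) by (auto simp: ordered_def lab_def sorted_wrt_iff_nth_less)
      then show ?thesis using 1 that by (simp add: nth min0_fermionic ne)
    next
      case 2
      have "lab j \<in> set w" using lab_c[of j] 2 that c(2) by auto
      then have "0 < first_position w (lab j)"
        using first_position_cases[of w "lab j"] positions_props(2) by (metis gr0I)
      then show ?thesis using 2 that by (simp add: nth min0_fermionic ne)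
    next
      case 3
      then have "first_position w (lab i) < first_position w (lab j)"
        using c(1) that len by (auto simp: ordered_def lab_def sorted_wrt_iff_nth_less)
      then show ?thesis using 3 that by (simp add: nth min0_fermionic ne)
    qed
  qed
  moreover have "distinct ?I"
    unfolding distinct_conv_nth
  proof (intro allI impI)
    fix i j assume ij: "i < length ?I" "j < length ?I" "i \<noteq> j"
    show "?I ! i \<noteq> ?I ! j"
    proof
      assume "?I ! i = ?I ! j"
      then show False using order[of i j] order[of j i] ij by (cases "i < j") auto
    qed
  qed
  moreover have "\<forall>B \<in> set ?I. B \<noteq> {} \<and> B \<subseteq> {0..n}"
  proof
    fix B assume "B \<in> set ?I"
    then consider v where "B = insert 0 (positions w v)" | v where "v \<in> set c" "B = positions w v"
      by (auto simp: blocks_def)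
    moreover have "positions w v \<subseteq> {0..n}" for v using n by (auto simp: positions_def)
    moreover have "positions w v \<noteq> {}" if "v \<in> set c" for v
      using that c(2) by (simp add: positions_empty_iff)
    ultimately show "B \<noteq> {} \<and> B \<subseteq> {0..n}" by cases auto
  qed
  moreover have "(\<Union>B \<in> set ?I. B - {0}) = {1..n}"
  proof -
    have "(\<Union>B \<in> set ?I. B - {0}) = (\<Union>v \<in> set a \<union> set c. positions w v)"
      by (auto simp: blocks_def)
    also have "\<dots> = {1..n}"
    proof (intro equalityI subsetI)
      fix j assume "j \<in> {1..n}"
      then have "j \<in> positions w (w ! (j - 1))" "w ! (j - 1) \<in> set w" using n by (auto simp: positions_def)
      then show "j \<in> (\<Union>v \<in> set a \<union> set c. positions w v)" using c(2) by blast
    qed (use n in \<open>auto simp: positions_def\<close>)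
    finally show ?thesis .
  qed
  ultimately show ?thesis
    using len unfolding set_superpartition_def by simp
qed

lemma blocks_words_of:
  assumes n: "length w = n" and a: "length a = m" "ordered w a" and c: "set c = set w - set a"
    and pos: "0 \<notin> set a" "0 \<notin> set w"
  shows "(a, w) \<in> words_of n m (blocks w a c)"
proof -
  have "a ! i = w ! (j - 1) \<longleftrightarrow> j \<in> blocks w a c ! i - {0}" if "i < m" "j \<in> {1..n}" for i j
    using that n a(1) by (auto simp: nth_blocks positions_def)
  moreover have "w ! (i - 1) = w ! (j - 1) \<longleftrightarrow> (\<exists>B \<in> set (blocks w a c). i \<in> B \<and> j \<in> B)"
    if "i \<in> {1..n}" "j \<in> {1..n}" for i j
  proof
    assume eq: "w ! (i - 1) = w ! (j - 1)"
    have "i \<in> positions w (w ! (i - 1))" "j \<in> positions w (w ! (i - 1))"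
      using that n eq by (auto simp: positions_def)
    moreover have "w ! (i - 1) \<in> set w" using that n by auto
    then have "w ! (i - 1) \<in> set a \<or> w ! (i - 1) \<in> set c" using c by blast
    ultimately show "\<exists>B \<in> set (blocks w a c). i \<in> B \<and> j \<in> B" by (auto simp: blocks_def)
  next
    assume "\<exists>B \<in> set (blocks w a c). i \<in> B \<and> j \<in> B"
    then show "w ! (i - 1) = w ! (j - 1)" using that by (auto simp: blocks_def positions_def)
  qed
  moreover have "\<forall>i \<in> set a \<union> set w. 1 \<le> i" using pos by (auto simp: Suc_le_eq intro!: gr0I)
  ultimately show ?thesis using n a(1) by (simp add: words_of_def)
qed

text \<open>Converse to \<open>blocks_words_of\<close>: a word with distinct theta indices, as a
  nonzero monomial has, determines the set superpartition in whose sum it occurs.\<close>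

lemma words_of_blocks:
  assumes I: "set_superpartition n m I" and aw: "(a, w) \<in> words_of n m I" and a: "distinct a"
  obtains c where "I = blocks w a c" "ordered w a" "ordered w c" "set c = set w - set a"
    "length a = m" "length w = n"
proof -
  note aw' = aw[unfolded words_of_def mem_Collect_eq prod.case]
  have len: "length a = m" "length w = n" using aw' by simp_all
  have ferm: "a ! i = w ! (j - 1) \<longleftrightarrow> j \<in> I ! i - {0}" if "i < m" "j \<in> {1..n}" for i j
    using aw' that by blast
  have same: "w ! (i - 1) = w ! (j - 1) \<longleftrightarrow> (\<exists>B \<in> set I. i \<in> B \<and> j \<in> B)"
    if "i \<in> {1..n}" "j \<in> {1..n}" for i j
    using aw' that by blast
  note I' = I[unfolded set_superpartition_def]
  have mI: "m \<le> length I" using I' by (elim conjE)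
  have subs: "\<forall>B \<in> set I. B \<noteq> {} \<and> B \<subseteq> {0..n}" using I' by (elim conjE)
  then have sub: "B \<noteq> {} \<and> B \<subseteq> {0..n}" if "B \<in> set I" for B using that by (rule bspec)
  have un: "(\<Union>B \<in> set I. B - {0}) = {1..n}" using I' by (elim conjE)
  have inters: "\<forall>i < length I. \<forall>j < length I. i \<noteq> j \<longrightarrow> I ! i \<inter> I ! j \<subseteq> {0}"
    using I' by (elim conjE)
  have inter: "I ! i \<inter> I ! j \<subseteq> {0}" if "i < length I" "j < length I" "i \<noteq> j" for i j
    using inters[rule_format, OF that] .
  have zeros: "\<forall>i < length I. 0 \<in> I ! i \<longleftrightarrow> i < m" using I' by (elim conjE)
  have zero: "0 \<in> I ! i \<longleftrightarrow> i < m" if "i < length I" for i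
    using zeros[rule_format, OF that] .
  have orders: "\<forall>i < length I. \<forall>j < length I. i < j \<longrightarrow> min0 (I ! i - I ! j) < min0 (I ! j - I ! i)"
    using I' by (elim conjE)
  have order: "min0 (I ! i - I ! j) < min0 (I ! j - I ! i)" if "i < length I" "j < length I" "i < j" for i j
    using orders[rule_format, OF that] .
  have fblock: "I ! i = insert 0 (positions w (a ! i))" if i: "i < m" for i
  proof (intro equalityI subsetI)
    have il: "i < length I" using i mI by simp
    fix j
    show "j \<in> insert 0 (positions w (a ! i))" if "j \<in> I ! i"
    proof (cases "j = 0")
      case False
      then have "j \<in> {1..n}" using that sub[OF nth_mem[OF il]] by auto
      then show ?thesis using ferm[OF i, of j] that False len by (auto simp: positions_def)
    qed simp
    show "j \<in> I ! i" if "j \<in> insert 0 (positions w (a ! i))"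
    proof (cases "j = 0")
      case True
      then show ?thesis using zero[OF il] i by simp
    next
      case False
      then have "j \<in> {1..n}" "w ! (j - 1) = a ! i" using that len by (auto simp: positions_def)
      then show ?thesis using ferm[OF i, of j] by auto
    qed
  qed
  \<comment> \<open>All positions in a block without 0 carry the same letter; the minimum just
    selects one of them, and list indices start at 0.\<close>
  define lab where "lab B = w ! (Min B - 1)" for B
  have bblock: "I ! i = positions w (lab (I ! i)) \<and> lab (I ! i) \<in> set w - set a" if i: "m \<le> i" "i < length I" for i
  proof -
    let ?B = "I ! i"
    have B: "?B \<in> set I" "0 \<notin> ?B" "?B \<noteq> {}" "?B \<subseteq> {1..n}"
    proof -
      show "?B \<in> set I" using i by simp
      then show "?B \<noteq> {}" using sub by blast
      show "0 \<notin> ?B" using zero i by simp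
      then show "?B \<subseteq> {1..n}" using sub[OF \<open>?B \<in> set I\<close>] by (auto simp: Suc_le_eq intro!: gr0I)
    qed
    have fin: "finite ?B" using B(4) finite_subset by blast
    define j where "j = Min ?B"
    have j: "j \<in> ?B" "j \<in> {1..n}" using Min_in[OF fin B(3)] B(4) by (auto simp: j_def)
    have own: "k = i" if "k < length I" "j \<in> I ! k" for k
      using inter[of k i] that i j by auto
    have 1: "?B = positions w (lab ?B)"
    proof (intro equalityI subsetI)
      fix k assume k: "k \<in> ?B"
      then have "w ! (k - 1) = w ! (j - 1)" using same[of k j] B j by blast
      then show "k \<in> positions w (lab ?B)" using k B(4) len by (auto simp: positions_def lab_def j_def)
    next
      fix k assume "k \<in> positions w (lab ?B)"
      then have k: "k \<in> {1..n}" "w ! (j - 1) = w ! (k - 1)" using len by (auto simp: positions_def lab_def j_def)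
      then obtain B' where "B' \<in> set I" "j \<in> B'" "k \<in> B'" using same[OF j(2) k(1)] by blast
      then show "k \<in> ?B" using own by (metis in_set_conv_nth)
    qed
    have "lab ?B \<in> set w" using j len by (auto simp: lab_def j_def)
    moreover have "lab ?B \<notin> set a"
    proof
      assume "lab ?B \<in> set a"
      then obtain k where k: "k < m" "a ! k = w ! (j - 1)" using len by (auto simp: in_set_conv_nth lab_def j_def)
      then have "j \<in> I ! k" using ferm[OF k(1) j(2)] by blast
      then show False using own[of k] k(1) mI i by simp
    qed
    ultimately show ?thesis using 1 by blast
  qed
  define c where "c = map lab (drop m I)"
  have c_nth: "c ! (i - m) = lab (I ! i)" if "m \<le> i" "i < length I" for i
    using that by (simp add: c_def)
  have Ieq: "I = blocks w a c"
  proof (rule nth_equalityI)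
    show "length I = length (blocks w a c)" using mI len by (simp add: blocks_def c_def)
    fix i assume i: "i < length I"
    then have "i < length a + length c" using mI len by (simp add: c_def)
    then show "I ! i = blocks w a c ! i"
      using fblock bblock c_nth i len(1) by (simp add: nth_blocks not_less)
  qed
  have cset: "set c = set w - set a"
  proof (intro equalityI subsetI)
    fix x assume "x \<in> set c"
    then obtain i where "i < length c" "x = c ! i" by (auto simp: in_set_conv_nth)
    then show "x \<in> set w - set a" using bblock[of "i + m"] c_nth[of "i + m"] by (simp add: c_def)
  next
    fix x assume x: "x \<in> set w - set a"
    then obtain j where j: "j < n" "w ! j = x" using len by (auto simp: in_set_conv_nth)
    then have "Suc j \<in> (\<Union>B \<in> set I. B - {0})" using un by simp
    then obtain i where i: "i < length I" "Suc j \<in> I ! i" by (auto simp: in_set_conv_nth)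
    have "\<not> i < m"
    proof
      assume "i < m"
      then have "a ! i = x" using fblock i j len by (auto simp: positions_def)
      then show False using x \<open>i < m\<close> len by auto
    qed
    then have "I ! i = positions w (lab (I ! i))" using bblock[of i] i(1) by simp
    then have "Suc j \<in> positions w (lab (I ! i))" using i(2) by (rule subst)
    then have "x = lab (I ! i)" using j(2) by (simp add: positions_def)
    moreover have "i - m < length c" using \<open>\<not> i < m\<close> i(1) by (simp add: c_def)
    ultimately show "x \<in> set c"
      using nth_mem[of "i - m" c] c_nth[of i] \<open>\<not> i < m\<close> i(1) by simp
  qed
  have oa: "ordered w a"
    unfolding ordered_def sorted_wrt_iff_nth_less
  proof (intro allI impI)
    fix i j assume ij: "i < j" "j < length a"
    then have "a ! i \<noteq> a ! j" using a by (simp add: nth_eq_iff_index_eq)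
    then show "first_position w (a ! i) < first_position w (a ! j)"
      using order[of i j] ij len mI fblock by (simp add: min0_fermionic)
  qed
  have oc: "ordered w c"
    unfolding ordered_def sorted_wrt_iff_nth_less
  proof (intro allI impI)
    fix i j assume ij: "i < j" "j < length c"
    then have l: "i + m < length I" "j + m < length I" by (simp_all add: c_def)
    have eqs: "I ! (i + m) = positions w (c ! i)" "I ! (j + m) = positions w (c ! j)"
      using bblock[of "i + m"] bblock[of "j + m"] c_nth[of "i + m"] c_nth[of "j + m"] l by simp_all
    have "c ! i \<noteq> c ! j"
    proof
      assume "c ! i = c ! j"
      then show False using order[of "i + m" "j + m"] l ij eqs by simp
    qed
    then show "first_position w (c ! i) < first_position w (c ! j)"
      using order[of "i + m" "j + m"] l ij eqs by (simp add: min0_fermionic)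
  qed
  show ?thesis using that[OF Ieq oa oc cset len] .
qed

section \<open>Coefficients and types of the monomial functions\<close>

lemma scoeff_super_monomial:
  "scoeff (super_monomial n m I) A w = (if 0 \<notin> A \<and> 0 \<notin> set w
     then \<Sum>a | (a, w) \<in> words_of n m I \<and> distinct a \<and> set a = A. (-1) ^ inversions a else 0)"
proof -
  let ?f = "\<lambda>(a, b). super_word a b"
  have val: "scoeff (?f s) B v = (if distinct (fst s) \<and> set (fst s) = B \<and> 0 \<notin> B \<and> snd s = v \<and> 0 \<notin> set v
      then (-1) ^ inversions (fst s) else 0)" for s B v
    by (cases s) (simp add: scoeff_super_word)
  have "scoeff (super_monomial n m I) A w =
      (\<Sum>s \<in> {s \<in> words_of n m I. scoeff (?f s) A w \<noteq> 0}. scoeff (?f s) A w)"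
    unfolding super_monomial_def words_of_def[symmetric]
  proof (rule scoeff_formal_sum[where d = "m + n"])
    fix s B v assume s: "s \<in> words_of n m I" "scoeff (?f s) B v \<noteq> 0"
    then have "set (fst s) = B" "snd s = v" unfolding val by (auto split: if_splits)
    moreover have "length (fst s) = m" "length (snd s) = n" using s(1) by (auto simp: words_of_def)
    ultimately show "card B + length v \<le> m + n" using card_length[of "fst s"] by auto
  qed
  also have "\<dots> = (if 0 \<notin> A \<and> 0 \<notin> set w
     then \<Sum>a | (a, w) \<in> words_of n m I \<and> distinct a \<and> set a = A. (-1) ^ inversions a else 0)"
  proof (cases "0 \<notin> A \<and> 0 \<notin> set w")
    case True
    have "(\<Sum>s \<in> {s \<in> words_of n m I. scoeff (?f s) A w \<noteq> 0}. scoeff (?f s) A w) =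
        (\<Sum>a | (a, w) \<in> words_of n m I \<and> distinct a \<and> set a = A. (-1) ^ inversions a)"
      by (rule sum.reindex_bij_witness[where i = "\<lambda>a. (a, w)" and j = fst])
        (use True in \<open>auto simp: scoeff_super_word split: if_splits\<close>)
    then show ?thesis using True by simp
  next
    case False
    then show ?thesis unfolding if_not_P[OF False] by (intro sum.neutral) (auto simp: val)
  qed
  finally show ?thesis .
qed

lemma fermionic_sizes_blocks: "fermionic_sizes (blocks w a c) = map (count_list w) a"
proof -
  have "filter (\<lambda>B. 0 \<in> B) (map (\<lambda>v. insert 0 (positions w v)) a) = map (\<lambda>v. insert 0 (positions w v)) a"
    "filter (\<lambda>B. 0 \<in> B) (map (positions w) c) = []"
    by (simp_all add: filter_empty_conv)
  then show ?thesis
    by (simp add: fermionic_sizes_def blocks_def comp_def card_positions)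
qed

lemma ssp_type_blocks:
  "ssp_type (blocks w a c) = (if distinct (map (count_list w) a)
     then Some (decreasing (map (count_list w) a), decreasing (map (count_list w) c)) else None)"
proof -
  have "filter (\<lambda>B. 0 \<notin> B) (map (\<lambda>v. insert 0 (positions w v)) a) = []"
    "filter (\<lambda>B. 0 \<notin> B) (map (positions w) c) = map (positions w) c"
    by (simp_all add: filter_empty_conv)
  then have "map card (filter (\<lambda>B. 0 \<notin> B) (blocks w a c)) = map (count_list w) c"
    by (simp add: blocks_def comp_def card_positions)
  then show ?thesis by (simp add: ssp_type_def fermionic_sizes_blocks)
qed

lemma sum_count_split:
  assumes "distinct a" "distinct c" "set c = set w - set a"
  shows "sum_list (map (count_list w) a) + sum_list (map (count_list w) c) = length w"
proof -
  have "sum_list (map (count_list w) a) + sum_list (map (count_list w) c) =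
      sum (count_list w) (set a) + sum (count_list w) (set c)"
    using assms by (simp add: sum_list_distinct_conv_sum_set)
  also have "\<dots> = sum (count_list w) (set a \<union> set w)"
    unfolding assms(3) by (subst sum.union_disjoint[symmetric]) (auto simp: Un_Diff_cancel)
  also have "\<dots> = length w" by (rule sum_count_set) auto
  finally show ?thesis .
qed

text \<open>Each letter contributes the factorial of its multiplicity. A fermionic letter absent
  from \<open>w\<close> contributes 0! = 1, so it may be missing from
  \<open>stabilizer_size\<close>.\<close>

lemma sp_fact_type:
  assumes "distinct a" "distinct c" "set c = set w - set a"
  shows "sp_fact (decreasing (map (count_list w) a), decreasing (map (count_list w) c)) = stabilizer_size w"
proof -
  let ?f = "\<lambda>x. fact (count_list w x) :: nat"
  have dec: "prod_list (map fact (decreasing xs)) = (prod_list (map fact xs) :: nat)" for xs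
    by (simp flip: prod_mset_prod_list)
  have "sp_fact (decreasing (map (count_list w) a), decreasing (map (count_list w) c)) =
      prod ?f (set a) * prod ?f (set c)"
    using assms(1,2) by (simp add: sp_fact_def dec comp_def prod.distinct_set_conv_list)
  also have "\<dots> = prod ?f (set a \<union> set w)"
    unfolding assms(3) by (subst prod.union_disjoint[symmetric]) (auto simp: Un_Diff_cancel)
  also have "\<dots> = stabilizer_size w"
    unfolding stabilizer_size_def
    by (rule prod.mono_neutral_right) (auto simp: count_list_0_iff[THEN iffD2])
  finally show ?thesis .
qed

lemma finite_set_superpartitions: "finite {I. set_superpartition n m I}"
proof (rule finite_subset)
  show "{I. set_superpartition n m I} \<subseteq> {I. set I \<subseteq> Pow {0..n} \<and> distinct I}"
  proof
    fix I assume "I \<in> {I. set_superpartition n m I}"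
    then have I: "set_superpartition n m I" by simp
    have "distinct I" using I unfolding set_superpartition_def by (elim conjE)
    moreover have "\<forall>B \<in> set I. B \<noteq> {} \<and> B \<subseteq> {0..n}"
      using I unfolding set_superpartition_def by (elim conjE)
    ultimately show "I \<in> {I. set I \<subseteq> Pow {0..n} \<and> distinct I}" by auto
  qed
  show "finite {I. set I \<subseteq> Pow {0..n} \<and> distinct I}"
    by (rule finite_subset_distinct) simp
qed

lemma signed_count_content_nonzero:
  assumes L: "is_superpartition L" and A: "0 \<notin> A" "0 \<notin> set w" and r: "\<And>x. x \<in> A \<union> set w \<Longrightarrow> x \<le> r"
    and nz: "signed_count (rev (content r A w)) L \<noteq> 0"
  shows "card A = df L" "length w = spsize L"
proof -
  have "{T. tableau L (content r A w) T} \<noteq> {}"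
    using nz unfolding sum_tableaux[OF L, symmetric] by (metis sum.empty)
  then have "fillings L (content r A w) \<noteq> {}" by (simp add: fillings_def)
  then obtain F where F: "distinct (map F (circles L))" "set (map F (circles L)) = A"
    "mset (map F (boxes L)) = mset w"
    using fillings_content[OF A r] by auto
  have "card A = length (map F (circles L))" using F(1,2) distinct_card by metis
  then show "card A = df L" using length_row_list[OF L] by (simp add: circles_eq[OF L])
  have "card (new_boxes ([], []) L) + spsize ([], []) = spsize L"
    by (rule card_new_boxes) (simp add: shape_def sp_plus_def decreasing_def)
  then have "card (set (boxes L)) = spsize L" by (simp add: new_boxes_def spsize_def)
  then have "length (boxes L) = spsize L"
    using distinct_card[of "boxes L"] young_distinct by (simp add: boxes_def)
  then show "length w = spsize L" using mset_eq_length[OF F(3)] by simp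
qed

section \<open>Comparison of coefficients\<close>

definition monomial_sum :: "nat \<Rightarrow> nat \<Rightarrow> spart \<Rightarrow> superseries" where
  "monomial_sum n m O' = (\<Sum>I | set_superpartition n m I \<and> ssp_type I = Some O'.
     (-1) ^ ssp_eps I * super_monomial n m I)"

lemma scoeff_monomial_sum: "scoeff (monomial_sum n m O') A w =
  (\<Sum>I | set_superpartition n m I \<and> ssp_type I = Some O'.
     (-1) ^ ssp_eps I * scoeff (super_monomial n m I) A w)"
  by (simp add: monomial_sum_def scoeff_sum scoeff_minus_one_power_mult)

lemma scoeff_super_monomial_nonzero:
  assumes "set_superpartition n m I" "scoeff (super_monomial n m I) A w \<noteq> 0"
  obtains a c where "I = blocks w a c" "ordered w a" "ordered w c" "set a = A" "set c = set w - A"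
    "length a = m" "length w = n"
proof -
  have "{a. (a, w) \<in> words_of n m I \<and> distinct a \<and> set a = A} \<noteq> {}"
    using assms(2) unfolding scoeff_super_monomial by (metis sum.empty)
  then obtain a where a: "(a, w) \<in> words_of n m I" "distinct a" "set a = A" by blast
  show ?thesis
    by (rule words_of_blocks[OF assms(1) a(1,2)]) (use that a(3) in blast)
qed

text \<open>The sets of letters are prescribed by \<open>A\<close> and \<open>w\<close>, and
  \<open>ordered\<close> fixes their order. So a single set superpartition contributes, and within
  it a single word.\<close>

lemma scoeff_monomial_sum_eq:
  assumes a: "ordered w a" "set a = A" "length a = m" and c: "ordered w c" "set c = set w - A"
    and n: "length w = n" and pos: "0 \<notin> A" "0 \<notin> set w"
    and dist: "distinct (map (count_list w) a)"
  shows "scoeff (monomial_sum n m O') A w =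
    (if O' = (decreasing (map (count_list w) a), decreasing (map (count_list w) c))
     then (-1) ^ sort_length (map (count_list w) a) * (-1) ^ inversions a else 0)"
proof -
  let ?I = "blocks w a c"
  let ?O = "(decreasing (map (count_list w) a), decreasing (map (count_list w) c))"
  have ssp: "set_superpartition n m ?I"
    using set_superpartition_blocks[OF n a(3,1) c(1)] a(2) c(2) by simp
  have type: "ssp_type ?I = Some ?O" using dist by (simp add: ssp_type_blocks)
  have uniq: "I = ?I" if I: "set_superpartition n m I" "scoeff (super_monomial n m I) A w \<noteq> 0" for I
  proof -
    obtain a' c' where "I = blocks w a' c'" "ordered w a'" "ordered w c'" "set a' = A" "set c' = set w - A"
      using scoeff_super_monomial_nonzero[OF I] by metis
    then show ?thesis using ordered_unique a c by metis
  qed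
  have coeff: "scoeff (super_monomial n m ?I) A w = (-1) ^ inversions a"
  proof -
    have "{b. (b, w) \<in> words_of n m ?I \<and> distinct b \<and> set b = A} = {a}"
    proof (intro equalityI subsetI)
      fix b assume "b \<in> {b. (b, w) \<in> words_of n m ?I \<and> distinct b \<and> set b = A}"
      then have b: "(b, w) \<in> words_of n m ?I" "distinct b" "set b = A" by auto
      have "ordered w b" by (rule words_of_blocks[OF ssp b(1,2)])
      then show "b \<in> {a}" using ordered_unique a b(3) by blast
    next
      fix b assume "b \<in> {a}"
      then show "b \<in> {b. (b, w) \<in> words_of n m ?I \<and> distinct b \<and> set b = A}"
        using blocks_words_of[OF n a(3,1)] c(2) a(2) pos ordered_distinct[OF a(1)] by simp
    qed
    then show ?thesis using pos by (simp add: scoeff_super_monomial)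
  qed
  show ?thesis
  proof (cases "O' = ?O")
    case True
    have "scoeff (monomial_sum n m O') A w = (\<Sum>I \<in> {?I}. (-1) ^ ssp_eps I * scoeff (super_monomial n m I) A w)"
      unfolding scoeff_monomial_sum
    proof (rule sum.mono_neutral_right)
      show "finite {I. set_superpartition n m I \<and> ssp_type I = Some O'}"
        by (rule finite_subset[OF _ finite_set_superpartitions[of n m]]) auto
      show "{?I} \<subseteq> {I. set_superpartition n m I \<and> ssp_type I = Some O'}"
        using ssp type True by simp
      show "\<forall>I \<in> {I. set_superpartition n m I \<and> ssp_type I = Some O'} - {?I}.
          (-1) ^ ssp_eps I * scoeff (super_monomial n m I) A w = 0"
        using uniq by auto
    qed
    then show ?thesis using True coeff by (simp add: ssp_eps_def fermionic_sizes_blocks)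
  next
    case False
    have "scoeff (super_monomial n m I) A w = 0" if "set_superpartition n m I" "ssp_type I = Some O'" for I
    proof (rule ccontr)
      assume "scoeff (super_monomial n m I) A w \<noteq> 0"
      then have "I = ?I" by (rule uniq[OF that(1)])
      then show False using that(2) type False by simp
    qed
    then show ?thesis unfolding scoeff_monomial_sum if_not_P[OF False] by (intro sum.neutral) auto
  qed
qed

lemma superpartition_type:
  assumes "distinct a" "distinct c" "set c = set w - set a" "length a = m" "length w = n"
    "distinct (map (count_list w) a)"
  shows "superpartition n m (decreasing (map (count_list w) a), decreasing (map (count_list w) c))"
proof -
  have sum: "sum_list (decreasing xs) = sum_list xs" for xs
    by (metis decreasing_props(1) sum_mset_sum_list)
  have "distinct (decreasing (map (count_list w) a))"
    using assms(6) by (simp add: decreasing_def)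
  then have "sorted_wrt (>) (decreasing (map (count_list w) a))"
    by (simp add: decreasing_def sorted_wrt_rev strict_sorted_iff)
  moreover have "1 \<le> b" if b: "b \<in> set (map (count_list w) c)" for b
  proof -
    obtain x where "x \<in> set w" "b = count_list w x" using b assms(3) by auto
    then have "b \<noteq> 0" by (simp add: count_list_0_iff)
    then show ?thesis by simp
  qed
  ultimately show ?thesis
    using assms(4,5) sum_count_split[OF assms(1-3)] by (simp add: superpartition_def sum)
qed

lemma super_schur_expansion:
  assumes Lam: "superpartition n m L"
  shows "super_schur L = (\<Sum>O' | superpartition n m O'.
    of_int (super_kostka L O') * of_nat (sp_fact O') * monomial_sum n m O')"
proof (rule superseries_eqI)
  fix A w
  have L: "is_superpartition L" "spsize L = n" "df L = m" using Lam by (simp_all add: superpartition_iff)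
  have rhs: "scoeff (\<Sum>O' | superpartition n m O'.
      of_int (super_kostka L O') * of_nat (sp_fact O') * monomial_sum n m O') A w =
      (\<Sum>O' | superpartition n m O'.
        of_int (super_kostka L O') * (of_nat (sp_fact O') * scoeff (monomial_sum n m O') A w))"
    by (simp add: scoeff_sum mult.assoc scoeff_of_int_mult scoeff_of_nat_mult)
  show "scoeff (super_schur L) A w = scoeff (\<Sum>O' | superpartition n m O'.
      of_int (super_kostka L O') * of_nat (sp_fact O') * monomial_sum n m O') A w"
  proof (cases "finite A \<and> 0 \<notin> A \<and> 0 \<notin> set w")
    case False
    then have "scoeff f A w = 0" for f using scoeff[of f] by auto
    then show ?thesis by simp
  next
    case True
    then have A: "finite A" "0 \<notin> A" and w: "0 \<notin> set w" by auto
    define r where "r = Max (insert 0 (A \<union> set w))"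
    have r: "x \<le> r" if "x \<in> A \<union> set w" for x
      unfolding r_def by (rule Max_ge) (use A that in auto)
    have lhs: "scoeff (super_schur L) A w =
        of_nat (stabilizer_size w) * of_int (signed_count (rev (content r A w)) L)"
      using scoeff_super_schur[OF L(1) A(1) r] A w by simp
    show ?thesis
    proof (cases "card A = m \<and> length w = n \<and> inj_on (count_list w) A")
      \<comment> \<open>Both coefficients vanish: on the left by the numbers of circles and boxes or
        by antisymmetry, on the right because no set superpartition of the given bidegree possessing
        a type contains this monomial.\<close>
      case False
      have "signed_count (rev (content r A w)) L = 0"
      proof (rule ccontr)
        assume nz: "signed_count (rev (content r A w)) L \<noteq> 0"
        have "card A = m" "length w = n"
          using signed_count_content_nonzero[OF L(1) A(2) w r nz] L by simp_all
        moreover have "inj_on (count_list w) A"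
          using content_zero[OF L(1) A w r] nz by blast
        ultimately show False using False by blast
      qed
      moreover have "scoeff (monomial_sum n m O') A w = 0" for O'
      proof -
        have "scoeff (super_monomial n m I) A w = 0"
          if I: "set_superpartition n m I" "ssp_type I = Some O'" for I
        proof (rule ccontr)
          assume "scoeff (super_monomial n m I) A w \<noteq> 0"
          then obtain a c where *: "I = blocks w a c" "ordered w a" "set a = A" "length a = m" "length w = n"
            using scoeff_super_monomial_nonzero[OF I(1)] by metis
          have "distinct (map (count_list w) a)"
            using I(2) unfolding *(1) ssp_type_blocks by (auto split: if_splits)
          moreover have "card A = m" using *(2-4) ordered_distinct distinct_card by metis
          ultimately show False using False *(3,5) by (simp add: distinct_map)
        qed
        then show ?thesis unfolding scoeff_monomial_sum by (intro sum.neutral) auto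
      qed
      ultimately show ?thesis unfolding rhs lhs by simp
    next
      case size: True
      \<comment> \<open>Letters occurring in \<open>w\<close> have different first positions, and
        two absent letters would both have multiplicity 0, which injectivity of the multiplicities
        excludes.\<close>
      have "inj_on (first_position w) A"
      proof (rule inj_onI)
        fix u v assume uv: "u \<in> A" "v \<in> A" "first_position w u = first_position w v"
        from first_position_eq[OF uv(3)] show "u = v"
        proof
          assume "u \<notin> set w \<and> v \<notin> set w"
          then have "count_list w u = count_list w v" by (simp add: count_list_0_iff[THEN iffD2])
          then show "u = v" using size uv(1,2) by (auto dest: inj_onD)
        qed
      qed
      then obtain a where a: "ordered w a" "set a = A" using ordered_exists[OF A(1)] by metis
      have "inj_on (first_position w) (set w - A)"
        by (rule inj_onI) (use first_position_eq in blast)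
      then obtain c where c: "ordered w c" "set c = set w - A"
        using ordered_exists[of "set w - A" w] by (metis finite_Diff finite_set)
      have da: "distinct a" and dc: "distinct c" using ordered_distinct a c by blast+
      have len: "length a = m" "length w = n" using size a(2) distinct_card[OF da] by auto
      have dist: "distinct (map (count_list w) a)" using size a(2) da by (simp add: distinct_map)
      let ?O = "(decreasing (map (count_list w) a), decreasing (map (count_list w) c))"
      let ?s = "(-1) ^ sort_length (map (count_list w) a) * (-1) ^ inversions a :: rat"
      have c': "set c = set w - set a" using c a by simp
      have sp: "superpartition n m ?O" by (rule superpartition_type[OF da dc c' len dist])
      have "mset (map (count_list w) c) = image_mset (count_list w) (mset_set (set w - set a))"
        using dc c' by (metis mset_map mset_set_set)
      then have signs: "signed_count (rev (content r A w)) L =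
          (-1) ^ sort_length (map (count_list w) a) * (-1) ^ inversions a * super_kostka L ?O"
        using content_value[OF L(1) da _ w, of r "map (count_list w) c"] A r a(2) by simp
      have "(\<Sum>O' | superpartition n m O'.
          of_int (super_kostka L O') * (of_nat (sp_fact O') * scoeff (monomial_sum n m O') A w)) =
          (\<Sum>O' \<in> {?O}. of_int (super_kostka L O') * (of_nat (sp_fact O') * scoeff (monomial_sum n m O') A w))"
        by (rule sum.mono_neutral_right)
          (use finite_superpartitions sp scoeff_monomial_sum_eq[OF a len(1) c len(2) A(2) w dist] in auto)
      also have "\<dots> = of_int (super_kostka L ?O) * (of_nat (sp_fact ?O) * ?s)"
        using scoeff_monomial_sum_eq[OF a len(1) c len(2) A(2) w dist, of ?O] by simp
      also have "\<dots> = of_nat (stabilizer_size w) * of_int (signed_count (rev (content r A w)) L)"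
        unfolding signs sp_fact_type[OF da dc c'] by simp
      finally show ?thesis unfolding rhs lhs by simp
    qed
  qed
qed

theorem proposition6p5:
  fixes n m :: nat and \<Lambda> :: spart
  assumes "superpartition n m \<Lambda>"
  shows "super_schur \<Lambda> =
    (\<Sum>\<Omega> | superpartition n m \<Omega>.
       of_int (super_kostka \<Lambda> \<Omega>) * of_nat (sp_fact \<Omega>) *
       (\<Sum>I | set_superpartition n m I \<and> ssp_type I = Some \<Omega>.
          (-1) ^ ssp_eps I * super_monomial n m I))"
  using super_schur_expansion[OF assms] unfolding monomial_sum_def .

end
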